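(* Let $n>2$ and $2^*=\frac{2n}{n-2}$. Let $b\in\mathbb{R}$ and assume that $\frac{n-2-b}{2}\notin\mathbb{Z}\setminus\{1,\dots,n-2\}$. Then there is a $C>0$, depending on $n$ and $b$, such that for every $u\in C_0^\infty(\mathbb{R}^n\setminus\{0\};\mathbb{C}^m)$, $$\int_{\mathbb{R}^n}|x|^{-b}|(\sigma\cdot\nabla)u|^2\,dx\ \ge\ C\left(\int_{\mathbb{R}^n}|x|^{-\beta}|u|^{2^*}\,dx\right)^{2/2^*},$$ where $\beta=\frac{bn}{n-2}$.
   Context: Let $m$ be a positive integer and let $\sigma_1,\dots,\sigma_n$ be Hermitian $m\times m$ complex matrices with $\sigma_i\sigma_j+\sigma_j\sigma_i=2\delta_{ij}I_m$ for $i,j=1,\dots,n$. Write $\sigma\cdot\nabla=\sum_{i=1}^n\sigma_i\partial_{x_i}$, and $|\cdot|$ for the Euclidean norm on $\mathbb{C}^m$. *)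

theory Defs
  imports "HOL-Analysis.Analysis" "Jordan_Normal_Form.Schur_Decomposition"
begin

text \<open>
  The domain \<open>\<real>\<^sup>n\<close> is \<^typ>\<open>real ^ 'n\<close>. Matrices and vectors over \<open>\<complex>\<close> are those of
  \<^theory>\<open>Jordan_Normal_Form.Matrix\<close>, so that the size \<open>m\<close> is a natural number that can be
  quantified inside a formula.
\<close>

definition vec_norm2 :: "complex vec \<Rightarrow> real" where
  "vec_norm2 v = L2_set (\<lambda>k. cmod (v $ k)) {..<dim_vec v}"

definition clifford_matrices :: "nat \<Rightarrow> ('n \<Rightarrow> complex mat) \<Rightarrow> bool" where
  "clifford_matrices m \<sigma> \<longleftrightarrow>
     (\<forall>i. \<sigma> i \<in> carrier_mat m m \<and> mat_adjoint (\<sigma> i) = \<sigma> i) \<and>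
     (\<forall>i j. \<sigma> i * \<sigma> j + \<sigma> j * \<sigma> i = (if i = j then 2 else 0) \<cdot>\<^sub>m 1\<^sub>m m)"

definition partial_deriv ::
  "'n::finite \<Rightarrow> (real ^ 'n \<Rightarrow> complex) \<Rightarrow> real ^ 'n \<Rightarrow> complex" where
  "partial_deriv i f x = frechet_derivative f (at x) (axis i 1)"

primrec Ck_on :: "nat \<Rightarrow> (real ^ 'n::finite) set \<Rightarrow> (real ^ 'n \<Rightarrow> complex) \<Rightarrow> bool" where
  "Ck_on 0 S f \<longleftrightarrow> continuous_on S f"
| "Ck_on (Suc k) S f \<longleftrightarrow>
     (\<forall>x\<in>S. f differentiable (at x)) \<and> (\<forall>i. Ck_on k S (partial_deriv i f))"

text \<open>
  \<open>C\<^sub>0\<^sup>\<infinity>(S; \<complex>\<^sup>m)\<close> for open \<open>S\<close>. The members are total functions on \<open>\<real>\<^sup>n\<close>; as the support is a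
  subset of \<open>S\<close>, they vanish outside \<open>S\<close>.
\<close>

definition test_functions ::
  "(real ^ 'n::finite) set \<Rightarrow> nat \<Rightarrow> (real ^ 'n \<Rightarrow> complex vec) set" where
  "test_functions S m =
     {u. (\<forall>x. u x \<in> carrier_vec m) \<and>
         (\<forall>j<m. \<forall>k. Ck_on k S (\<lambda>x. u x $ j)) \<and>
         compact (closure {x. u x \<noteq> 0\<^sub>v m}) \<and> closure {x. u x \<noteq> 0\<^sub>v m} \<subseteq> S}"

text \<open>The operator \<open>\<sigma> \<cdot> \<nabla>\<close>. The sum over the coordinates is taken entrywise.\<close>

definition dirac_op ::
  "nat \<Rightarrow> ('n::finite \<Rightarrow> complex mat) \<Rightarrow> (real ^ 'n \<Rightarrow> complex vec) \<Rightarrow> real ^ 'n \<Rightarrow> complex vec" where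
  "dirac_op m \<sigma> u x =
     vec m (\<lambda>j. \<Sum>i\<in>UNIV. (\<sigma> i *\<^sub>v vec m (\<lambda>k. partial_deriv i (\<lambda>y. u y $ k) x)) $ j)"

definition sobolev_exponent :: "nat \<Rightarrow> real" where
  "sobolev_exponent n = 2 * real n / (real n - 2)"

end

theory Submission
  imports Defs
begin

text \<open>
  Write \<open>n\<close> for the dimension, \<open>c x\<close> for the matrix \<open>\<sigma> \<cdot> x\<close>, \<open>D\<close> for \<open>\<sigma> \<cdot> \<nabla>\<close> and \<open>E = x \<cdot> \<nabla>\<close> for the
  Euler operator. The Clifford relations say \<open>c x (c x v) = |x|\<^sup>2 v\<close>, so that \<open>|c x v| = |x| |v|\<close>, and
  they give \<open>c x D = E - \<Gamma>\<close> with a first order operator \<open>\<Gamma>\<close> that differentiates only along spheres.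

  The heart is a Hardy inequality. With \<open>v = |x|\<^bsup>-b/2-1\<^esup> u\<close> one has
  \<open>|x|\<^bsup>-b\<^esup> |D u|\<^sup>2 = |(E + n/2) v - (\<Gamma> + \<kappa>) v|\<^sup>2\<close>, where \<open>\<kappa> = (n - 2 - b)/2\<close>. On \<open>L\<^sup>2\<close> the operator
  \<open>E + n/2\<close> is skew, \<open>\<Gamma>\<close> is symmetric, and the two commute; hence the cross term vanishes and
  \<open>\<integral> |x|\<^bsup>-b\<^esup> |D u|\<^sup>2 \<ge> \<integral> |(\<Gamma> + \<kappa>) v|\<^sup>2\<close>. The eigenvalues of \<open>\<Gamma>\<close> are the integers \<open>k \<ge> 0\<close> and
  \<open>k \<le> 1 - n\<close>, the degrees of homogeneity of the null solutions of \<open>D\<close> away from the origin, and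
  the hypothesis on \<open>b\<close> says exactly that \<open>-\<kappa>\<close> is none of them. So
  \<open>\<integral> |x|\<^bsup>-b\<^esup> |D u|\<^sup>2 \<ge> d\<^sup>2 \<integral> |x|\<^bsup>-b-2\<^esup> |u|\<^sup>2\<close> with \<open>d > 0\<close> (\<open>hardy_inequality\<close>).

  The spectral gap needs no analysis on the sphere. By induction on \<open>k\<close>, every homogeneous
  polynomial field of degree \<open>k\<close> is a sum of polynomial eigenfields of \<open>\<Gamma>\<close>
  (\<open>homogeneous_eigenfield_sum\<close>): the relation \<open>\<Gamma> c x = - c x (\<Gamma> + n - 1)\<close> carries a decomposition
  of \<open>D f\<close> to one of \<open>(k - \<Gamma>) f = c x D f\<close>. Eigenfields for different eigenvalues are orthogonal
  for every radial weight, so \<open>\<Gamma> + \<kappa>\<close> can be inverted on polynomials with norm at most \<open>1/d\<close>, and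
  polynomials are dense; duality transfers the bound to all fields (\<open>spectral_gap\<close>).

  The passage to the Sobolev norm uses \<open>w = |x|\<^bsup>-b/2\<^esup> u\<close>. Here \<open>D w\<close> is \<open>|x|\<^bsup>-b/2\<^esup> D u\<close> plus a term
  of size \<open>|b|/2 |x|\<^bsup>-b/2-1\<^esup> |u|\<close>, which the Hardy inequality controls; integration by parts gives
  \<open>\<integral> |D w|\<^sup>2 = \<integral> |\<nabla> w|\<^sup>2\<close> (\<open>integral_Dirac\<close>); and the Gagliardo-Nirenberg-Sobolev
  inequality (\<open>sobolev_inequality\<close>) bounds \<open>w\<close> in \<open>L\<^sup>q\<close>, where \<open>q = 2 n / (n - 2)\<close>.

  All fields take values in one real inner product space of finitely supported sequences, on
  which the matrices act blockwise. So the constant depends neither on \<open>m\<close> nor on \<open>\<sigma>\<close>.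
\<close>

section \<open>Partial derivatives, fields of class C1 and C2\<close>

(* The dot denotes the inner product of real inner product spaces throughout. *)
no_notation scalar_prod (infix "\<bullet>" 70)

definition pd :: "'a::euclidean_space \<Rightarrow> ('a \<Rightarrow> 'v::real_normed_vector) \<Rightarrow> 'a \<Rightarrow> 'v" where
  "pd b f x = frechet_derivative f (at x) b"

text \<open>
  Differentiability is required separately from continuity of the partial derivatives, since
  the Frechet derivative is an arbitrary map where no derivative exists.
\<close>

definition C1 :: "('a::euclidean_space \<Rightarrow> 'v::real_normed_vector) \<Rightarrow> bool" where
  "C1 f \<longleftrightarrow> (\<forall>x. f differentiable (at x)) \<and> (\<forall>b\<in>Basis. continuous_on UNIV (pd b f))"

definition C2 :: "('a::euclidean_space \<Rightarrow> 'v::real_normed_vector) \<Rightarrow> bool" where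
  "C2 f \<longleftrightarrow> (\<forall>x. f differentiable (at x)) \<and> (\<forall>b\<in>Basis. C1 (pd b f))"

definition csupp :: "('a::euclidean_space \<Rightarrow> 'v::real_normed_vector) \<Rightarrow> bool" where
  "csupp f \<longleftrightarrow> (\<exists>R. \<forall>x. R < norm x \<longrightarrow> f x = 0)"

lemma pd_eq: "(f has_derivative f') (at x) \<Longrightarrow> pd b f x = f' b"
  unfolding pd_def using frechet_derivative_at by metis

lemma has_derivative_pd: "f differentiable (at x) \<Longrightarrow> (f has_derivative (\<lambda>h. pd h f x)) (at x)"
  unfolding pd_def using frechet_derivative_works by (metis (no_types, lifting) eta_contract_eq)

lemma pd_cong_open:
  assumes "open S" "x \<in> S" "\<And>y. y \<in> S \<Longrightarrow> f y = g y" "f differentiable (at x)"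
  shows "pd b f x = pd b g x" "g differentiable (at x)"
proof -
  have "(g has_derivative (\<lambda>h. pd h f x)) (at x)"
    using has_derivative_transform_within_open[OF has_derivative_pd[OF assms(4)] assms(1,2)] assms(3) by auto
  then show "pd b f x = pd b g x" "g differentiable (at x)"
    by (auto simp: pd_eq differentiable_def)
qed

lemma pd_const [simp]: "pd b (\<lambda>x. k) x = 0"
  by (rule pd_eq[where f'="\<lambda>h. 0"]) simp

lemma pd_add: "f differentiable (at x) \<Longrightarrow> g differentiable (at x) \<Longrightarrow>
    pd b (\<lambda>x. f x + g x) x = pd b f x + pd b g x"
  by (rule pd_eq) (intro derivative_intros has_derivative_pd)

lemma pd_diff: "f differentiable (at x) \<Longrightarrow> g differentiable (at x) \<Longrightarrow>
    pd b (\<lambda>x. f x - g x) x = pd b f x - pd b g x"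
  by (rule pd_eq) (intro derivative_intros has_derivative_pd)

lemma pd_sum: "(\<And>i. i \<in> I \<Longrightarrow> f i differentiable (at x)) \<Longrightarrow>
    pd b (\<lambda>x. \<Sum>i\<in>I. f i x) x = (\<Sum>i\<in>I. pd b (f i) x)"
  by (rule pd_eq) (intro derivative_intros has_derivative_pd)

lemma pd_scaleR: "f differentiable (at x) \<Longrightarrow> g differentiable (at x) \<Longrightarrow>
    pd b (\<lambda>x. f x *\<^sub>R g x) x = pd b f x *\<^sub>R g x + f x *\<^sub>R pd b g x"
  by (subst pd_eq, rule has_derivative_scaleR, (erule has_derivative_pd)+) simp

lemma pd_mult:
  fixes f g :: "'a::euclidean_space \<Rightarrow> real"
  shows "f differentiable (at x) \<Longrightarrow> g differentiable (at x) \<Longrightarrow>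
    pd b (\<lambda>x. f x * g x) x = pd b f x * g x + f x * pd b g x"
  using pd_scaleR[of f x g b] by simp

lemma pd_inner: "f differentiable (at x) \<Longrightarrow> g differentiable (at x) \<Longrightarrow>
    pd b (\<lambda>x. f x \<bullet> g x) x = pd b f x \<bullet> g x + f x \<bullet> pd b g x"
  by (subst pd_eq, rule has_derivative_inner, (erule has_derivative_pd)+) simp

lemma pd_linear: "bounded_linear L \<Longrightarrow> f differentiable (at x) \<Longrightarrow>
    pd b (\<lambda>x. L (f x)) x = L (pd b f x)"
  by (rule pd_eq, rule bounded_linear.has_derivative, assumption, erule has_derivative_pd)

lemma pd_coord [simp]: "pd b (\<lambda>x. x \<bullet> d) x = b \<bullet> d"
  by (rule pd_eq) (auto intro!: derivative_eq_intros)

lemma differentiable_inner':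
  fixes f g :: "'a::euclidean_space \<Rightarrow> 'v::real_inner"
  assumes "f differentiable (at x)" "g differentiable (at x)"
  shows "(\<lambda>x. f x \<bullet> g x) differentiable (at x)"
  using has_derivative_inner[OF has_derivative_pd[OF assms(1)] has_derivative_pd[OF assms(2)]]
  by (auto simp: differentiable_def)

lemma differentiable_linear':
  fixes f :: "'a::euclidean_space \<Rightarrow> 'v::real_normed_vector"
  assumes "bounded_linear L" "f differentiable (at x)"
  shows "(\<lambda>x. L (f x)) differentiable (at x)"
  using bounded_linear.has_derivative[OF assms(1) has_derivative_pd[OF assms(2)]]
  by (auto simp: differentiable_def)

lemma differentiable_coord [simp]: "(\<lambda>x::'a::euclidean_space. x \<bullet> d) differentiable (at x)"
  by (rule differentiable_inner') simp_all

lemma pd_sum_Basis: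
  assumes "f differentiable (at x)"
  shows "pd h f x = (\<Sum>b\<in>Basis. (h \<bullet> b) *\<^sub>R pd b f x)"
proof -
  have L: "linear (\<lambda>h. pd h f x)"
    using has_derivative_pd[OF assms] has_derivative_linear by blast
  have "pd h f x = pd (\<Sum>b\<in>Basis. (h \<bullet> b) *\<^sub>R b) f x"
    by (simp add: euclidean_representation)
  also have "\<dots> = (\<Sum>b\<in>Basis. (h \<bullet> b) *\<^sub>R pd b f x)"
    using linear_sum[OF L, of "\<lambda>b. (h \<bullet> b) *\<^sub>R b" Basis] linear_scale[OF L] by simp
  finally show ?thesis .
qed

lemma C1D: "C1 f \<Longrightarrow> f differentiable (at x)" and C1_pd: "C1 f \<Longrightarrow> b \<in> Basis \<Longrightarrow> continuous_on UNIV (pd b f)"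
  by (auto simp: C1_def)

lemma C1_continuous: "C1 f \<Longrightarrow> continuous_on S f"
  by (meson C1_def differentiable_imp_continuous_within continuous_at_imp_continuous_on)

lemma C2D: "C2 f \<Longrightarrow> f differentiable (at x)" and C2_pd: "C2 f \<Longrightarrow> b \<in> Basis \<Longrightarrow> C1 (pd b f)"
  by (auto simp: C2_def)

lemma C2_C1: "C2 f \<Longrightarrow> C1 f"
  by (auto simp: C1_def C2_def C1_continuous)

lemma C1_const [simp]: "C1 (\<lambda>x. k)"
  by (auto simp: C1_def)

lemma C1_coord [simp]: "C1 (\<lambda>x. x \<bullet> d)"
  by (auto simp: C1_def)

lemma C1I:
  assumes "\<And>x. f differentiable (at x)" "\<And>b x. b \<in> Basis \<Longrightarrow> pd b f x = g b x"
    "\<And>b. b \<in> Basis \<Longrightarrow> continuous_on UNIV (g b)"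
  shows "C1 f"
proof -
  have "pd b f = g b" if "b \<in> Basis" for b using assms(2)[OF that] by blast
  then show ?thesis using assms(1,3) by (simp add: C1_def)
qed

lemma C1_add:
  assumes "C1 f" "C1 g" shows "C1 (\<lambda>x. f x + g x)"
  by (rule C1I, rule differentiable_add[OF C1D[OF assms(1)] C1D[OF assms(2)]],
      rule pd_add[OF C1D[OF assms(1)] C1D[OF assms(2)]])
    (intro continuous_intros C1_pd assms)

lemma C1_diff:
  assumes "C1 f" "C1 g" shows "C1 (\<lambda>x. f x - g x)"
  by (rule C1I, rule differentiable_diff[OF C1D[OF assms(1)] C1D[OF assms(2)]],
      rule pd_diff[OF C1D[OF assms(1)] C1D[OF assms(2)]])
    (intro continuous_intros C1_pd assms)

lemma C1_sum: "(\<And>i. i \<in> I \<Longrightarrow> C1 (f i)) \<Longrightarrow> C1 (\<lambda>x. \<Sum>i\<in>I. f i x)"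
  by (induction I rule: infinite_finite_induct) (simp_all add: C1_add)

lemma C1_scaleR:
  assumes "C1 f" "C1 g" shows "C1 (\<lambda>x. f x *\<^sub>R g x)"
  by (rule C1I, rule differentiable_scaleR[OF C1D[OF assms(1)] C1D[OF assms(2)]],
      rule pd_scaleR[OF C1D[OF assms(1)] C1D[OF assms(2)]])
    (intro continuous_on_add continuous_on_scaleR C1_pd C1_continuous assms, assumption+)

lemma C1_mult:
  fixes f g :: "'a::euclidean_space \<Rightarrow> real"
  shows "C1 f \<Longrightarrow> C1 g \<Longrightarrow> C1 (\<lambda>x. f x * g x)"
  using C1_scaleR[of f g] by simp

lemma C1_inner:
  assumes "C1 f" "C1 g" shows "C1 (\<lambda>x. f x \<bullet> g x)"
  by (rule C1I, rule differentiable_inner'[OF C1D[OF assms(1)] C1D[OF assms(2)]],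
      rule pd_inner[OF C1D[OF assms(1)] C1D[OF assms(2)]])
    (intro continuous_on_add continuous_on_inner C1_pd C1_continuous assms, assumption+)

lemma C1_linear:
  assumes "bounded_linear L" "C1 f" shows "C1 (\<lambda>x. L (f x))"
  by (rule C1I, rule differentiable_linear'[OF assms(1) C1D[OF assms(2)]],
      rule pd_linear[OF assms(1) C1D[OF assms(2)]])
    (intro bounded_linear.continuous_on[OF assms(1)] C1_pd assms)

lemma C2_linear: "bounded_linear L \<Longrightarrow> C2 f \<Longrightarrow> C2 (\<lambda>x. L (f x))"
proof -
  assume L: "bounded_linear L" and f: "C2 f"
  have "pd b (\<lambda>x. L (f x)) = (\<lambda>x. L (pd b f x))" for b
    by (rule ext) (simp add: pd_linear L C2D f)
  then show ?thesis using L f by (auto simp: C2_def differentiable_linear' C1_linear)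
qed

lemma C2_add: "C2 f \<Longrightarrow> C2 g \<Longrightarrow> C2 (\<lambda>x. f x + g x)"
proof -
  assume f: "C2 f" and g: "C2 g"
  have "pd b (\<lambda>x. f x + g x) = (\<lambda>x. pd b f x + pd b g x)" for b
    by (rule ext) (simp add: pd_add C2D f g)
  then show ?thesis using f g by (simp add: C2_def differentiable_add C1_add)
qed

lemma C2_const: "C2 (\<lambda>x::'a::euclidean_space. k)"
proof -
  have "pd b (\<lambda>x::'a. k) = (\<lambda>x. 0)" for b by (rule ext) simp
  then show ?thesis by (simp add: C2_def)
qed

lemma C2_sum: "(\<And>i. i \<in> I \<Longrightarrow> C2 (f i)) \<Longrightarrow> C2 (\<lambda>x. \<Sum>i\<in>I. f i x)"
  by (induction I rule: infinite_finite_induct) (simp_all add: C2_add C2_const)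

lemma csuppE:
  assumes "csupp f"
  obtains R where "\<And>x. R < norm x \<Longrightarrow> f x = 0"
  using assms unfolding csupp_def by blast

lemma csuppI: "(\<And>x. R < norm x \<Longrightarrow> f x = 0) \<Longrightarrow> csupp f"
  unfolding csupp_def by blast

lemma csupp_pd: "csupp f \<Longrightarrow> csupp (pd b f)"
proof -
  assume "csupp f"
  then obtain R where R: "\<And>x. R < norm x \<Longrightarrow> f x = 0" using csuppE by blast
  have "pd b f x = 0" if "R < norm x" for x
  proof -
    have "open {x::'a. R < norm x}" by (intro open_Collect_less continuous_intros)
    from pd_cong_open(1)[OF this, of x "\<lambda>_. 0" f b] that R show ?thesis by simp
  qed
  then show ?thesis by (rule csuppI)
qed

lemma csupp_0:
  assumes "csupp f" "\<And>x. f x = 0 \<Longrightarrow> g x = 0"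
  shows "csupp g"
proof -
  obtain R where R: "\<And>x. R < norm x \<Longrightarrow> f x = 0" using csuppE[OF assms(1)] by blast
  show ?thesis by (rule csuppI[of R]) (simp add: R assms(2))
qed

lemma csupp_add:
  assumes "csupp f" "csupp g" shows "csupp (\<lambda>x. f x + g x)"
proof -
  obtain R where "\<And>x. R < norm x \<Longrightarrow> f x = 0" using csuppE[OF assms(1)] by blast
  moreover obtain S where "\<And>x. S < norm x \<Longrightarrow> g x = 0" using csuppE[OF assms(2)] by blast
  ultimately
show ?thesis by (intro csuppI[of "max R S"]) simp
qed

lemma csupp_sum: "(\<And>i. i \<in> I \<Longrightarrow> csupp (f i)) \<Longrightarrow> csupp (\<lambda>x. \<Sum>i\<in>I. f i x)"
  by (induction I rule: infinite_finite_induct) (simp_all add: csupp_add csupp_def[of "\<lambda>_. 0"])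

section \<open>Integration by parts and symmetry of second derivatives\<close>

lemma integrable_csupp:
  fixes f :: "'a::euclidean_space \<Rightarrow> real"
  assumes "continuous_on UNIV f" "csupp f"
  shows "integrable lborel f"
proof -
  obtain R where R: "\<And>x. R < norm x \<Longrightarrow> f x = 0" using csuppE assms by blast
  have "integrable lborel (\<lambda>x. indicator (cball 0 R) x *\<^sub>R f x)"
    by (rule borel_integrable_compact) (auto intro: continuous_on_subset[OF assms(1)])
  also have "(\<lambda>x. indicator (cball 0 R) x *\<^sub>R f x) = f"
    using R by (auto simp: fun_eq_iff indicator_def not_le)
  finally show ?thesis .
qed

lemma bounded_csupp:
  fixes f :: "'a::euclidean_space \<Rightarrow> 'v::real_normed_vector"
  assumes "continuous_on UNIV f" "csupp f"
  obtains M where "\<And>x. norm (f x) \<le> M"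
proof -
  obtain R where R: "\<And>x. R < norm x \<Longrightarrow> f x = 0" using csuppE assms by blast
  have "compact (f ` cball 0 R)"
    by (intro compact_continuous_image continuous_on_subset[OF assms(1)]) auto
  then have "bounded (f ` cball 0 R)" by (rule compact_imp_bounded)
  then obtain M where M: "\<forall>x\<in>cball 0 R. norm (f x) \<le> M"
    unfolding bounded_iff by blast
  have "norm (f x) \<le> max M 0" for x
  proof (cases "R < norm x")
    case False
    then have "norm (f x) \<le> M" using M by simp
    then show ?thesis by simp
  qed (simp add: R)
  then show ?thesis using that by blast
qed

lemma has_vector_derivative_line:
  assumes "f differentiable (at (y + t *\<^sub>R b))"
  shows "((\<lambda>t. f (y + t *\<^sub>R b)) has_vector_derivative pd b f (y + t *\<^sub>R b)) (at t within S)"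
proof -
  have "((\<lambda>t. y + t *\<^sub>R b) has_derivative (\<lambda>h. h *\<^sub>R b)) (at t within S)"
    by (auto intro!: derivative_eq_intros)
  from has_derivative_compose[OF this has_derivative_pd[OF assms]]
  have "((\<lambda>t. f (y + t *\<^sub>R b)) has_derivative (\<lambda>h. pd (h *\<^sub>R b) f (y + t *\<^sub>R b))) (at t within S)" .
  moreover have "pd (h *\<^sub>R b) f (y + t *\<^sub>R b) = h *\<^sub>R pd b f (y + t *\<^sub>R b)" for h
    using has_derivative_linear[OF has_derivative_pd[OF assms]] by (rule linear_scale)
  ultimately show ?thesis by (simp add: has_vector_derivative_def)
qed

lemma has_real_derivative_line:
  fixes f :: "'a::euclidean_space \<Rightarrow> real"
  assumes "f differentiable (at (y + t *\<^sub>R b))"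
  shows "((\<lambda>t. f (y + t *\<^sub>R b)) has_real_derivative pd b f (y + t *\<^sub>R b)) (at t within S)"
  using has_vector_derivative_line[OF assms] by (simp add: has_real_derivative_iff_has_vector_derivative)

lemma integral_lborel_translate:
  fixes f :: "'a::euclidean_space \<Rightarrow> real"
  assumes "f \<in> borel_measurable borel"
  shows "integral\<^sup>L lborel (\<lambda>x. f (x + k)) = integral\<^sup>L lborel f"
proof -
  have "integral\<^sup>L lborel f = integral\<^sup>L (distr lborel borel ((+) k)) f"
    by (simp add: lborel_distr_plus)
  also have "\<dots> = integral\<^sup>L lborel (\<lambda>x. f (k + x))"
    by (rule integral_distr) (use assms in auto)
  finally show ?thesis by (simp add: add.commute)
qed

text \<open>
  The integral is translation invariant, so all difference quotients of \<open>F\<close> integrate to zero;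
  they converge boundedly to the derivative.
\<close>

lemma integral_pd:
  fixes F :: "'a::euclidean_space \<Rightarrow> real"
  assumes F: "C1 F" "csupp F" and b: "b \<in> Basis"
  shows "integral\<^sup>L lborel (pd b F) = 0"
proof -
  define s where "s n x = (F (x + inverse (real (Suc n)) *\<^sub>R b) - F x) * real (Suc n)" for n x
  have cF: "continuous_on UNIV F" using F C1_continuous by blast
  have cp: "continuous_on UNIV (pd b F)" using F b C1_pd by blast
  obtain M where M: "\<And>x. norm (pd b F x) \<le> M" using bounded_csupp[OF cp csupp_pd[OF F(2)]] by blast
  obtain R where R: "\<And>x. R < norm x \<Longrightarrow> F x = 0" using csuppE[OF F(2)] by blast
  \<comment> \<open>A shift by at most one moves the support into the ball of radius \<open>R + 1\<close>; inside, the mean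
    value theorem bounds the quotient by the supremum of the derivative.\<close>
  have bnd: "\<bar>s n x\<bar> \<le> M * indicator (cball 0 (R+1)) x" for n x
  proof (cases "norm x > R + 1")
    case True
    define h where "h = inverse (real (Suc n))"
    have h: "0 < h" "h \<le> 1" by (auto simp: h_def field_simps)
    have "norm x \<le> norm (x + h *\<^sub>R b) + norm (h *\<^sub>R b)"
      by (metis add_diff_cancel_right' norm_triangle_ineq4)
    moreover have "norm (h *\<^sub>R b) \<le> 1" using h b by simp
    ultimately have "norm (x + h *\<^sub>R b) > R" using True by linarith
    then have "F (x + h *\<^sub>R b) = 0" "F x = 0" using R True by auto
    then show ?thesis using True unfolding s_def h_def[symmetric] by simp
  next
    case False
    define h where "h = inverse (real (Suc n))"
    have h: "0 < h" by (auto simp: h_def)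
    have "\<exists>z>0. z < h \<and> F (x + h *\<^sub>R b) - F (x + 0 *\<^sub>R b) = (h - 0) * pd b F (x + z *\<^sub>R b)"
      by (rule MVT2) (use h F in \<open>auto intro!: has_real_derivative_line C1D\<close>)
    then obtain z where "F (x + h *\<^sub>R b) - F x = h * pd b F (x + z *\<^sub>R b)" by auto
    then have "s n x = pd b F (x + z *\<^sub>R b)" unfolding s_def h_def[symmetric] by (simp add: h_def)
    then show ?thesis using False M[of "x + z *\<^sub>R b"] by simp
  qed
  have sm: "s n \<in> borel_measurable borel" for n
    unfolding s_def by (intro borel_measurable_continuous_onI continuous_intros continuous_on_compose2[OF cF]) auto
  have lim: "(\<lambda>n. s n x) \<longlonglongrightarrow> pd b F x" for x
  proof -
    have "((\<lambda>t. F (x + t *\<^sub>R b)) has_real_derivative pd b F (x + 0 *\<^sub>R b)) (at 0)"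
      by (rule has_real_derivative_line) (use F C1D in blast)
    then have "(\<lambda>h. (F (x + h *\<^sub>R b) - F x) / h) \<midarrow>0\<rightarrow> pd b F x" by (simp add: DERIV_def)
    moreover have "filterlim (\<lambda>n. inverse (real (Suc n))) (at 0) sequentially"
      using LIMSEQ_inverse_real_of_nat by (auto simp: filterlim_at)
    ultimately have "(\<lambda>n. (F (x + inverse (real (Suc n)) *\<^sub>R b) - F x) / inverse (real (Suc n))) \<longlonglongrightarrow> pd b F x"
      by (rule filterlim_compose)
    then show ?thesis by (simp add: s_def divide_inverse)
  qed
  have iF: "integrable lborel F" using integrable_csupp cF F by blast
  have i0: "integral\<^sup>L lborel (s n) = 0" for n
  proof -
    have 1: "integral\<^sup>L lborel (\<lambda>x. F (x + inverse (real (Suc n)) *\<^sub>R b)) = integral\<^sup>L lborel F"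
      by (rule integral_lborel_translate) (use cF borel_measurable_continuous_onI in blast)
    have 2: "integrable lborel (\<lambda>x. F (x + inverse (real (Suc n)) *\<^sub>R b))"
    proof -
      have "integrable (distr lborel borel ((+) (inverse (real (Suc n)) *\<^sub>R b))) F"
        using iF by (simp add: lborel_distr_plus)
      then show ?thesis
        by (subst (asm) integrable_distr_eq) (use cF borel_measurable_continuous_onI in \<open>auto simp: add.commute\<close>)
    qed
    show ?thesis unfolding s_def using 1 2 iF by simp
  qed
  have "(\<lambda>n. integral\<^sup>L lborel (s n)) \<longlonglongrightarrow> integral\<^sup>L lborel (pd b F)"
  proof (rule integral_dominated_convergence[where w="\<lambda>x. M * indicator (cball 0 (R+1)) x"])
    show "integrable lborel (\<lambda>x::'a. M * indicator (cball 0 (R+1)) x)"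
      using emeasure_lborel_cball_finite[of "0::'a" "R+1"] by (intro integrable_mult_right) (auto intro!: integrable_real_indicator)
  qed (use bnd lim sm cp borel_measurable_continuous_onI in auto)
  then show ?thesis using i0 LIMSEQ_unique by (simp add: LIMSEQ_const_iff)
qed

lemma integral_pd_inner_parts:
  fixes f g :: "'a::euclidean_space \<Rightarrow> 'v::real_inner"
  assumes f: "C1 f" and g: "C1 g" and s: "csupp f" and b: "b \<in> Basis"
  shows "integral\<^sup>L lborel (\<lambda>x. pd b f x \<bullet> g x) = - integral\<^sup>L lborel (\<lambda>x. f x \<bullet> pd b g x)"
proof -
  have c: "continuous_on UNIV f" "continuous_on UNIV g" "continuous_on UNIV (pd b f)" "continuous_on UNIV (pd b g)"
    using f g b by (auto intro: C1_continuous C1_pd)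
  have "integral\<^sup>L lborel (pd b (\<lambda>x. f x \<bullet> g x)) = 0"
    by (rule integral_pd) (use f g b in \<open>auto intro: C1_inner csupp_0[OF s]\<close>)
  also have "pd b (\<lambda>x. f x \<bullet> g x) = (\<lambda>x. pd b f x \<bullet> g x + f x \<bullet> pd b g x)"
    using pd_inner C1D f g by blast
  also have "integral\<^sup>L lborel \<dots> = integral\<^sup>L lborel (\<lambda>x. pd b f x \<bullet> g x) + integral\<^sup>L lborel (\<lambda>x. f x \<bullet> pd b g x)"
    by (rule Bochner_Integration.integral_add)
      (intro integrable_csupp continuous_on_inner c csupp_0[OF csupp_pd[OF s, of b]] csupp_0[OF s]; simp)+
  finally show ?thesis by simp
qed

text \<open>
  The mixed second difference is symmetric in \<open>a\<close> and \<open>b\<close>, while the mean value theorem, applied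
  in the direction \<open>a\<close> and then in \<open>b\<close>, expresses it by one of the two mixed derivatives at a
  nearby point. Letting \<open>h\<close> tend to zero gives Schwarz's theorem.
\<close>

lemma mixed_difference_MVT:
  fixes f :: "'a::euclidean_space \<Rightarrow> real"
  assumes f: "C2 f" and b: "b \<in> Basis" "a \<in> Basis" and h: "h > 0"
  obtains s t where "0 < s" "s < h" "0 < t" "t < h"
    "f (x + h *\<^sub>R a + h *\<^sub>R b) - f (x + h *\<^sub>R a) - f (x + h *\<^sub>R b) + f x
       = h * h * pd b (pd a f) (x + s *\<^sub>R a + t *\<^sub>R b)"
proof -
  have D: "((\<lambda>s. f (x + h *\<^sub>R b + s *\<^sub>R a) - f (x + s *\<^sub>R a)) has_real_derivative
      pd a f (x + h *\<^sub>R b + s *\<^sub>R a) - pd a f (x + s *\<^sub>R a)) (at s)" for s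
    by (intro derivative_intros has_real_derivative_line C2D f)
  have "\<exists>z>0. z < h \<and> (f (x + h *\<^sub>R b + h *\<^sub>R a) - f (x + h *\<^sub>R a)) - (f (x + h *\<^sub>R b + 0 *\<^sub>R a) - f (x + 0 *\<^sub>R a)) =
     (h - 0) * (pd a f (x + h *\<^sub>R b + z *\<^sub>R a) - pd a f (x + z *\<^sub>R a))"
    by (rule MVT2) (use h D in auto)
  then obtain s where s: "0 < s" "s < h" and 1: "(f (x + h *\<^sub>R b + h *\<^sub>R a) - f (x + h *\<^sub>R a)) - (f (x + h *\<^sub>R b) - f x) =
     h * (pd a f (x + h *\<^sub>R b + s *\<^sub>R a) - pd a f (x + s *\<^sub>R a))" by auto
  have D2: "((\<lambda>t. pd a f (x + s *\<^sub>R a + t *\<^sub>R b)) has_real_derivative pd b (pd a f) (x + s *\<^sub>R a + t *\<^sub>R b)) (at t)" for t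
    by (intro has_real_derivative_line C1D C2_pd f b)
  have "\<exists>z>0. z < h \<and> pd a f (x + s *\<^sub>R a + h *\<^sub>R b) - pd a f (x + s *\<^sub>R a + 0 *\<^sub>R b) = (h - 0) * pd b (pd a f) (x + s *\<^sub>R a + z *\<^sub>R b)"
    by (rule MVT2) (use h D2 in auto)
  then obtain t where t: "0 < t" "t < h" and 2: "pd a f (x + s *\<^sub>R a + h *\<^sub>R b) - pd a f (x + s *\<^sub>R a) = h * pd b (pd a f) (x + s *\<^sub>R a + t *\<^sub>R b)"
    by auto
  show ?thesis
    by (rule that[OF s t]) (use 1 2 in \<open>simp add: algebra_simps\<close>)
qed

lemma pd_commute_real:
  fixes f :: "'a::euclidean_space \<Rightarrow> real"
  assumes f: "C2 f" and b: "b \<in> Basis" "a \<in> Basis"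
  shows "pd a (pd b f) x = pd b (pd a f) x"
proof -
  have *: "\<exists>u v. norm (u - x) \<le> 2 * h \<and> norm (v - x) \<le> 2 * h \<and> pd a (pd b f) u = pd b (pd a f) v" if h: "h > 0" for h
  proof -
    obtain s t where 1: "0 < s" "s < h" "0 < t" "t < h"
      "f (x + h *\<^sub>R a + h *\<^sub>R b) - f (x + h *\<^sub>R a) - f (x + h *\<^sub>R b) + f x
       = h * h * pd b (pd a f) (x + s *\<^sub>R a + t *\<^sub>R b)" using mixed_difference_MVT[OF f b h] by blast
    obtain s' t' where 2: "0 < s'" "s' < h" "0 < t'" "t' < h"
      "f (x + h *\<^sub>R b + h *\<^sub>R a) - f (x + h *\<^sub>R b) - f (x + h *\<^sub>R a) + f x
       = h * h * pd a (pd b f) (x + s' *\<^sub>R b + t' *\<^sub>R a)" using mixed_difference_MVT[OF f b(2,1) h] by blast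
    have n: "norm (p *\<^sub>R d + q *\<^sub>R e) \<le> 2 * h" if "0 < p" "p < h" "0 < q" "q < h" "d \<in> Basis" "e \<in> Basis" for p q and d e :: 'a
      using norm_triangle_ineq[of "p *\<^sub>R d" "q *\<^sub>R e"] that by simp
    have "h * h * pd a (pd b f) (x + s' *\<^sub>R b + t' *\<^sub>R a) = h * h * pd b (pd a f) (x + s *\<^sub>R a + t *\<^sub>R b)"
      unfolding 1(5)[symmetric] 2(5)[symmetric] by (simp add: add.commute add.left_commute)
    then have "pd a (pd b f) (x + s' *\<^sub>R b + t' *\<^sub>R a) = pd b (pd a f) (x + s *\<^sub>R a + t *\<^sub>R b)"
      using h by simp
    then show ?thesis using n 1 2 b
      by (intro exI[of _ "x + s' *\<^sub>R b + t' *\<^sub>R a"] exI[of _ "x + s *\<^sub>R a + t *\<^sub>R b"]) (auto simp: algebra_simps)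
  qed
  then have "\<forall>n. \<exists>u v. norm (u - x) \<le> 2 * inverse (real (Suc n)) \<and> norm (v - x) \<le> 2 * inverse (real (Suc n)) \<and> pd a (pd b f) u = pd b (pd a f) v"
    by simp
  then obtain u v where uv: "\<And>n. norm (u n - x) \<le> 2 * inverse (real (Suc n))" "\<And>n. norm (v n - x) \<le> 2 * inverse (real (Suc n))"
     "\<And>n. pd a (pd b f) (u n) = pd b (pd a f) (v n)" by metis
  have L: "(\<lambda>n. 2 * inverse (real (Suc n))) \<longlonglongrightarrow> 0"
    using tendsto_mult[OF tendsto_const[of "2::real"] LIMSEQ_inverse_real_of_nat] by simp
  have "u \<longlonglongrightarrow> x" "v \<longlonglongrightarrow> x"
    by (rule LIM_zero_cancel, rule Lim_null_comparison[OF _ L], use uv in auto)+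
  moreover have "isCont (pd a (pd b f)) x" "isCont (pd b (pd a f)) x"
    using C1_pd[OF C2_pd[OF f b(1)] b(2)] C1_pd[OF C2_pd[OF f b(2)] b(1)]
    by (auto simp: continuous_on_eq_continuous_at)
  ultimately have "(\<lambda>n. pd a (pd b f) (u n)) \<longlonglongrightarrow> pd a (pd b f) x" "(\<lambda>n. pd b (pd a f) (v n)) \<longlonglongrightarrow> pd b (pd a f) x"
    by (auto intro: isCont_tendsto_compose)
  then show ?thesis using uv(3) LIMSEQ_unique by simp
qed

text \<open>
  Reduction to the real case: pair the field with the difference of its two mixed derivatives
  at the given point.
\<close>

lemma pd_commute:
  fixes f :: "'a::euclidean_space \<Rightarrow> 'v::real_inner"
  assumes f: "C2 f" and b: "b \<in> Basis" "a \<in> Basis"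
  shows "pd a (pd b f) x = pd b (pd a f) x"
proof -
  define e where "e = pd a (pd b f) x - pd b (pd a f) x"
  let ?L = "\<lambda>v. v \<bullet> e"
  have L: "bounded_linear ?L" by (rule bounded_linear_inner_left)
  have 1: "pd d (\<lambda>x. ?L (f x)) = (\<lambda>x. ?L (pd d f x))" for d
    by (rule ext) (simp add: pd_linear[OF L] C2D f)
  have "pd a (pd b (\<lambda>x. ?L (f x))) x = pd b (pd a (\<lambda>x. ?L (f x))) x"
    by (rule pd_commute_real) (use C2_linear[OF L f] b in auto)
  then have "?L (pd a (pd b f) x) = ?L (pd b (pd a f) x)"
    unfolding 1 using b f by (simp add: pd_linear[OF L] C1D C2_pd)
  then have "e \<bullet> e = 0" by (simp add: e_def inner_diff_left)
  then show ?thesis by (simp add: e_def)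
qed

section \<open>Hoelder's and Gagliardo's inequalities\<close>

text \<open>
  Powers of extended reals with exponents \<open>a \<ge> 0\<close>. The value at exponent zero is one everywhere,
  also at the base zero, where \<open>powr\<close> has value zero; this keeps the law of exponents valid for
  all exponents \<open>\<ge> 0\<close>, and it lets a factor with exponent zero drop out of a product.
\<close>

definition ennreal_powr :: "real \<Rightarrow> ennreal \<Rightarrow> ennreal" where
  "ennreal_powr a x = (if a = 0 then 1 else if x = top_class.top then top_class.top else ennreal (enn2real x powr a))"

lemma ennreal_powr_0 [simp]: "ennreal_powr 0 x = 1" by (simp add: ennreal_powr_def)

lemma ennreal_powr_zero [simp]: "a \<noteq> 0 \<Longrightarrow> ennreal_powr a 0 = 0" by (simp add: ennreal_powr_def)

lemma ennreal_powr_ennreal: "a \<noteq> 0 \<Longrightarrow> 0 \<le> r \<Longrightarrow> ennreal_powr a (ennreal r) = ennreal (r powr a)"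
  by (simp add: ennreal_powr_def)

lemma ennreal_powr_eq_0: "ennreal_powr a x = 0 \<Longrightarrow> x = 0"
  by (auto simp: ennreal_powr_def ennreal_eq_0_iff enn2real_eq_0_iff split: if_splits)

lemma ennreal_powr_add:
  assumes "a \<ge> 0" "b \<ge> 0"
  shows "ennreal_powr (a + b) x = ennreal_powr a x * ennreal_powr b x"
  using assms by (cases "a = 0"; cases "b = 0")
    (auto simp: ennreal_powr_def powr_add ennreal_mult ennreal_top_mult add_nonneg_eq_0_iff)

lemma ennreal_powr_mono:
  assumes "a \<ge> 0" "x \<le> y" shows "ennreal_powr a x \<le> ennreal_powr a y"
proof -
  have "enn2real x powr a \<le> enn2real y powr a" if "y \<noteq> top_class.top"
    by (intro powr_mono2 enn2real_mono) (use assms that in \<open>auto simp: top.not_eq_extremum\<close>)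
  moreover have "x \<noteq> top_class.top" if "y \<noteq> top_class.top" using assms(2) that by (auto simp: top_unique)
  ultimately show ?thesis by (auto simp: ennreal_powr_def intro: ennreal_leI)
qed

lemma ennreal_powr_measurable [measurable]: "ennreal_powr a \<in> borel_measurable borel"
  unfolding ennreal_powr_def by measurable

lemma weighted_AM_GM:
  fixes a y :: "'i \<Rightarrow> real"
  assumes "finite J" "\<And>j. j \<in> J \<Longrightarrow> a j > 0" "sum a J = 1" "\<And>j. j \<in> J \<Longrightarrow> y j \<ge> 0"
  shows "(\<Prod>j\<in>J. y j powr a j) \<le> (\<Sum>j\<in>J. a j * y j)"
proof (cases "\<exists>j\<in>J. y j = 0")
  case True
  then have "(\<Prod>j\<in>J. y j powr a j) = 0" using assms(1) by (auto simp: prod_zero_iff)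
  also have "0 \<le> (\<Sum>j\<in>J. a j * y j)" using assms by (intro sum_nonneg mult_nonneg_nonneg) (auto intro: less_imp_le)
  finally show ?thesis .
next
  case False
  then have pos: "y j > 0" if "j \<in> J" for j using assms(4)[OF that] that by (auto simp: less_le)
  have ne: "J \<noteq> {}" using assms(3) by auto
  have "(\<Prod>j\<in>J. y j powr a j) = exp (\<Sum>j\<in>J. a j *\<^sub>R ln (y j))"
    unfolding exp_sum[OF assms(1)] by (intro prod.cong refl) (use pos in \<open>force simp: powr_def\<close>)
  also have "\<dots> \<le> (\<Sum>j\<in>J. a j * exp (ln (y j)))"
    by (rule convex_on_sum[OF assms(1) ne exp_convex assms(3)]) (use assms(2) in \<open>auto intro: less_imp_le\<close>)
  also have "\<dots> = (\<Sum>j\<in>J. a j * y j)" using pos by (intro sum.cong) auto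
  finally show ?thesis .
qed

text \<open>
  The pointwise form of Hoelder's inequality, for values \<open>z j\<close> normalised by constants \<open>A j\<close>, which
  will be the integrals.
\<close>

lemma ennreal_AM_GM:
  fixes a :: "'i \<Rightarrow> real" and A z :: "'i \<Rightarrow> ennreal"
  assumes "finite J" "\<And>j. j \<in> J \<Longrightarrow> a j > 0" "sum a J = 1"
    and A: "\<And>j. j \<in> J \<Longrightarrow> A j \<noteq> 0" "\<And>j. j \<in> J \<Longrightarrow> A j \<noteq> top_class.top"
  shows "(\<Prod>j\<in>J. ennreal_powr (a j) (z j)) \<le> (\<Prod>j\<in>J. ennreal_powr (a j) (A j)) * (\<Sum>j\<in>J. ennreal (a j) * (z j / A j))"
proof (cases "\<exists>j\<in>J. z j = top_class.top")
  case True
  then obtain j where j: "j \<in> J" "z j = top_class.top" by auto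
  have "ennreal (a j) * (z j / A j) = top_class.top"
    using j assms(2)[OF j(1)] A[OF j(1)] by (simp add: ennreal_top_divide ennreal_mult_top)
  then have "(\<Sum>j\<in>J. ennreal (a j) * (z j / A j)) = top_class.top"
    using assms(1) j(1) by (metis ennreal_sum_eq_top)
  moreover have "(\<Prod>j\<in>J. ennreal_powr (a j) (A j)) \<noteq> 0"
    using A(1) ennreal_powr_eq_0 assms(1) by (auto simp: prod_zero_iff)
  ultimately have "(\<Prod>j\<in>J. ennreal_powr (a j) (A j)) * (\<Sum>j\<in>J. ennreal (a j) * (z j / A j)) = top_class.top"
    by (simp only: ennreal_mult_top if_False)
  then show ?thesis by simp
next
  case False
  define B y where "B j = enn2real (A j)" and "y j = enn2real (z j)" for j
  have AB: "A j = ennreal (B j)" "B j > 0" if "j \<in> J" for j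
    using A[OF that] by (auto simp: B_def less_top enn2real_positive_iff zero_less_iff_neq_zero)
  have zy: "z j = ennreal (y j)" "y j \<ge> 0" if "j \<in> J" for j
    using False that by (auto simp: y_def less_top)
  have ay: "a j * (y j / B j) \<ge> 0" if "j \<in> J" for j
    using assms(2)[OF that] AB(2)[OF that] zy(2)[OF that] by simp
  have "(\<Prod>j\<in>J. ennreal_powr (a j) (z j)) = (\<Prod>j\<in>J. ennreal (y j powr a j))"
    by (intro prod.cong refl) (use zy assms(2) in \<open>force simp: ennreal_powr_ennreal\<close>)
  also have "\<dots> = ennreal (\<Prod>j\<in>J. y j powr a j)" by (rule prod_ennreal) simp
  also have "(\<Prod>j\<in>J. y j powr a j) = (\<Prod>j\<in>J. B j powr a j * (y j / B j) powr a j)"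
    by (intro prod.cong refl) (use AB zy in \<open>force simp: powr_mult[symmetric]\<close>)
  also have "\<dots> = (\<Prod>j\<in>J. B j powr a j) * (\<Prod>j\<in>J. (y j / B j) powr a j)" by (rule prod.distrib)
  also have "\<dots> \<le> (\<Prod>j\<in>J. B j powr a j) * (\<Sum>j\<in>J. a j * (y j / B j))"
    by (intro mult_left_mono weighted_AM_GM assms prod_nonneg) (use AB zy in \<open>auto intro!: divide_nonneg_pos\<close>)
  also have "ennreal \<dots> = ennreal (\<Prod>j\<in>J. B j powr a j) * ennreal (\<Sum>j\<in>J. a j * (y j / B j))"
    by (intro ennreal_mult prod_nonneg sum_nonneg ay) auto
  also have "ennreal (\<Prod>j\<in>J. B j powr a j) = (\<Prod>j\<in>J. ennreal (B j powr a j))"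
    by (rule prod_ennreal[symmetric]) simp
  also have "\<dots> = (\<Prod>j\<in>J. ennreal_powr (a j) (A j))"
    by (intro prod.cong refl) (use AB assms(2) in \<open>force simp: ennreal_powr_ennreal\<close>)
  also have "ennreal (\<Sum>j\<in>J. a j * (y j / B j)) = (\<Sum>j\<in>J. ennreal (a j * (y j / B j)))"
    by (rule sum_ennreal[symmetric, OF ay])
  also have "\<dots> = (\<Sum>j\<in>J. ennreal (a j) * (z j / A j))"
  proof (intro sum.cong refl)
    fix j assume j: "j \<in> J"
    show "ennreal (a j * (y j / B j)) = ennreal (a j) * (z j / A j)"
      unfolding AB(1)[OF j] zy(1)[OF j] divide_ennreal[OF zy(2)[OF j] AB(2)[OF j]]
      by (rule ennreal_mult) (use AB(2)[OF j] zy(2)[OF j] assms(2)[OF j] in auto)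
  qed
  finally show ?thesis by (simp add: ennreal_leI)
qed

text \<open>
  Normalisation by the integrals is possible unless one of them is zero, when the left-hand side
  vanishes, or one is infinite and none is zero, when the right-hand side is infinite.
\<close>

lemma Hoelder_inequality_pos:
  fixes a :: "'i \<Rightarrow> real" and f :: "'i \<Rightarrow> 'x \<Rightarrow> ennreal"
  assumes J: "finite J" and a: "\<And>j. j \<in> J \<Longrightarrow> a j > 0" and s: "sum a J = 1"
    and f [measurable]: "\<And>j. j \<in> J \<Longrightarrow> f j \<in> borel_measurable M"
  shows "(\<integral>\<^sup>+x. (\<Prod>j\<in>J. ennreal_powr (a j) (f j x)) \<partial>M) \<le> (\<Prod>j\<in>J. ennreal_powr (a j) (\<integral>\<^sup>+x. f j x \<partial>M))"
proof -
  define A where "A j = (\<integral>\<^sup>+x. f j x \<partial>M)" for j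
  consider (zero) j where "j \<in> J" "A j = 0" | (top) j where "j \<in> J" "A j = top_class.top" "\<forall>j\<in>J. A j \<noteq> 0"
    | (fin) "\<forall>j\<in>J. A j \<noteq> 0 \<and> A j \<noteq> top_class.top" by blast
  then have "(\<integral>\<^sup>+x. (\<Prod>j\<in>J. ennreal_powr (a j) (f j x)) \<partial>M) \<le> (\<Prod>j\<in>J. ennreal_powr (a j) (A j))"
  proof cases
    case zero
    then have "AE x in M. f j x = 0" using nn_integral_0_iff_AE[OF f] by (simp add: A_def)
    then have "AE x in M. (\<Prod>j\<in>J. ennreal_powr (a j) (f j x)) = 0"
    proof eventually_elim
      case (elim x)
      then have "ennreal_powr (a j) (f j x) = 0" using a[OF zero(1)] by simp
      then show ?case using J zero(1) by (auto simp: prod_zero_iff)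
    qed
    then have "(\<integral>\<^sup>+x. (\<Prod>j\<in>J. ennreal_powr (a j) (f j x)) \<partial>M) = (\<integral>\<^sup>+x. 0 \<partial>M)"
      by (rule nn_integral_cong_AE)
    then show ?thesis by simp
  next
    case top
    have "ennreal_powr (a j) (A j) = top_class.top" using a[OF top(1)] top(2) by (simp add: ennreal_powr_def)
    moreover have "(\<Prod>i\<in>J - {j}. ennreal_powr (a i) (A i)) \<noteq> 0"
      using top(3) J ennreal_powr_eq_0 by (auto simp: prod_zero_iff)
    ultimately have "(\<Prod>j\<in>J. ennreal_powr (a j) (A j)) = top_class.top"
      using J top(1) by (simp add: prod.remove ennreal_top_mult)
    then show ?thesis by simp
  next
    case fin
    have "(\<integral>\<^sup>+x. (\<Prod>j\<in>J. ennreal_powr (a j) (f j x)) \<partial>M)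
        \<le> (\<integral>\<^sup>+x. (\<Prod>j\<in>J. ennreal_powr (a j) (A j)) * (\<Sum>j\<in>J. ennreal (a j) * (f j x / A j)) \<partial>M)"
      by (intro nn_integral_mono ennreal_AM_GM J a s) (use fin in auto)
    also have "\<dots> = (\<Prod>j\<in>J. ennreal_powr (a j) (A j)) * (\<Sum>j\<in>J. ennreal (a j) * (A j / A j))"
      by (subst nn_integral_cmult) (auto simp: nn_integral_sum nn_integral_cmult nn_integral_divide A_def)
    also have "(\<Sum>j\<in>J. ennreal (a j) * (A j / A j)) = (\<Sum>j\<in>J. ennreal (a j))"
      by (intro sum.cong refl) (use fin in \<open>auto simp: ennreal_divide_self less_top zero_less_iff_neq_zero\<close>)
    also have "\<dots> = 1" using s a by (subst sum_ennreal) (auto intro: less_imp_le)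
    finally show ?thesis by simp
  qed
  then show ?thesis by (simp add: A_def)
qed

lemma Hoelder_inequality:
  fixes a :: "'i \<Rightarrow> real" and f :: "'i \<Rightarrow> 'x \<Rightarrow> ennreal"
  assumes J: "finite J" and a: "\<And>j. j \<in> J \<Longrightarrow> a j \<ge> 0" and s: "sum a J = 1"
    and f: "\<And>j. j \<in> J \<Longrightarrow> f j \<in> borel_measurable M"
  shows "(\<integral>\<^sup>+x. (\<Prod>j\<in>J. ennreal_powr (a j) (f j x)) \<partial>M) \<le> (\<Prod>j\<in>J. ennreal_powr (a j) (\<integral>\<^sup>+x. f j x \<partial>M))"
proof -
  define K where "K = {j\<in>J. a j \<noteq> 0}"
  have 1: "(\<Prod>j\<in>J. ennreal_powr (a j) (g j)) = (\<Prod>j\<in>K. ennreal_powr (a j) (g j))" for g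
    by (rule prod.mono_neutral_right) (use J in \<open>auto simp: K_def\<close>)
  have 2: "sum a K = 1"
    unfolding s[symmetric] by (rule sum.mono_neutral_left) (use J in \<open>auto simp: K_def\<close>)
  show ?thesis unfolding 1
    by (rule Hoelder_inequality_pos) (use J a f 2 in \<open>auto simp: K_def less_le\<close>)
qed

lemma measurable_fun_upd_PiM:
  fixes I :: "'i set"
  assumes "f \<in> borel_measurable (PiM I (\<lambda>_. lborel :: real measure))" "j \<in> I"
  shows "(\<lambda>z. f ((fst z)(j := snd z))) \<in> borel_measurable (PiM I (\<lambda>_. lborel) \<Otimes>\<^sub>M lborel)"
  by (rule measurable_compose[OF _ assms(1)], rule measurable_fun_upd[of _ I]) (use assms(2) in auto)

lemma measurable_line_integral:
  fixes I :: "'i set"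
  assumes "f \<in> borel_measurable (PiM I (\<lambda>_. lborel :: real measure))" "j \<in> I"
  shows "(\<lambda>x. \<integral>\<^sup>+t. f (x(j := t)) \<partial>lborel) \<in> borel_measurable (PiM I (\<lambda>_. lborel))"
  using lborel.borel_measurable_nn_integral[of "\<lambda>x t. f (x(j := t))" "PiM I (\<lambda>_. lborel)"] measurable_fun_upd_PiM[OF assms]
  by (simp add: case_prod_beta')

lemma measurable_new_line_integral:
  fixes I :: "'i set"
  assumes "f \<in> borel_measurable (PiM (insert i I) (\<lambda>_. lborel :: real measure))"
  shows "(\<lambda>x. \<integral>\<^sup>+t. f (x(i := t)) \<partial>lborel) \<in> borel_measurable (PiM I (\<lambda>_. lborel))"
proof -
  have "(\<lambda>z. f ((fst z)(i := snd z))) \<in> borel_measurable (PiM I (\<lambda>_. lborel) \<Otimes>\<^sub>M lborel)"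
    by (rule measurable_compose[OF _ assms(1)], rule measurable_fun_upd[of _ I]) auto
  then show ?thesis
    using lborel.borel_measurable_nn_integral[of "\<lambda>x t. f (x(i := t))" "PiM I (\<lambda>_. lborel)"]
    by (simp add: case_prod_beta')
qed

text \<open>
  This inequality interpolates between Gagliardo's inequality, where the exponent of \<open>f\<close> is zero,
  and the trivial case without variables. It admits induction on the number of variables:
  integrating in one variable \<open>i\<close> and applying Hoelder's inequality turns the statement for \<open>f\<close>
  into the same statement for the line integral \<open>g\<close> of \<open>f\<close> in the direction \<open>i\<close>, with the same \<open>p\<close>.
\<close>

lemma grid_line_inequality:
  fixes f :: "('i \<Rightarrow> real) \<Rightarrow> ennreal"
  assumes "finite I" "p \<ge> 0" "(real (card I) - 1) * p \<le> 1"
    and "f \<in> borel_measurable (PiM I (\<lambda>_. lborel))"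
  shows "(\<integral>\<^sup>+x. ennreal_powr (1 - (real (card I) - 1) * p) (f x) * (\<Prod>i\<in>I. ennreal_powr p (\<integral>\<^sup>+t. f (x(i := t)) \<partial>lborel)) \<partial>PiM I (\<lambda>_. lborel))
    \<le> ennreal_powr (1 + p) (\<integral>\<^sup>+x. f x \<partial>PiM I (\<lambda>_. lborel))"
  using assms
proof (induction I arbitrary: f rule: finite_induct)
  case empty
  interpret product_sigma_finite "\<lambda>_::'i. lborel :: real measure"
    by (simp add: product_sigma_finite_def lborel.sigma_finite_measure_axioms)
  show ?case by (simp add: nn_integral_empty)
next
  case (insert i I)
  interpret product_sigma_finite "\<lambda>_::'i. lborel :: real measure"
    by (simp add: product_sigma_finite_def lborel.sigma_finite_measure_axioms)
  note [measurable] = insert.prems(3)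
  let ?c = "real (card I)"
  let ?P = "PiM I (\<lambda>_. lborel :: real measure)"
  have c: "?c * p \<le> 1" "0 \<le> ?c * p" using insert by auto
  define g where "g x = (\<integral>\<^sup>+t. f (x(i := t)) \<partial>lborel)" for x
  have mg: "g \<in> borel_measurable ?P" unfolding g_def by (rule measurable_new_line_integral[OF insert.prems(3)])
  have line: "(\<lambda>t. f (x(i := t))) \<in> borel_measurable lborel" if "x \<in> space ?P" for x
    by (rule measurable_compose[OF measurable_fun_upd[of _ I] insert.prems(3)]) (use that in auto)
  have ne: "j \<noteq> i" if "j \<in> I" for j using insert.hyps(2) that by auto
  have swap: "(\<integral>\<^sup>+y. (\<integral>\<^sup>+t. f (x(i := y, j := t)) \<partial>lborel) \<partial>lborel) = (\<integral>\<^sup>+t. g (x(j := t)) \<partial>lborel)"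
    and mline: "(\<lambda>y. \<integral>\<^sup>+t. f (x(i := y, j := t)) \<partial>lborel) \<in> borel_measurable lborel"
    if x: "x \<in> space ?P" and j: "j \<in> I" for x j
  proof -
    have [measurable]: "(\<lambda>z. f (x(i := fst z, j := snd z))) \<in> borel_measurable (lborel \<Otimes>\<^sub>M lborel)"
      by (rule measurable_compose[OF _ insert.prems(3)], rule measurable_fun_upd[of _ "insert i I"],
          use j in auto, rule measurable_fun_upd[of _ I], use x in auto)
    have 1: "(\<integral>\<^sup>+y. (\<integral>\<^sup>+t. f (x(i := y, j := t)) \<partial>lborel) \<partial>lborel) = (\<integral>\<^sup>+t. (\<integral>\<^sup>+y. f (x(i := y, j := t)) \<partial>lborel) \<partial>lborel)"
      using lborel_pair.Fubini'[of "\<lambda>y t. f (x(i := y, j := t))"] by (simp add: case_prod_beta')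
    show "(\<integral>\<^sup>+y. (\<integral>\<^sup>+t. f (x(i := y, j := t)) \<partial>lborel) \<partial>lborel) = (\<integral>\<^sup>+t. g (x(j := t)) \<partial>lborel)"
      unfolding 1 g_def using ne[OF j] by (simp add: fun_upd_twist)
    show "(\<lambda>y. \<integral>\<^sup>+t. f (x(i := y, j := t)) \<partial>lborel) \<in> borel_measurable lborel"
      using lborel.borel_measurable_nn_integral[of "\<lambda>y t. f (x(i := y, j := t))" lborel] by (simp add: case_prod_beta')
  qed
  let ?F = "\<lambda>x. ennreal_powr (1 - ?c * p) (f x) * (\<Prod>j\<in>insert i I. ennreal_powr p (\<integral>\<^sup>+t. f (x(j := t)) \<partial>lborel))"
  have mF: "?F \<in> borel_measurable (PiM (insert i I) (\<lambda>_. lborel))"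
    by (intro borel_measurable_times_ennreal borel_measurable_prod_ennreal measurable_compose[OF _ ennreal_powr_measurable]
        measurable_line_integral insert.prems(3))
  \<comment> \<open>The factor for direction \<open>i\<close> does not depend on \<open>y\<close>. The others carry the weight
    \<open>1 - card I * p\<close> for \<open>f\<close> and \<open>p\<close> for each \<open>j\<close> in \<open>I\<close>; these weights add up to one.\<close>
  have inner: "(\<integral>\<^sup>+y. ?F (x(i := y)) \<partial>lborel)
      \<le> ennreal_powr (1 - (?c - 1) * p) (g x) * (\<Prod>j\<in>I. ennreal_powr p (\<integral>\<^sup>+t. g (x(j := t)) \<partial>lborel))" if x: "x \<in> space ?P" for x
  proof -
    define a where "a j = (if j = i then 1 - ?c * p else p)" for j
    define h where "h j y = (if j = i then f (x(i := y)) else (\<integral>\<^sup>+t. f (x(i := y, j := t)) \<partial>lborel))" for j y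
    have F: "?F (x(i := y)) = ennreal_powr p (g x) * (\<Prod>j\<in>insert i I. ennreal_powr (a j) (h j y))" for y
    proof -
      have "(\<Prod>j\<in>I. ennreal_powr p (\<integral>\<^sup>+t. f (x(i := y, j := t)) \<partial>lborel)) = (\<Prod>j\<in>I. ennreal_powr (a j) (h j y))"
        by (intro prod.cong refl) (auto simp: a_def h_def dest: ne)
      then show ?thesis
        using insert.hyps by (simp add: a_def h_def g_def mult_ac)
    qed
    have mh: "h j \<in> borel_measurable lborel" if "j \<in> insert i I" for j
      using that line[OF x] mline[OF x] by (cases "j = i") (auto simp: h_def[abs_def])
    have sa: "sum a (insert i I) = 1"
    proof -
      have "sum a I = (\<Sum>j\<in>I. p)" by (intro sum.cong refl) (auto simp: a_def dest: ne)
      then show ?thesis using insert.hyps by (simp add: a_def)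
    qed
    have "(\<integral>\<^sup>+y. ?F (x(i := y)) \<partial>lborel) = ennreal_powr p (g x) * (\<integral>\<^sup>+y. (\<Prod>j\<in>insert i I. ennreal_powr (a j) (h j y)) \<partial>lborel)"
      unfolding F
      by (rule nn_integral_cmult) (intro borel_measurable_prod_ennreal measurable_compose[OF _ ennreal_powr_measurable] mh)
    also have "\<dots> \<le> ennreal_powr p (g x) * (\<Prod>j\<in>insert i I. ennreal_powr (a j) (\<integral>\<^sup>+y. h j y \<partial>lborel))"
      by (intro mult_left_mono Hoelder_inequality mh sa) (use insert c in \<open>auto simp: a_def\<close>)
    also have "(\<Prod>j\<in>insert i I. ennreal_powr (a j) (\<integral>\<^sup>+y. h j y \<partial>lborel)) =
        ennreal_powr (1 - ?c * p) (g x) * (\<Prod>j\<in>I. ennreal_powr p (\<integral>\<^sup>+t. g (x(j := t)) \<partial>lborel))"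
    proof -
      have "(\<Prod>j\<in>I. ennreal_powr (a j) (\<integral>\<^sup>+y. h j y \<partial>lborel)) = (\<Prod>j\<in>I. ennreal_powr p (\<integral>\<^sup>+t. g (x(j := t)) \<partial>lborel))"
        by (intro prod.cong refl) (auto simp: a_def h_def swap[OF x, symmetric] dest: ne)
      then show ?thesis using insert.hyps by (simp add: a_def h_def g_def)
    qed
    also have "ennreal_powr p (g x) * (ennreal_powr (1 - ?c * p) (g x) * (\<Prod>j\<in>I. ennreal_powr p (\<integral>\<^sup>+t. g (x(j := t)) \<partial>lborel)))
       = ennreal_powr (1 - (?c - 1) * p) (g x) * (\<Prod>j\<in>I. ennreal_powr p (\<integral>\<^sup>+t. g (x(j := t)) \<partial>lborel))"
      using ennreal_powr_add[of p "1 - ?c * p" "g x"] insert.prems c by (simp add: algebra_simps)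
    finally show ?thesis .
  qed
  have "(\<integral>\<^sup>+x. ?F x \<partial>PiM (insert i I) (\<lambda>_. lborel)) = (\<integral>\<^sup>+x. (\<integral>\<^sup>+y. ?F (x(i := y)) \<partial>lborel) \<partial>?P)"
    by (rule product_nn_integral_insert[OF insert.hyps mF])
  also have "\<dots> \<le> (\<integral>\<^sup>+x. ennreal_powr (1 - (?c - 1) * p) (g x) * (\<Prod>j\<in>I. ennreal_powr p (\<integral>\<^sup>+t. g (x(j := t)) \<partial>lborel)) \<partial>?P)"
    by (rule nn_integral_mono) (rule inner)
  also have "\<dots> \<le> ennreal_powr (1 + p) (\<integral>\<^sup>+x. g x \<partial>?P)"
    by (rule insert.IH) (use insert.prems c mg in \<open>auto simp: algebra_simps\<close>)
  also have "(\<integral>\<^sup>+x. g x \<partial>?P) = (\<integral>\<^sup>+x. f x \<partial>PiM (insert i I) (\<lambda>_. lborel))"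
    unfolding g_def by (rule product_nn_integral_insert[OF insert.hyps insert.prems(3), symmetric])
  finally show ?case using insert.hyps by simp
qed

text \<open>
  The product of the line integrals through \<open>x\<close> in all coordinate directions, raised to the power
  \<open>1 / (n - 1)\<close>, has an integral controlled by that of \<open>g\<close>. It is the grid line inequality for the
  \<open>p\<close> with \<open>(n - 1) p = 1\<close>.
\<close>

lemma gagliardo_inequality:
  fixes g :: "'a::euclidean_space \<Rightarrow> ennreal"
  assumes g: "g \<in> borel_measurable borel" and n: "DIM('a) \<ge> 2"
  defines "p \<equiv> 1 / (real DIM('a) - 1)"
  shows "(\<integral>\<^sup>+x. (\<Prod>b\<in>Basis. ennreal_powr p (\<integral>\<^sup>+t. g (x + (t - x \<bullet> b) *\<^sub>R b) \<partial>lborel)) \<partial>lborel) \<le> ennreal_powr (1 + p) (\<integral>\<^sup>+x. g x \<partial>lborel)"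
proof -
  let ?P = "PiM (Basis::'a set) (\<lambda>_. lborel :: real measure)"
  define \<phi> :: "('a \<Rightarrow> real) \<Rightarrow> 'a" where "\<phi> f = (\<Sum>b\<in>Basis. f b *\<^sub>R b)" for f
  have m\<phi>: "\<phi> \<in> measurable ?P borel" unfolding \<phi>_def by measurable
  have lb: "(lborel::'a measure) = distr ?P borel \<phi>" unfolding \<phi>_def by (rule lborel_eq)
  have int: "(\<integral>\<^sup>+x. h x \<partial>lborel) = (\<integral>\<^sup>+f. h (\<phi> f) \<partial>?P)" if "h \<in> borel_measurable borel" for h :: "'a \<Rightarrow> ennreal"
    by (subst lb, rule nn_integral_distr) (use m\<phi> that in auto)
  have upd: "\<phi> (f(b := t)) = \<phi> f + (t - \<phi> f \<bullet> b) *\<^sub>R b" if "b \<in> Basis" for f b t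
  proof -
    have "\<phi> (f(b := t)) - \<phi> f = (\<Sum>c\<in>Basis. (if c = b then (t - f b) *\<^sub>R b else 0))"
      unfolding \<phi>_def sum_subtractf[symmetric] by (intro sum.cong) (auto simp: algebra_simps)
    also have "\<dots> = (t - f b) *\<^sub>R b" using that by simp
    also have "f b = \<phi> f \<bullet> b" unfolding \<phi>_def using that by simp
    finally show ?thesis unfolding diff_eq_eq by (simp only: add.commute)
  qed
  have mg: "(\<lambda>f. g (\<phi> f)) \<in> borel_measurable ?P" using m\<phi> g by (rule measurable_compose)
  have [measurable]: "(\<lambda>x. \<integral>\<^sup>+t. g (x + (t - x \<bullet> b) *\<^sub>R b) \<partial>lborel) \<in> borel_measurable borel" for b
  proof -
    have "(\<lambda>z. g (fst z + (snd z - fst z \<bullet> b) *\<^sub>R b)) \<in> borel_measurable (borel \<Otimes>\<^sub>M lborel)"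
      by (rule measurable_compose[OF _ g]) measurable
    then show ?thesis
      using lborel.borel_measurable_nn_integral[of "\<lambda>x t. g (x + (t - x \<bullet> b) *\<^sub>R b)" borel] by (simp add: case_prod_beta')
  qed
  have p: "p \<ge> 0" "(real DIM('a) - 1) * p = 1" using n by (auto simp: p_def)
  have "(\<integral>\<^sup>+x. (\<Prod>b\<in>Basis. ennreal_powr p (\<integral>\<^sup>+t. g (x + (t - x \<bullet> b) *\<^sub>R b) \<partial>lborel)) \<partial>lborel)
     = (\<integral>\<^sup>+f. (\<Prod>b\<in>Basis. ennreal_powr p (\<integral>\<^sup>+t. g (\<phi> f + (t - \<phi> f \<bullet> b) *\<^sub>R b) \<partial>lborel)) \<partial>?P)"
    by (rule int) (intro borel_measurable_prod_ennreal measurable_compose[OF _ ennreal_powr_measurable], measurable)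
  also have "\<dots> = (\<integral>\<^sup>+f. ennreal_powr (1 - (real DIM('a) - 1) * p) (g (\<phi> f)) * (\<Prod>b\<in>Basis. ennreal_powr p (\<integral>\<^sup>+t. g (\<phi> (f(b := t))) \<partial>lborel)) \<partial>?P)"
    using p by (simp add: upd)
  also have "\<dots> \<le> ennreal_powr (1 + p) (\<integral>\<^sup>+f. g (\<phi> f) \<partial>?P)"
    by (rule grid_line_inequality) (use p mg in auto)
  also have "\<dots> = ennreal_powr (1 + p) (\<integral>\<^sup>+x. g x \<partial>lborel)" using int g by simp
  finally show ?thesis .
qed


section \<open>The Sobolev inequality\<close>

lemma has_derivative_norm_powr_nonzero:
  fixes x :: "'v::real_inner"
  assumes "x \<noteq> 0"
  shows "((\<lambda>x. norm x powr s) has_derivative (\<lambda>h. s * norm x powr (s - 2) * (x \<bullet> h))) (at x)"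
proof -
  have 1: "(norm has_derivative (\<lambda>h. h \<bullet> sgn x)) (at x)"
    by (rule has_derivative_norm[OF assms])
  have "((\<lambda>r. r powr s) has_real_derivative s * norm x powr (s - 1)) (at (norm x))"
    by (rule has_real_derivative_powr) (use assms in auto)
  from has_derivative_compose[OF 1 this[unfolded has_field_derivative_def]]
  have "((\<lambda>z. norm z powr s) has_derivative (\<lambda>h. s * norm x powr (s - 1) * (h \<bullet> sgn x))) (at x)" .
  moreover have "s * norm x powr (s - 1) * (h \<bullet> sgn x) = s * norm x powr (s - 2) * (x \<bullet> h)" for h
  proof -
    have "norm x powr (s - 1) = norm x powr (s - 2) * norm x"
      using assms powr_add[of "norm x" "s - 2" 1] by simp
    then show ?thesis using assms by (simp add: sgn_div_norm inner_commute)
  qed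
  ultimately show ?thesis by simp
qed

text \<open>
  At \<open>z = 0\<close> the derivative vanishes because \<open>\<gamma> > 1\<close>; the formula is right there, too, as the
  base zero makes \<open>powr\<close> zero.
\<close>

lemma has_derivative_norm_powr:
  fixes z :: "'v::real_inner"
  assumes "\<gamma> > 1"
  shows "((\<lambda>z. norm z powr \<gamma>) has_derivative (\<lambda>h. \<gamma> * norm z powr (\<gamma> - 2) * (z \<bullet> h))) (at z)"
proof (cases "z = 0")
  case False
  then show ?thesis by (rule has_derivative_norm_powr_nonzero)
next
  case True
  have "((\<lambda>h::'v. norm h powr (\<gamma> - 1)) \<longlongrightarrow> 0) (at 0)"
    by (rule tendsto_eq_intros | simp add: assms eventually_at_filter | use assms in force)+
  moreover have "norm h powr (\<gamma> - 1) = norm h powr \<gamma> / norm h" for h :: 'v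
    using powr_diff[of "norm h" \<gamma> 1] by simp
  ultimately have "((\<lambda>h::'v. norm h powr \<gamma> / norm h) \<longlongrightarrow> 0) (at 0)" by simp
  then show ?thesis using True by (simp add: has_derivative_at)
qed

text \<open>
  Follow the line through \<open>x\<close> in the direction \<open>b\<close> from a point outside the support up to \<open>x\<close>; the
  increase of \<open>|v|\<^sup>\<gamma>\<close> is at most the integral of the bound \<open>g\<close> for its derivative.
\<close>

lemma norm_powr_le_line_integral:
  fixes v :: "'a::euclidean_space \<Rightarrow> 'v::real_inner"
  assumes v: "C1 v" "csupp v" and \<gamma>: "\<gamma> > 1" and b: "b \<in> Basis"
    and g: "continuous_on UNIV g" "\<And>x. \<gamma> * norm (v x) powr (\<gamma> - 1) * norm (pd b v x) \<le> g x"
  shows "ennreal (norm (v x) powr \<gamma>) \<le> (\<integral>\<^sup>+t. ennreal (g (x + (t - x \<bullet> b) *\<^sub>R b)) \<partial>lborel)"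
proof -
  define y where "y = x - (x \<bullet> b) *\<^sub>R b"
  have xy: "x + (t - x \<bullet> b) *\<^sub>R b = y + t *\<^sub>R b" for t by (simp add: y_def algebra_simps)
  have g0: "0 \<le> g z" for z using \<gamma> by (intro order_trans[OF _ g(2)]) simp
  obtain R where R: "\<And>x. R < norm x \<Longrightarrow> v x = 0" using csuppE[OF v(2)] by blast
  define T where "T = \<bar>R\<bar> + \<bar>x \<bullet> b\<bar> + norm y + 1"
  have T: "- T \<le> x \<bullet> b" unfolding T_def using norm_ge_zero[of y] by linarith
  have v0: "v (y + (- T) *\<^sub>R b) = 0"
  proof (rule R)
    have "norm (T *\<^sub>R b) \<le> norm (y + (- T) *\<^sub>R b) + norm y"
      by (metis add.commute add_diff_cancel_left' norm_minus_cancel norm_triangle_ineq4 scaleR_minus_left)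
    moreover have "T \<ge> 0" by (simp add: T_def)
    then have "norm (T *\<^sub>R b) = T" using b by simp
    moreover have "R + norm y < T" by (simp add: T_def)
    ultimately show "R < norm (y + (- T) *\<^sub>R b)" by linarith
  qed
  let ?f' = "\<lambda>t. \<gamma> * norm (v (y + t *\<^sub>R b)) powr (\<gamma> - 2) * (v (y + t *\<^sub>R b) \<bullet> pd b v (y + t *\<^sub>R b))"
  let ?g = "\<lambda>t. g (y + t *\<^sub>R b)"
  have D: "((\<lambda>t. norm (v (y + t *\<^sub>R b)) powr \<gamma>) has_vector_derivative ?f' t) (at t within S)" for t S
  proof -
    have "((\<lambda>t. v (y + t *\<^sub>R b)) has_derivative (\<lambda>h. h *\<^sub>R pd b v (y + t *\<^sub>R b))) (at t within S)"
      using has_vector_derivative_line[OF C1D[OF v(1)]] by (simp add: has_vector_derivative_def)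
    from has_derivative_compose[OF this has_derivative_norm_powr[OF \<gamma>]]
    show ?thesis by (simp add: has_vector_derivative_def mult_ac)
  qed
  have FTC: "(?f' has_integral norm (v (y + (x \<bullet> b) *\<^sub>R b)) powr \<gamma> - norm (v (y + (- T) *\<^sub>R b)) powr \<gamma>) {- T .. x \<bullet> b}"
    by (rule fundamental_theorem_of_calculus[OF T D])
  have cg: "continuous_on S ?g" for S
    by (intro continuous_on_compose2[OF g(1)] continuous_intros) auto
  have gi: "?g integrable_on {- T .. x \<bullet> b}" by (rule integrable_continuous_real[OF cg])
  have le: "?f' t \<le> ?g t" for t
  proof -
    let ?v = "v (y + t *\<^sub>R b)" and ?d = "pd b v (y + t *\<^sub>R b)"
    have "?f' t \<le> \<gamma> * norm ?v powr (\<gamma> - 2) * (norm ?v * norm ?d)"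
      using \<gamma> norm_cauchy_schwarz by (intro mult_left_mono) auto
    also have "\<dots> = \<gamma> * norm ?v powr (\<gamma> - 1) * norm ?d"
      using powr_add[of "norm ?v" "\<gamma> - 2" 1] by (cases "?v = 0") auto
    also have "\<dots> \<le> ?g t" by (rule g(2))
    finally show ?thesis .
  qed
  have "norm (v x) powr \<gamma> \<le> integral {- T .. x \<bullet> b} ?g"
    using has_integral_le[OF FTC integrable_integral[OF gi]] le v0 by (simp add: y_def)
  then have "ennreal (norm (v x) powr \<gamma>) \<le> ennreal (integral {- T .. x \<bullet> b} ?g)" by (rule ennreal_leI)
  also have "\<dots> = (\<integral>\<^sup>+t\<in>{- T .. x \<bullet> b}. ennreal (?g t) \<partial>lborel)"
  proof -
    have "(?g has_integral integral {- T .. x \<bullet> b} ?g) {- T .. x \<bullet> b}" by (rule integrable_integral[OF gi])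
    then show ?thesis
      by (subst nn_integral_has_integral_lebesgue'[symmetric]) (use g0 in \<open>auto intro: has_integral_nonneg\<close>)
  qed
  also have "\<dots> \<le> (\<integral>\<^sup>+t. ennreal (?g t) \<partial>lborel)"
    by (intro nn_integral_mono) (auto simp: indicator_def)
  finally show ?thesis by (simp add: xy)
qed


text \<open>
  Gagliardo's inequality is applied to \<open>|v|\<^sup>\<gamma>\<close>, with \<open>\<gamma>\<close> chosen such that the power \<open>\<gamma> n / (n - 1)\<close>
  on the left and the power \<open>2 (\<gamma> - 1)\<close>, which the Cauchy-Schwarz inequality produces from the
  derivative of \<open>|v|\<^sup>\<gamma>\<close>, are both equal to the Sobolev exponent \<open>q\<close>. Treating \<open>|v|\<close> as a whole, and not the
  components, keeps the constant independent of the dimension of the target space.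
\<close>

lemma sobolev_inequality:
  fixes v :: "'a::euclidean_space \<Rightarrow> 'v::real_inner"
  assumes v: "C1 v" "csupp v" and dim: "DIM('a) > 2"
  defines "n \<equiv> real DIM('a)"
  defines "q \<equiv> 2 * n / (n - 2)"
  shows "(\<integral>x. norm (v x) powr q \<partial>lborel) powr (2 / q)
     \<le> (2 * (n - 1) / (n - 2))\<^sup>2 * (\<integral>x. (\<Sum>b\<in>Basis. (norm (pd b v x))\<^sup>2) \<partial>lborel)"
proof -
  define \<gamma> where "\<gamma> = 2 * (n - 1) / (n - 2)"
  define p where "p = 1 / (n - 1)"
  have n: "n > 2" using dim by (simp add: n_def)
  have \<gamma>: "\<gamma> > 1" and q: "q > 0" and p: "p > 0" using n by (auto simp: \<gamma>_def q_def p_def field_simps)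
  have e1: "2 * (\<gamma> - 1) = q" and e3: "1 + p = n / (n - 1)"
    using n by (auto simp: \<gamma>_def q_def p_def field_simps)
  have "(n - 1) * p = 1" using n by (simp add: p_def)
  moreover have "\<gamma> * (p * n) = 2 * n * ((n - 1) * p) / (n - 2)" unfolding \<gamma>_def by simp
  ultimately have e2: "\<gamma> * (p * n) = q" unfolding q_def by simp
  define G where "G x = (\<Sum>b\<in>Basis. (norm (pd b v x))\<^sup>2)" for x
  define N where "N x = norm (v x) powr (\<gamma> - 1)" for x
  define g where "g x = \<gamma> * (N x * sqrt (G x))" for x
  have G0: "G x \<ge> 0" and N0: "N x \<ge> 0" for x by (auto simp: G_def N_def intro: sum_nonneg)
  have cv: "continuous_on UNIV v" by (rule C1_continuous[OF v(1)])
  have cG: "continuous_on UNIV G" unfolding G_def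
    by (intro continuous_intros C1_pd v)
  have cN: "continuous_on UNIV N" unfolding N_def
    by (rule continuous_on_powr') (use \<gamma> in \<open>auto intro!: continuous_intros cv\<close>)
  have cq: "continuous_on UNIV (\<lambda>x. norm (v x) powr q)"
    by (rule continuous_on_powr') (use q in \<open>auto intro!: continuous_intros cv\<close>)
  have cg: "continuous_on UNIV g" unfolding g_def
    by (intro continuous_intros cN cG)
  have sG: "csupp G" unfolding G_def
    by (intro csupp_sum csupp_0[OF csupp_pd[OF v(2)]]) simp
  have sq: "csupp (\<lambda>x. norm (v x) powr q)" by (rule csupp_0[OF v(2)]) simp
  have sg: "csupp g" by (rule csupp_0[OF v(2)]) (simp add: g_def N_def)
  have iG: "integrable lborel G" and iq: "integrable lborel (\<lambda>x. norm (v x) powr q)" and ig: "integrable lborel g"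
    by (auto intro!: integrable_csupp cG cq cg sG sq sg)
  define A B E where "A = (\<integral>x. norm (v x) powr q \<partial>lborel)" and "B = integral\<^sup>L lborel G" and "E = integral\<^sup>L lborel g"
  have nonneg: "A \<ge> 0" "B \<ge> 0" "E \<ge> 0"
    unfolding A_def B_def E_def using G0 N0 \<gamma> by (auto intro!: integral_nonneg simp: g_def)
  have NA: "(\<integral>\<^sup>+x. ennreal (norm (v x) powr q) \<partial>lborel) = ennreal A"
    unfolding A_def by (rule nn_integral_eq_integral[OF iq]) simp
  have NB: "(\<integral>\<^sup>+x. ennreal (G x) \<partial>lborel) = ennreal B"
    unfolding B_def by (rule nn_integral_eq_integral[OF iG]) (simp add: G0)
  have NE: "(\<integral>\<^sup>+x. ennreal (g x) \<partial>lborel) = ennreal E"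
    unfolding E_def by (rule nn_integral_eq_integral[OF ig]) (use G0 N0 \<gamma> in \<open>simp add: g_def\<close>)
  have mg: "(\<lambda>x. ennreal (g x)) \<in> borel_measurable borel"
    by (intro measurable_compose[OF _ measurable_ennreal] borel_measurable_continuous_onI cg)
  have line: "ennreal (norm (v x) powr \<gamma>) \<le> (\<integral>\<^sup>+t. ennreal (g (x + (t - x \<bullet> b) *\<^sub>R b)) \<partial>lborel)" if b: "b \<in> Basis" for x b
  proof (rule norm_powr_le_line_integral[OF v \<gamma> b cg])
    fix x
    have "(norm (pd b v x))\<^sup>2 \<le> G x" unfolding G_def by (rule member_le_sum) (use b in auto)
    then have "norm (pd b v x) \<le> sqrt (G x)" by (rule real_le_rsqrt)
    then show "\<gamma> * norm (v x) powr (\<gamma> - 1) * norm (pd b v x) \<le> g x"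
      unfolding g_def N_def mult.assoc using \<gamma> by (intro mult_left_mono) auto
  qed
  have prod: "ennreal (norm (v x) powr q) = (\<Prod>b\<in>(Basis::'a set). ennreal_powr p (ennreal (norm (v x) powr \<gamma>)))" for x
  proof -
    have "(\<Prod>b\<in>(Basis::'a set). ennreal_powr p (ennreal (norm (v x) powr \<gamma>))) = ennreal (((norm (v x) powr \<gamma>) powr p) ^ DIM('a))"
      using p by (simp add: ennreal_powr_ennreal ennreal_power)
    also have "((norm (v x) powr \<gamma>) powr p) ^ DIM('a) = norm (v x) powr q"
    proof (cases "v x = 0")
      case False
      then have "((norm (v x) powr \<gamma>) powr p) ^ DIM('a) = ((norm (v x) powr \<gamma>) powr p) powr n"
        by (simp add: powr_realpow n_def)
      then show ?thesis by (simp add: powr_powr e2 mult.assoc)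
    qed (use dim in auto)
    finally show ?thesis by simp
  qed
  have "ennreal A \<le> (\<integral>\<^sup>+x. (\<Prod>b\<in>Basis. ennreal_powr p (\<integral>\<^sup>+t. ennreal (g (x + (t - x \<bullet> b) *\<^sub>R b)) \<partial>lborel)) \<partial>lborel)"
    unfolding NA[symmetric] prod
    by (intro nn_integral_mono prod_mono_ennreal ennreal_powr_mono line) (use p in auto)
  also have "\<dots> \<le> ennreal_powr (1 + p) (\<integral>\<^sup>+x. ennreal (g x) \<partial>lborel)"
    unfolding p_def n_def by (rule gagliardo_inequality[OF mg]) (use dim in simp)
  also have "\<dots> = ennreal (E powr (1 + p))" unfolding NE using p nonneg by (simp add: ennreal_powr_ennreal)
  finally have AE: "A \<le> E powr (1 + p)" by (simp add: ennreal_le_iff)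
  have [measurable]: "N \<in> borel_measurable borel" "G \<in> borel_measurable borel"
    "(\<lambda>x. norm (v x) powr q) \<in> borel_measurable borel"
    by (intro borel_measurable_continuous_onI cN cG cq)+
  have "(\<integral>\<^sup>+x. ennreal (\<gamma> * N x) * ennreal (sqrt (G x)) \<partial>lborel)\<^sup>2
     \<le> (\<integral>\<^sup>+x. (ennreal (\<gamma> * N x))\<^sup>2 \<partial>lborel) * (\<integral>\<^sup>+x. (ennreal (sqrt (G x)))\<^sup>2 \<partial>lborel)"
    by (rule Cauchy_Schwarz_nn_integral) measurable
  also have "(\<lambda>x. ennreal (\<gamma> * N x) * ennreal (sqrt (G x))) = (\<lambda>x. ennreal (g x))"
    using \<gamma> N0 G0 by (auto simp: g_def ennreal_mult[symmetric] mult.assoc)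
  also have "(\<lambda>x. (ennreal (\<gamma> * N x))\<^sup>2) = (\<lambda>x. ennreal (\<gamma>\<^sup>2) * ennreal (norm (v x) powr q))"
  proof
    fix x
    have "(N x)\<^sup>2 = norm (v x) powr q"
      unfolding N_def e1[symmetric] by (simp add: power2_eq_square powr_add[symmetric])
    then show "(ennreal (\<gamma> * N x))\<^sup>2 = ennreal (\<gamma>\<^sup>2) * ennreal (norm (v x) powr q)"
      using \<gamma> N0[of x] by (simp add: ennreal_power power_mult_distrib ennreal_mult[symmetric])
  qed
  also have "(\<lambda>x. (ennreal (sqrt (G x)))\<^sup>2) = (\<lambda>x. ennreal (G x))"
    using G0 by (simp add: ennreal_power)
  also have "(\<integral>\<^sup>+x. ennreal (\<gamma>\<^sup>2) * ennreal (norm (v x) powr q) \<partial>lborel) = ennreal (\<gamma>\<^sup>2) * ennreal A"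
    unfolding NA[symmetric] by (rule nn_integral_cmult) measurable
  finally have "(ennreal E)\<^sup>2 \<le> ennreal (\<gamma>\<^sup>2) * ennreal A * ennreal B" unfolding NE NB .
  then have "ennreal (E\<^sup>2) \<le> ennreal (\<gamma>\<^sup>2 * A * B)"
    using nonneg by (simp add: ennreal_power ennreal_mult[symmetric])
  then have EB: "E\<^sup>2 \<le> \<gamma>\<^sup>2 * A * B" using nonneg by (simp add: ennreal_le_iff)
  \<comment> \<open>Combining \<open>A \<le> E powr (n / (n - 1))\<close> with \<open>E\<^sup>2 \<le> \<gamma>\<^sup>2 A B\<close> and dividing by \<open>A\<close>.\<close>
  have "A powr (2 / q) \<le> \<gamma>\<^sup>2 * B"
  proof (cases "A = 0")
    case False
    then have A: "A > 0" using nonneg by simp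
    then have E: "E > 0" using AE nonneg by (cases "E = 0") auto
    have "A powr (2 / (1 + p)) \<le> (E powr (1 + p)) powr (2 / (1 + p))"
      using AE A p by (intro powr_mono2) auto
    also have "\<dots> = E powr 2"
    proof -
      have "k * (2 / k) = 2" if "k > 0" for k :: real using that by simp
      from this[of "1 + p"] have "(1 + p) * (2 / (1 + p)) = 2" using p by linarith
      then show ?thesis by (simp only: powr_powr)
    qed
    also have "\<dots> = E\<^sup>2" using powr_realpow[OF E, of 2] by simp
    also have "\<dots> \<le> A * (\<gamma>\<^sup>2 * B)" using EB by (simp add: mult_ac)
    also have "2 / (1 + p) = 1 + 2 / q" using n unfolding e3 q_def by (simp add: field_simps)
    also have "A powr (1 + 2 / q) = A * A powr (2 / q)" using A by (simp add: powr_add)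
    finally show ?thesis using A by simp
  qed (use nonneg in auto)
  then show ?thesis unfolding A_def B_def G_def \<gamma>_def .
qed

section \<open>The Dirac operator and its angular part\<close>

definition Euler :: "('a::euclidean_space \<Rightarrow> 'v::real_normed_vector) \<Rightarrow> 'a \<Rightarrow> 'v" where
  "Euler f x = (\<Sum>b\<in>Basis. (x \<bullet> b) *\<^sub>R pd b f x)"

text \<open>
  The degrees of homogeneity of the null solutions of the Dirac operator on punctured \<open>n\<close>-space:
  polynomials have degrees \<open>\<ge> 0\<close>, their Kelvin transforms degrees \<open>\<le> 1 - n\<close>.
\<close>

definition monogenic_degrees :: "nat \<Rightarrow> int set" where
  "monogenic_degrees n = {0..} \<union> {.. 1 - int n}"

text \<open>
  Clifford multiplication by vectors: \<open>c x\<close> stands for \<open>\<sigma> \<cdot> x\<close>. The target space is any real inner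
  product space, complete or not; only real-valued functions will be integrated.
\<close>

locale clifford =
  fixes c :: "'a::euclidean_space \<Rightarrow> 'v::real_inner \<Rightarrow> 'v"
  assumes c_add_left: "c (x + y) v = c x v + c y v"
    and c_scaleR_left: "c (r *\<^sub>R x) v = r *\<^sub>R c x v"
    and c_add_right: "c x (v + w) = c x v + c x w"
    and c_scaleR_right: "c x (r *\<^sub>R v) = r *\<^sub>R c x v"
    and c_sym: "c x v \<bullet> w = v \<bullet> c x w"
    and c_anticommute: "c x (c y v) + c y (c x v) = (2 * (x \<bullet> y)) *\<^sub>R v"
begin

lemma c_square: "c x (c x v) = (x \<bullet> x) *\<^sub>R v"
proof -
  have "2 *\<^sub>R c x (c x v) = 2 *\<^sub>R ((x \<bullet> x) *\<^sub>R v)"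
    using c_anticommute[of x x v] by (simp add: scaleR_2)
  then show ?thesis unfolding scaleR_cancel_left by simp
qed

lemma c_inner_c: "c x v \<bullet> c x w = (x \<bullet> x) * (v \<bullet> w)"
  by (simp add: c_sym c_square)

lemma norm_c: "norm (c x v) = norm x * norm v"
  by (simp add: norm_eq_sqrt_inner c_inner_c real_sqrt_mult)

sublocale cl: bounded_bilinear c
proof
  show "\<exists>K. \<forall>a b. norm (c a b) \<le> norm a * norm b * K"
    by (intro exI[of _ 1]) (simp add: norm_c)
qed (rule c_add_left c_add_right c_scaleR_left c_scaleR_right)+

lemma c_swap: "c x (c y v) = (2 * (x \<bullet> y)) *\<^sub>R v - c y (c x v)"
  using c_anticommute[of x y v] by (simp add: eq_diff_eq)

lemma c_expand: "c x v = (\<Sum>b\<in>Basis. (x \<bullet> b) *\<^sub>R c b v)"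
proof -
  have "c x v = c (\<Sum>b\<in>Basis. (x \<bullet> b) *\<^sub>R b) v" by (simp add: euclidean_representation)
  also have "\<dots> = (\<Sum>b\<in>Basis. (x \<bullet> b) *\<^sub>R c b v)" by (simp only: cl.sum_left cl.scaleR_left)
  finally show ?thesis .
qed

definition Dirac :: "('a \<Rightarrow> 'v) \<Rightarrow> 'a \<Rightarrow> 'v" where
  "Dirac f x = (\<Sum>b\<in>Basis. c b (pd b f x))"

text \<open>
  The operator \<open>\<Gamma>\<close>. As \<open>c x\<close> squares to \<open>|x|\<^sup>2\<close>, it gives the polar decomposition
  \<open>c x D = E - \<Gamma>\<close>; written out, \<open>\<Gamma>\<close> is the sum of the \<open>- \<sigma>\<^sub>i \<sigma>\<^sub>j x\<^sub>i \<partial>\<^sub>j\<close> with \<open>i \<noteq> j\<close> and contains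
  only rotational derivatives.
\<close>

definition Angular :: "('a \<Rightarrow> 'v) \<Rightarrow> 'a \<Rightarrow> 'v" where
  "Angular f x = Euler f x - c x (Dirac f x)"

lemma bounded_linear_c: "bounded_linear (c b)" by (rule cl.bounded_linear_right)

lemma pd_c_const: "f differentiable (at x) \<Longrightarrow> pd b (\<lambda>x. c d (f x)) x = c d (pd b f x)"
  by (rule pd_linear[OF bounded_linear_c])

lemma pd_position_mult:
  assumes "f differentiable (at x)"
  shows "pd b (\<lambda>x. c x (f x)) x = c x (pd b f x) + c b (f x)"
  by (rule pd_eq, rule cl.FDERIV, rule has_derivative_ident, rule has_derivative_pd[OF assms])

lemma C1_c_const: "C1 f \<Longrightarrow> C1 (\<lambda>x. c d (f x))"
  by (rule C1_linear[OF bounded_linear_c])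

lemma C1_position_mult:
  assumes "C1 f" shows "C1 (\<lambda>x. c x (f x))"
proof -
  have "C1 (\<lambda>x. \<Sum>b\<in>Basis. (x \<bullet> b) *\<^sub>R c b (f x))"
    by (intro C1_sum C1_scaleR C1_coord C1_c_const assms)
  moreover have "(\<lambda>x. c x (f x)) = (\<lambda>x. \<Sum>b\<in>Basis. (x \<bullet> b) *\<^sub>R c b (f x))"
    by (rule ext) (rule c_expand)
  ultimately show ?thesis by simp
qed

lemma C1_scaleR_const: "C1 f \<Longrightarrow> C1 (\<lambda>x. r *\<^sub>R f x)"
  by (intro C1_scaleR C1_const)

lemma pd_scaleR_const: "f differentiable (at x) \<Longrightarrow> pd b (\<lambda>x. r *\<^sub>R f x) x = r *\<^sub>R pd b f x"
  by (rule pd_linear[OF bounded_linear_scaleR_right])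

lemma continuous_Euler: "C1 f \<Longrightarrow> continuous_on UNIV (Euler f)"
  unfolding Euler_def by (intro continuous_on_sum continuous_on_scaleR continuous_on_inner continuous_on_id continuous_on_const C1_pd)

lemma continuous_Dirac: "C1 f \<Longrightarrow> continuous_on UNIV (Dirac f)"
  unfolding Dirac_def by (intro continuous_on_sum bounded_linear.continuous_on[OF bounded_linear_c] C1_pd)

lemma continuous_position_mult: "continuous_on UNIV f \<Longrightarrow> continuous_on UNIV (\<lambda>x. c x (f x))"
  by (intro cl.continuous_on continuous_on_id)

lemma continuous_Angular: "C1 f \<Longrightarrow> continuous_on UNIV (Angular f)"
  unfolding Angular_def by (intro continuous_on_diff continuous_Euler continuous_position_mult continuous_Dirac)

lemma C1_Euler: "C2 f \<Longrightarrow> C1 (Euler f)"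
  unfolding Euler_def by (intro C1_sum C1_scaleR C1_coord C2_pd)

lemma C1_Dirac: "C2 f \<Longrightarrow> C1 (Dirac f)"
  unfolding Dirac_def by (intro C1_sum C1_c_const C2_pd)

lemma C1_Angular: "C2 f \<Longrightarrow> C1 (Angular f)"
  unfolding Angular_def by (intro C1_diff C1_Euler C1_position_mult C1_Dirac)

lemma csupp_Euler:
  assumes "csupp f" shows "csupp (Euler f)"
  unfolding Euler_def
proof (rule csupp_sum)
  show "csupp (\<lambda>x. (x \<bullet> b) *\<^sub>R pd b f x)" for b
    by (rule csupp_0[OF csupp_pd[OF assms, of b]]) simp
qed

lemma csupp_Dirac:
  assumes "csupp f" shows "csupp (Dirac f)"
  unfolding Dirac_def
proof (rule csupp_sum)
  show "csupp (\<lambda>x. c b (pd b f x))" for b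
    by (rule csupp_0[OF csupp_pd[OF assms, of b]]) (simp add: cl.zero_right)
qed

lemma Euler_add: "f differentiable (at x) \<Longrightarrow> g differentiable (at x) \<Longrightarrow> Euler (\<lambda>x. f x + g x) x = Euler f x + Euler g x"
  by (simp add: Euler_def pd_add scaleR_add_right sum.distrib)
lemma Euler_diff: "f differentiable (at x) \<Longrightarrow> g differentiable (at x) \<Longrightarrow> Euler (\<lambda>x. f x - g x) x = Euler f x - Euler g x"
  by (simp add: Euler_def pd_diff scaleR_diff_right sum_subtractf)
lemma Dirac_diff: "f differentiable (at x) \<Longrightarrow> g differentiable (at x) \<Longrightarrow> Dirac (\<lambda>x. f x - g x) x = Dirac f x - Dirac g x"
  by (simp add: Dirac_def pd_diff cl.diff_right sum_subtractf)
lemma Angular_diff: "f differentiable (at x) \<Longrightarrow> g differentiable (at x) \<Longrightarrow> Angular (\<lambda>x. f x - g x) x = Angular f x - Angular g x"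
  by (simp add: Angular_def Euler_diff Dirac_diff cl.diff_right)

lemma Angular_sum_scaleR:
  assumes "\<And>i. i \<in> I \<Longrightarrow> f i differentiable (at x)"
  shows "Angular (\<lambda>x. \<Sum>i\<in>I. r i *\<^sub>R f i x) x = (\<Sum>i\<in>I. r i *\<^sub>R Angular (f i) x)"
proof -
  have p: "pd b (\<lambda>x. \<Sum>i\<in>I. r i *\<^sub>R f i x) x = (\<Sum>i\<in>I. r i *\<^sub>R pd b (f i) x)" for b
    using assms by (subst pd_sum) (auto intro!: differentiable_scaleR sum.cong simp: pd_scaleR_const)
  have "Euler (\<lambda>x. \<Sum>i\<in>I. r i *\<^sub>R f i x) x = (\<Sum>i\<in>I. r i *\<^sub>R Euler (f i) x)"
    unfolding Euler_def p scaleR_sum_right by (subst sum.swap) (simp add: mult.commute)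
  moreover have "Dirac (\<lambda>x. \<Sum>i\<in>I. r i *\<^sub>R f i x) x = (\<Sum>i\<in>I. r i *\<^sub>R Dirac (f i) x)"
    unfolding Dirac_def p scaleR_sum_right cl.sum_right cl.scaleR_right by (rule sum.swap)
  ultimately show ?thesis
    by (simp add: Angular_def cl.sum_right cl.scaleR_right scaleR_diff_right sum_subtractf)
qed

lemma Angular_scaleR: "f differentiable (at x) \<Longrightarrow> Angular (\<lambda>x. r *\<^sub>R f x) x = r *\<^sub>R Angular f x"
  using Angular_sum_scaleR[of "{()}" "\<lambda>_. f" x "\<lambda>_. r"] by simp

lemma Dirac_position_mult:
  assumes "f differentiable (at x)"
  shows "Dirac (\<lambda>x. c x (f x)) x = real DIM('a) *\<^sub>R f x + 2 *\<^sub>R Euler f x - c x (Dirac f x)"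
proof -
  have "Dirac (\<lambda>x. c x (f x)) x = (\<Sum>b\<in>Basis. ((2 * (x \<bullet> b)) *\<^sub>R pd b f x - c x (c b (pd b f x))) + f x)"
    unfolding Dirac_def
  proof (intro sum.cong refl)
    fix b :: 'a assume b: "b \<in> Basis"
    show "c b (pd b (\<lambda>x. c x (f x)) x) = ((2 * (x \<bullet> b)) *\<^sub>R pd b f x - c x (c b (pd b f x))) + f x"
      using b by (simp add: pd_position_mult[OF assms] cl.add_right c_square c_swap[of b x] inner_commute)
  qed
  also have "\<dots> = real DIM('a) *\<^sub>R f x + 2 *\<^sub>R Euler f x - c x (Dirac f x)"
    by (simp add: sum.distrib sum_subtractf Dirac_def Euler_def cl.sum_right scaleR_sum_right sum_constant_scaleR)
  finally show ?thesis .
qed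

lemma Euler_position_mult:
  assumes "f differentiable (at x)"
  shows "Euler (\<lambda>x. c x (f x)) x = c x (Euler f x) + c x (f x)"
  using c_expand[of x "f x"]
  by (simp add: Euler_def pd_position_mult[OF assms] scaleR_add_right sum.distrib cl.sum_right cl.scaleR_right)

text \<open>
  Multiplication by the position vector reflects the spectrum of \<open>\<Gamma>\<close>: the eigenvalue \<open>l\<close> becomes
  \<open>1 - n - l\<close>.
\<close>

lemma Angular_position_mult:
  assumes "f differentiable (at x)"
  shows "Angular (\<lambda>x. c x (f x)) x = (1 - real DIM('a)) *\<^sub>R c x (f x) - c x (Angular f x)"
  unfolding Angular_def Dirac_position_mult[OF assms] Euler_position_mult[OF assms]
  by (simp add: cl.diff_right cl.add_right cl.scaleR_right scaleR_2 algebra_simps)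

text \<open>
  Pointwise, \<open>w (\<Gamma> f \<bullet> g - f \<bullet> \<Gamma> g)\<close> is the divergence of the field with the components \<open>F b\<close> below;
  the derivatives of the weight cancel because its gradient is a multiple of \<open>x\<close> and
  \<open>c x f \<bullet> c x g = |x|\<^sup>2 (f \<bullet> g)\<close>. Either the weight or the field \<open>f\<close> may provide the compact support.
\<close>

lemma Angular_symmetric:
  assumes f: "C1 f" and g: "C1 g" and w: "C1 w" "csupp (\<lambda>x. w x *\<^sub>R f x)"
    and radial: "\<And>b x. b \<in> Basis \<Longrightarrow> pd b w x = (x \<bullet> b) * \<omega> x"
  shows "(\<integral>x. w x * (Angular f x \<bullet> g x) \<partial>lborel) = (\<integral>x. w x * (f x \<bullet> Angular g x) \<partial>lborel)"
proof -
  define F where "F b x = w x * ((x \<bullet> b) * (f x \<bullet> g x) - c b (f x) \<bullet> c x (g x))" for b x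
  have C1F: "C1 (F b)" for b unfolding F_def
    by (intro C1_mult C1_diff C1_inner w f g C1_coord C1_c_const C1_position_mult)
  have sF: "csupp (F b)" for b
    by (rule csupp_0[OF w(2)]) (auto simp: F_def cl.zero_right)
  have df: "f differentiable (at x)" and dg: "g differentiable (at x)" and dw: "w differentiable (at x)" for x
    using C1D f g w by auto
  have dcf: "(\<lambda>x. c b (f x)) differentiable (at x)" and dcg: "(\<lambda>x. c x (g x)) differentiable (at x)" for b x
    using C1D[OF C1_c_const[OF f]] C1D[OF C1_position_mult[OF g]] by auto
  have pdF: "pd b (F b) x = (x \<bullet> b) * \<omega> x * ((x \<bullet> b) * (f x \<bullet> g x) - c b (f x) \<bullet> c x (g x))
     + w x * (f x \<bullet> g x + (x \<bullet> b) * (pd b f x \<bullet> g x + f x \<bullet> pd b g x)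
        - (c b (pd b f x) \<bullet> c x (g x) + (c b (f x) \<bullet> c x (pd b g x) + f x \<bullet> g x)))" if b: "b \<in> Basis" for b x
  proof -
    have 1: "pd b (\<lambda>x. (x \<bullet> b) * (f x \<bullet> g x)) x = f x \<bullet> g x + (x \<bullet> b) * (pd b f x \<bullet> g x + f x \<bullet> pd b g x)"
      using b by (subst pd_mult) (auto simp: pd_inner df dg intro!: differentiable_inner')
    have 2: "pd b (\<lambda>x. c b (f x) \<bullet> c x (g x)) x = c b (pd b f x) \<bullet> c x (g x) + (c b (f x) \<bullet> c x (pd b g x) + f x \<bullet> g x)"
      using b by (subst pd_inner[OF dcf dcg]) (simp add: pd_c_const df pd_position_mult dg inner_add_right c_inner_c)
    have "pd b (\<lambda>x. (x \<bullet> b) * (f x \<bullet> g x) - c b (f x) \<bullet> c x (g x)) x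
      = f x \<bullet> g x + (x \<bullet> b) * (pd b f x \<bullet> g x + f x \<bullet> pd b g x)
        - (c b (pd b f x) \<bullet> c x (g x) + (c b (f x) \<bullet> c x (pd b g x) + f x \<bullet> g x))"
      by (subst pd_diff) (auto simp: 1 2 intro!: differentiable_inner' differentiable_mult df dg dcf dcg)
    then show ?thesis unfolding F_def
      by (subst pd_mult) (auto simp: radial[OF b] intro!: dw differentiable_diff differentiable_inner' differentiable_mult df dg dcf dcg)
  qed
  have key: "(\<Sum>b\<in>Basis. pd b (F b) x) = w x * (Angular f x \<bullet> g x) - w x * (f x \<bullet> Angular g x)" for x
  proof -
    let ?f = "f x" and ?g = "g x"
    have A: "(\<Sum>b\<in>Basis. (x \<bullet> b) * ((x \<bullet> b) * (?f \<bullet> ?g) - c b ?f \<bullet> c x ?g)) = 0"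
    proof -
      have "(\<Sum>b\<in>Basis. (x \<bullet> b) * (c b ?f \<bullet> c x ?g)) = c x ?f \<bullet> c x ?g"
        by (subst (2) c_expand) (simp add: inner_sum_left)
      moreover have "(\<Sum>b\<in>Basis. (x \<bullet> b) * ((x \<bullet> b) * (?f \<bullet> ?g))) = (x \<bullet> x) * (?f \<bullet> ?g)"
        by (subst (3) euclidean_inner) (simp add: sum_distrib_right mult.assoc)
      ultimately show ?thesis by (simp add: right_diff_distrib sum_subtractf c_inner_c)
    qed
    have B: "(\<Sum>b\<in>Basis. c b ?f \<bullet> c x (pd b g x)) = ?f \<bullet> (2 *\<^sub>R Euler g x - c x (Dirac g x))"
    proof -
      have "(\<Sum>b\<in>Basis. c b ?f \<bullet> c x (pd b g x)) = ?f \<bullet> (\<Sum>b\<in>Basis. (2 * (x \<bullet> b)) *\<^sub>R pd b g x - c x (c b (pd b g x)))"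
        unfolding inner_sum_right by (intro sum.cong refl) (simp add: c_sym c_swap[of _ x] inner_commute[of _ x])
      also have "(\<Sum>b\<in>Basis. (2 * (x \<bullet> b)) *\<^sub>R pd b g x - c x (c b (pd b g x))) = 2 *\<^sub>R Euler g x - c x (Dirac g x)"
        by (simp add: sum_subtractf Dirac_def Euler_def cl.sum_right scaleR_sum_right)
      finally show ?thesis .
    qed
    have C: "(\<Sum>b\<in>Basis. c b (pd b f x) \<bullet> c x ?g) = c x (Dirac f x) \<bullet> ?g"
      by (simp add: Dirac_def inner_sum_left c_sym)
    have "(\<Sum>b\<in>Basis. pd b (F b) x) = \<omega> x * (\<Sum>b\<in>Basis. (x \<bullet> b) * ((x \<bullet> b) * (?f \<bullet> ?g) - c b ?f \<bullet> c x ?g))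
       + w x * ((\<Sum>b\<in>Basis. (x \<bullet> b) * (pd b f x \<bullet> ?g + ?f \<bullet> pd b g x)) - (\<Sum>b\<in>Basis. c b (pd b f x) \<bullet> c x ?g)
          - (\<Sum>b\<in>Basis. c b ?f \<bullet> c x (pd b g x)))"
      unfolding sum_distrib_left sum_subtractf[symmetric] sum.distrib[symmetric]
      by (intro sum.cong refl) (simp add: pdF algebra_simps)
    also have "(\<Sum>b\<in>Basis. (x \<bullet> b) * (pd b f x \<bullet> ?g + ?f \<bullet> pd b g x)) = Euler f x \<bullet> ?g + ?f \<bullet> Euler g x"
      by (simp add: Euler_def inner_sum_left inner_sum_right distrib_left sum.distrib)
    finally show ?thesis unfolding A B C
      by (simp add: Angular_def inner_diff_left inner_diff_right algebra_simps)
  qed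
  have 0: "(\<integral>x. (\<Sum>b\<in>Basis. pd b (F b) x) \<partial>lborel) = 0"
    by (subst Bochner_Integration.integral_sum)
      (auto intro!: integrable_csupp C1_pd C1F csupp_pd sF sum.neutral integral_pd)
  have cw: "continuous_on UNIV w" "continuous_on UNIV f" "continuous_on UNIV g"
    using w f g C1_continuous by auto
  have s1: "csupp (\<lambda>x. w x * (f x \<bullet> Angular g x))" by (rule csupp_0[OF w(2)]) auto
  have i1: "integrable lborel (\<lambda>x. w x * (f x \<bullet> Angular g x))"
    by (intro integrable_csupp s1 continuous_on_mult continuous_on_inner cw continuous_Angular g)
  have s2: "csupp (\<lambda>x. w x * (Angular f x \<bullet> g x))"
  proof -
    have "csupp (\<lambda>x. w x * (f x \<bullet> Angular g x) + (\<Sum>b\<in>Basis. pd b (F b) x))"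
      by (intro csupp_add s1 csupp_sum csupp_pd sF)
    then show ?thesis by (simp add: key)
  qed
  have i2: "integrable lborel (\<lambda>x. w x * (Angular f x \<bullet> g x))"
    by (intro integrable_csupp s2 continuous_on_mult continuous_on_inner cw continuous_Angular f)
  show ?thesis using 0 i1 i2 by (simp add: key)
qed

section \<open>Polynomial eigenfields of the angular operator\<close>

text \<open>
  Homogeneous polynomial fields of degree \<open>k\<close>, generated in the way that makes their calculus
  accessible to rule induction.
\<close>

inductive homogeneous :: "nat \<Rightarrow> ('a \<Rightarrow> 'v) \<Rightarrow> bool" where
  homogeneous_const: "homogeneous 0 (\<lambda>x. v)"
| homogeneous_mult: "homogeneous k f \<Longrightarrow> homogeneous (Suc k) (\<lambda>x. (x \<bullet> b) *\<^sub>R f x)"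
| homogeneous_add: "homogeneous k f \<Longrightarrow> homogeneous k g \<Longrightarrow> homogeneous k (\<lambda>x. f x + g x)"

lemma homogeneous_zero: "homogeneous k (\<lambda>x. 0)"
proof (induction k)
  case (Suc k)
  from homogeneous_mult[OF this, of undefined] show ?case by simp
qed (rule homogeneous_const)

lemma homogeneous_linear: "homogeneous k f \<Longrightarrow> bounded_linear L \<Longrightarrow> homogeneous k (\<lambda>x. L (f x))"
  by (induction rule: homogeneous.induct)
    (auto simp: linear_simps intro: homogeneous.intros)

lemma homogeneous_sum: "(\<And>i. i \<in> I \<Longrightarrow> homogeneous k (f i)) \<Longrightarrow> homogeneous k (\<lambda>x. \<Sum>i\<in>I. f i x)"
  by (induction I rule: infinite_finite_induct) (auto intro: homogeneous_add homogeneous_zero)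

lemma homogeneous_C1: "homogeneous k f \<Longrightarrow> C1 f"
  by (induction rule: homogeneous.induct) (auto intro: C1_add C1_scaleR)

lemma homogeneous_Euler: "homogeneous k f \<Longrightarrow> Euler f x = real k *\<^sub>R f x"
proof (induction rule: homogeneous.induct)
  case (homogeneous_const v)
  then show ?case by (simp add: Euler_def)
next
  case (homogeneous_mult k f d)
  have D: "f differentiable (at x)" using homogeneous_C1[OF homogeneous_mult.hyps] by (rule C1D)
  have "Euler (\<lambda>x. (x \<bullet> d) *\<^sub>R f x) x = (\<Sum>b\<in>Basis. ((x \<bullet> b) * (b \<bullet> d)) *\<^sub>R f x) + (x \<bullet> d) *\<^sub>R Euler f x"
    by (simp add: Euler_def pd_scaleR D scaleR_add_right sum.distrib scaleR_sum_right mult.commute)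
  also have "(\<Sum>b\<in>Basis. ((x \<bullet> b) * (b \<bullet> d)) *\<^sub>R f x) = (x \<bullet> d) *\<^sub>R f x"
    unfolding scaleR_sum_left[symmetric] euclidean_inner[of x d] by (simp add: inner_commute)
  finally show ?case using homogeneous_mult.IH by (simp add: algebra_simps)
next
  case (homogeneous_add k f g)
  have "f differentiable (at x)" "g differentiable (at x)"
    using homogeneous_C1[OF homogeneous_add.hyps(1)] homogeneous_C1[OF homogeneous_add.hyps(2)] by (auto intro: C1D)
  then show ?case using homogeneous_add.IH by (simp add: Euler_add scaleR_add_right)
qed

lemma homogeneous_pd: "homogeneous k f \<Longrightarrow> homogeneous (k - 1) (pd b f) \<and> (k = 0 \<longrightarrow> pd b f = (\<lambda>x. 0))"
proof (induction rule: homogeneous.induct)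
  case (homogeneous_const v)
  have "pd b (\<lambda>x::'a. v) = (\<lambda>x. 0)" by (rule ext) simp
  then show ?case using homogeneous_zero by simp
next
  case (homogeneous_mult k f d)
  have D: "f differentiable (at x)" for x using homogeneous_C1[OF homogeneous_mult.hyps] by (rule C1D)
  have eq: "pd b (\<lambda>x. (x \<bullet> d) *\<^sub>R f x) = (\<lambda>x. (b \<bullet> d) *\<^sub>R f x + (x \<bullet> d) *\<^sub>R pd b f x)"
    by (rule ext) (simp add: pd_scaleR D)
  have 1: "homogeneous k (\<lambda>x. (b \<bullet> d) *\<^sub>R f x)"
    by (rule homogeneous_linear[OF homogeneous_mult.hyps bounded_linear_scaleR_right])
  have 2: "homogeneous k (\<lambda>x. (x \<bullet> d) *\<^sub>R pd b f x)"
  proof (cases k)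
    case 0
    then show ?thesis using homogeneous_mult.IH homogeneous_zero by simp
  next
    case (Suc j)
    then show ?thesis using homogeneous_mult.IH homogeneous.homogeneous_mult[of j "pd b f" d] by simp
  qed
  show ?case unfolding eq using homogeneous.homogeneous_add[OF 1 2] by simp
next
  case (homogeneous_add k f g)
  have D: "f differentiable (at x)" "g differentiable (at x)" for x
    using homogeneous_C1[OF homogeneous_add.hyps(1)] homogeneous_C1[OF homogeneous_add.hyps(2)] by (auto intro: C1D)
  have eq: "pd b (\<lambda>x. f x + g x) = (\<lambda>x. pd b f x + pd b g x)" by (rule ext) (simp add: pd_add D)
  show ?case unfolding eq using homogeneous_add.IH homogeneous.homogeneous_add[of "k - 1" "pd b f" "pd b g"] by simp
qed

lemma homogeneous_Dirac: assumes "homogeneous k f" shows "homogeneous (k - 1) (Dirac f)"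
  unfolding Dirac_def
  by (intro homogeneous_sum homogeneous_linear[OF _ bounded_linear_c] conjunct1[OF homogeneous_pd[OF assms]])

lemma homogeneous_0_Dirac: assumes "homogeneous 0 f" shows "Dirac f x = 0"
  using homogeneous_pd[OF assms] by (simp add: Dirac_def cl.zero_right)

definition eigenfield :: "int \<Rightarrow> ('a \<Rightarrow> 'v) \<Rightarrow> bool" where
  "eigenfield l g \<longleftrightarrow> C1 g \<and> (\<forall>x. Angular g x = real_of_int l *\<^sub>R g x)"

text \<open>
  Grouped by eigenvalue, with at most one summand each, so that distinct summands will be
  orthogonal.
\<close>

definition eigenfield_sum :: "int set \<Rightarrow> ('a \<Rightarrow> 'v) \<Rightarrow> bool" where
  "eigenfield_sum A f \<longleftrightarrow> (\<exists>L p. finite L \<and> L \<subseteq> A \<and> (\<forall>l\<in>L. eigenfield l (p l)) \<and> (\<forall>x. f x = (\<Sum>l\<in>L. p l x)))"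

lemma eigenfield_add: "eigenfield l f \<Longrightarrow> eigenfield l g \<Longrightarrow> eigenfield l (\<lambda>x. f x + g x)"
proof -
  assume a: "eigenfield l f" "eigenfield l g"
  have "Angular (\<lambda>x. f x + g x) x = real_of_int l *\<^sub>R (f x + g x)" for x
    using Angular_sum_scaleR[of "UNIV :: bool set" "\<lambda>b. if b then f else g" x "\<lambda>_. 1"] a
    by (auto simp: UNIV_bool eigenfield_def C1D scaleR_add_right add.commute)
  then show ?thesis using a by (simp add: eigenfield_def C1_add)
qed

lemma eigenfield_zero: "eigenfield l (\<lambda>x. 0)"
  by (simp add: eigenfield_def Angular_def Euler_def Dirac_def cl.zero_right)

lemma eigenfield_sum_add:
  assumes "eigenfield_sum A f" "eigenfield_sum A g" shows "eigenfield_sum A (\<lambda>x. f x + g x)"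
proof -
  obtain L p where L: "finite L" "L \<subseteq> A" "\<And>l. l \<in> L \<Longrightarrow> eigenfield l (p l)" "\<And>x. f x = (\<Sum>l\<in>L. p l x)"
    using assms(1) unfolding eigenfield_sum_def by blast
  obtain M q where M: "finite M" "M \<subseteq> A" "\<And>l. l \<in> M \<Longrightarrow> eigenfield l (q l)" "\<And>x. g x = (\<Sum>l\<in>M. q l x)"
    using assms(2) unfolding eigenfield_sum_def by blast
  define p' q' where "p' l x = (if l \<in> L then p l x else 0)" and "q' l x = (if l \<in> M then q l x else 0)" for l x
  have e: "eigenfield l (p' l)" "eigenfield l (q' l)" for l
    using L(3) M(3) eigenfield_zero by (cases "l \<in> L"; cases "l \<in> M"; auto simp: p'_def[abs_def] q'_def[abs_def])+
  have "f x = (\<Sum>l\<in>L \<union> M. p' l x)" for x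
    unfolding L(4) by (rule sum.mono_neutral_cong_left) (use L M in \<open>auto simp: p'_def\<close>)
  moreover have "g x = (\<Sum>l\<in>L \<union> M. q' l x)" for x
    unfolding M(4) by (rule sum.mono_neutral_cong_left) (use L M in \<open>auto simp: q'_def\<close>)
  ultimately have "f x + g x = (\<Sum>l\<in>L \<union> M. p' l x + q' l x)" for x by (simp add: sum.distrib)
  then show ?thesis unfolding eigenfield_sum_def using L M eigenfield_add[OF e]
    by (intro exI[of _ "L \<union> M"] exI[of _ "\<lambda>l x. p' l x + q' l x"]) auto
qed

text \<open>
  Euler's identity gives \<open>(k - \<Gamma>) f = c x D f\<close>, and \<open>D f\<close> has degree \<open>k - 1\<close>. By induction \<open>D f\<close> is a
  sum of eigenfields with eigenvalues \<open>l\<close>, so \<open>(k - \<Gamma>) f\<close> is a sum of eigenfields with the reflected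
  eigenvalues \<open>1 - n - l\<close>. The bounds on \<open>l\<close> exclude \<open>1 - n - l = k\<close>, so these summands have
  preimages under \<open>k - \<Gamma>\<close>, and what remains of \<open>f\<close> is an eigenfield for \<open>k\<close>. Tracking the exact
  range of eigenvalues is what makes the induction work.
\<close>

lemma homogeneous_eigenfield_sum:
  "homogeneous k f \<Longrightarrow> eigenfield_sum ({0..int k} \<union> {2 - int DIM('a) - int k .. 1 - int DIM('a)}) f"
proof (induction k arbitrary: f)
  case 0
  have "eigenfield 0 f" using homogeneous_C1[OF 0] homogeneous_Euler[OF 0] homogeneous_0_Dirac[OF 0]
    by (simp add: eigenfield_def Angular_def cl.zero_right)
  then show ?case unfolding eigenfield_sum_def by (intro exI[of _ "{0}"] exI[of _ "\<lambda>_. f"]) auto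
next
  case (Suc k)
  let ?N = "int DIM('a)"
  have "homogeneous k (Dirac f)" using homogeneous_Dirac[OF Suc.prems] by simp
  from Suc.IH[OF this] obtain L q where L: "finite L" "L \<subseteq> {0..int k} \<union> {2 - ?N - int k .. 1 - ?N}"
    "\<And>l. l \<in> L \<Longrightarrow> eigenfield l (q l)" "\<And>x. Dirac f x = (\<Sum>l\<in>L. q l x)"
    unfolding eigenfield_sum_def by blast
  define K where "K = int (Suc k)"
  define \<mu> where "\<mu> l = 1 - ?N - l" for l
  define r where "r l x = c x (q l x)" for l x
  \<comment> \<open>Removing the preimages of the summands of \<open>(K - \<Gamma>) f\<close> leaves the part with eigenvalue \<open>K\<close>.\<close>
  define p where "p x = f x - (\<Sum>l\<in>L. (1 / real_of_int (K - \<mu> l)) *\<^sub>R r l x)" for x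
  have DIM: "?N \<ge> 1" using DIM_positive[where 'a='a] by linarith
  have \<mu>: "\<mu> l \<in> {0..int (Suc k)} \<union> {2 - ?N - int (Suc k) .. 1 - ?N}" "\<mu> l \<noteq> K" if "l \<in> L" for l
  proof -
    have l: "0 \<le> l \<and> l \<le> int k \<or> 2 - ?N - int k \<le> l \<and> l \<le> 1 - ?N" using L(2) that by auto
    then show "\<mu> l \<in> {0..int (Suc k)} \<union> {2 - ?N - int (Suc k) .. 1 - ?N}"
      using DIM by (auto simp: \<mu>_def)
    show "\<mu> l \<noteq> K"
    proof
      assume "\<mu> l = K"
      then have "l = - ?N - int k" by (simp add: \<mu>_def K_def)
      moreover have "int k \<ge> 0" by simp
      ultimately show False using l DIM by linarith
    qed
  qed
  have r: "eigenfield (\<mu> l) (r l)" if l: "l \<in> L" for l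
  proof -
    have q: "C1 (q l)" "\<And>x. Angular (q l) x = real_of_int l *\<^sub>R q l x" using L(3)[OF l] by (auto simp: eigenfield_def)
    then show ?thesis
      by (auto simp: eigenfield_def r_def[abs_def] C1_position_mult Angular_position_mult C1D cl.scaleR_right \<mu>_def scaleR_diff_left)
  qed
  have C1r: "C1 (r l)" if "l \<in> L" for l using r[OF that] by (simp add: eigenfield_def)
  have p: "eigenfield K p"
    unfolding eigenfield_def
  proof (intro conjI allI)
    show "C1 p" unfolding p_def using homogeneous_C1[OF Suc.prems] C1r by (intro C1_diff C1_sum C1_scaleR_const) auto
    fix x
    have "Angular p x = Angular f x - (\<Sum>l\<in>L. (1 / real_of_int (K - \<mu> l)) *\<^sub>R Angular (r l) x)"
      unfolding p_def
      by (subst Angular_diff) (use C1D[OF homogeneous_C1[OF Suc.prems]] C1D[OF C1r] L(1) in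
         \<open>auto simp: Angular_sum_scaleR intro!: differentiable_sum differentiable_scaleR\<close>)
    also have "Angular f x = real_of_int K *\<^sub>R f x - (\<Sum>l\<in>L. r l x)"
      by (simp add: Angular_def homogeneous_Euler[OF Suc.prems] K_def L(4) cl.sum_right r_def)
    also have "real_of_int K *\<^sub>R f x - (\<Sum>l\<in>L. r l x) - (\<Sum>l\<in>L. (1 / real_of_int (K - \<mu> l)) *\<^sub>R Angular (r l) x)
      = real_of_int K *\<^sub>R f x - (\<Sum>l\<in>L. r l x + (1 / real_of_int (K - \<mu> l)) *\<^sub>R Angular (r l) x)"
      by (simp add: sum.distrib)
    also have "(\<Sum>l\<in>L. r l x + (1 / real_of_int (K - \<mu> l)) *\<^sub>R Angular (r l) x)
      = (\<Sum>l\<in>L. real_of_int K *\<^sub>R ((1 / real_of_int (K - \<mu> l)) *\<^sub>R r l x))"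
    proof (intro sum.cong refl)
      fix l assume l: "l \<in> L"
      have nz: "real_of_int (K - \<mu> l) \<noteq> 0" using \<mu>(2)[OF l] by simp
      have "r l x + (1 / real_of_int (K - \<mu> l)) *\<^sub>R Angular (r l) x
          = (1 + (1 / real_of_int (K - \<mu> l)) * real_of_int (\<mu> l)) *\<^sub>R r l x"
        using r[OF l] by (simp add: eigenfield_def scaleR_add_left)
      also have "1 + (1 / real_of_int (K - \<mu> l)) * real_of_int (\<mu> l) = real_of_int K * (1 / real_of_int (K - \<mu> l))"
        using nz by (simp add: field_simps)
      finally show "r l x + (1 / real_of_int (K - \<mu> l)) *\<^sub>R Angular (r l) x = real_of_int K *\<^sub>R ((1 / real_of_int (K - \<mu> l)) *\<^sub>R r l x)"
        by simp
    qed
    finally show "Angular p x = real_of_int K *\<^sub>R p x" unfolding p_def scaleR_diff_right scaleR_sum_right .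
  qed
  define P where "P l x = (if l = K then p x else (1 / real_of_int (K - l)) *\<^sub>R r (1 - ?N - l) x)" for l x
  have inv: "1 - ?N - \<mu> l = l" for l by (simp add: \<mu>_def)
  have inj: "inj_on \<mu> L" by (rule inj_onI) (simp add: \<mu>_def)
  have "f x = (\<Sum>l\<in>insert K (\<mu> ` L). P l x)" for x
  proof -
    have "K \<notin> \<mu> ` L" using \<mu>(2) by blast
    then have "(\<Sum>l\<in>insert K (\<mu> ` L). P l x) = p x + (\<Sum>l\<in>L. P (\<mu> l) x)"
      using L(1) by (simp add: sum.reindex[OF inj] P_def)
    also have "(\<Sum>l\<in>L. P (\<mu> l) x) = (\<Sum>l\<in>L. (1 / real_of_int (K - \<mu> l)) *\<^sub>R r l x)"
      by (intro sum.cong refl) (use \<mu>(2) in \<open>auto simp: P_def inv\<close>)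
    finally show ?thesis by (simp add: p_def)
  qed
  moreover have "eigenfield l (P l)" if l: "l \<in> insert K (\<mu> ` L)" for l
  proof (cases "l = K")
    case False
    then obtain j where j: "j \<in> L" "l = \<mu> j" using l by auto
    have "P l = (\<lambda>x. (1 / real_of_int (K - \<mu> j)) *\<^sub>R r j x)" using False j by (auto simp: P_def inv)
    then show ?thesis using r[OF j(1)] j(2) by (auto simp: eigenfield_def C1_scaleR_const Angular_scaleR C1D)
  qed (use p in \<open>simp add: P_def[abs_def]\<close>)
  moreover have "insert K (\<mu> ` L) \<subseteq> {0..int (Suc k)} \<union> {2 - ?N - int (Suc k) .. 1 - ?N}"
  proof -
    have "K \<in> {0..int (Suc k)}" by (simp add: K_def)
    moreover have "\<mu> ` L \<subseteq> {0..int (Suc k)} \<union> {2 - ?N - int (Suc k) .. 1 - ?N}"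
      by (rule image_subsetI) (rule \<mu>(1))
    ultimately show ?thesis by blast
  qed
  ultimately show ?case unfolding eigenfield_sum_def using L(1)
    by (intro exI[of _ "insert K (\<mu> ` L)"] exI[of _ P]) auto
qed


inductive polynomial_field :: "('a \<Rightarrow> 'v) \<Rightarrow> bool" where
  polynomial_field_homogeneous: "homogeneous k f \<Longrightarrow> polynomial_field f"
| polynomial_field_add: "polynomial_field f \<Longrightarrow> polynomial_field g \<Longrightarrow> polynomial_field (\<lambda>x. f x + g x)"

lemma polynomial_field_sum: "(\<And>i. i \<in> I \<Longrightarrow> polynomial_field (f i)) \<Longrightarrow> polynomial_field (\<lambda>x. \<Sum>i\<in>I. f i x)"
  by (induction I rule: infinite_finite_induct) (auto intro: polynomial_field_add polynomial_field_homogeneous[OF homogeneous_zero])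

lemma polynomial_field_scale: "polynomial_field f \<Longrightarrow> polynomial_field (\<lambda>x. r *\<^sub>R f x)"
proof (induction rule: polynomial_field.induct)
  case (polynomial_field_homogeneous k f)
  then show ?case by (intro polynomial_field.polynomial_field_homogeneous[of k] homogeneous_linear[OF _ bounded_linear_scaleR_right])
qed (auto simp: scaleR_add_right intro: polynomial_field.polynomial_field_add)

lemma polynomial_field_coord: "polynomial_field f \<Longrightarrow> polynomial_field (\<lambda>x. (x \<bullet> b) *\<^sub>R f x)"
proof (induction rule: polynomial_field.induct)
  case (polynomial_field_homogeneous k f)
  then show ?case by (intro polynomial_field.polynomial_field_homogeneous[of "Suc k"] homogeneous_mult)
qed (auto simp: scaleR_add_right intro: polynomial_field.polynomial_field_add)

lemma polynomial_field_mult: "real_polynomial_function p \<Longrightarrow> polynomial_field f \<Longrightarrow> polynomial_field (\<lambda>x. p x *\<^sub>R f x)"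
proof (induction arbitrary: f rule: real_polynomial_function.induct)
  case (linear p)
  have "p x *\<^sub>R f x = (\<Sum>b\<in>Basis. (x \<bullet> b) *\<^sub>R (p b *\<^sub>R f x))" for x
  proof -
    have "p x = p (\<Sum>b\<in>Basis. (x \<bullet> b) *\<^sub>R b)" by (simp add: euclidean_representation)
    also have "\<dots> = (\<Sum>b\<in>Basis. (x \<bullet> b) * p b)"
      using linear.hyps by (simp add: linear_sum linear_scale bounded_linear.linear)
    finally show ?thesis by (simp add: scaleR_sum_left)
  qed
  then show ?case using linear.prems by (simp only:) (intro polynomial_field_sum polynomial_field_coord polynomial_field_scale)
next
  case (add p q)
  then show ?case by (simp add: scaleR_add_left polynomial_field_add)
next
  case (mult p q)
  have "polynomial_field (\<lambda>x. p x *\<^sub>R (q x *\<^sub>R f x))" by (intro mult.IH mult.prems)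
  then show ?case by simp
qed (rule polynomial_field_scale)

lemma polynomial_field_eigenfield_sum: "polynomial_field f \<Longrightarrow> eigenfield_sum (monogenic_degrees DIM('a)) f"
proof (induction rule: polynomial_field.induct)
  case (polynomial_field_homogeneous k f)
  obtain L p where "finite L" "L \<subseteq> {0..int k} \<union> {2 - int DIM('a) - int k .. 1 - int DIM('a)}"
     "\<forall>l\<in>L. eigenfield l (p l)" "\<forall>x. f x = (\<Sum>l\<in>L. p l x)"
    using homogeneous_eigenfield_sum[OF polynomial_field_homogeneous] unfolding eigenfield_sum_def by blast
  then show ?case unfolding eigenfield_sum_def monogenic_degrees_def by (intro exI[of _ L] exI[of _ p]) auto
qed (rule eigenfield_sum_add)

text \<open>
  The expansion of \<open>v\<close> in finitely many fixed vectors reduces this to the Stone-Weierstrass theorem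
  for real-valued functions.
\<close>

lemma eigenfield_sum_dense:
  assumes v: "continuous_on UNIV v" and B: "finite B" "\<And>x. v x = (\<Sum>e\<in>B. (v x \<bullet> e) *\<^sub>R e)" and \<epsilon>: "\<epsilon> > 0"
  obtains p where "eigenfield_sum (monogenic_degrees DIM('a)) p" "\<And>x. norm x \<le> R \<Longrightarrow> norm (v x - p x) \<le> \<epsilon>"
proof -
  define K where "K = (\<Sum>e\<in>B. norm e) + 1"
  have K: "K > 0" unfolding K_def by (intro add_nonneg_pos sum_nonneg) auto
  have "\<exists>g. real_polynomial_function g \<and> (\<forall>x\<in>cball 0 R. \<bar>v x \<bullet> e - g x\<bar> < \<epsilon> / K)" for e
  proof -
    have "continuous_on (cball 0 R) (\<lambda>x. v x \<bullet> e)"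
      by (intro continuous_on_inner continuous_on_subset[OF v] continuous_on_const) auto
    from Stone_Weierstrass_real_polynomial_function[OF compact_cball this, of "\<epsilon> / K"]
    show ?thesis using \<epsilon> K by (metis divide_pos_pos)
  qed
  then obtain g where g: "\<And>e. real_polynomial_function (g e)" "\<And>e x. norm x \<le> R \<Longrightarrow> \<bar>v x \<bullet> e - g e x\<bar> < \<epsilon> / K"
    by (metis mem_cball_0)
  define p where "p x = (\<Sum>e\<in>B. g e x *\<^sub>R e)" for x
  have "polynomial_field p" unfolding p_def by (intro polynomial_field_sum polynomial_field_mult g polynomial_field_homogeneous[OF homogeneous_const])
  then have "eigenfield_sum (monogenic_degrees DIM('a)) p" by (rule polynomial_field_eigenfield_sum)
  moreover have "norm (v x - p x) \<le> \<epsilon>" if x: "norm x \<le> R" for x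
  proof -
    have "v x - p x = (\<Sum>e\<in>B. (v x \<bullet> e - g e x) *\<^sub>R e)"
      by (subst B(2)) (simp add: p_def sum_subtractf scaleR_diff_left)
    also have "norm \<dots> \<le> (\<Sum>e\<in>B. norm ((v x \<bullet> e - g e x) *\<^sub>R e))" by (rule norm_sum)
    also have "\<dots> \<le> (\<Sum>e\<in>B. \<epsilon> / K * norm e)"
      unfolding norm_scaleR by (intro sum_mono mult_right_mono) (use g(2)[OF x] in \<open>auto intro: less_imp_le\<close>)
    also have "\<dots> = \<epsilon> / K * (K - 1)" by (simp add: sum_distrib_left K_def)
    also have "\<dots> \<le> \<epsilon> / K * K" using \<epsilon> K by (intro mult_left_mono) auto
    finally show ?thesis using K by simp
  qed
  ultimately show ?thesis using that by blast
qed

end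

section \<open>The spectral gap and the Hardy inequality\<close>

lemma has_real_derivative_max_sq: "((\<lambda>s::real. (max 0 s)\<^sup>2) has_real_derivative 2 * max 0 s) (at s)"
proof -
  consider "s > 0" | "s < 0" | "s = 0" by linarith
  then show ?thesis
  proof cases
    case 1
    have "((\<lambda>s::real. s\<^sup>2) has_real_derivative 2 * s) (at s)" by (auto intro!: derivative_eq_intros)
    then have "((\<lambda>s::real. (max 0 s)\<^sup>2) has_real_derivative 2 * s) (at s)"
      by (rule has_field_derivative_transform_within[where d=s]) (use 1 in \<open>auto simp: dist_real_def max_def\<close>)
    then show ?thesis using 1 by simp
  next
    case 2
    have "((\<lambda>s::real. 0) has_real_derivative 0) (at s)" by simp
    then have "((\<lambda>s::real. (max 0 s)\<^sup>2) has_real_derivative 0) (at s)"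
      by (rule has_field_derivative_transform_within[where d="-s"]) (use 2 in \<open>auto simp: dist_real_def max_def\<close>)
    then show ?thesis using 2 by simp
  next
    case 3
    have "(\<lambda>h::real. (max 0 h)\<^sup>2 / h) = max 0"
      by (rule ext) (auto simp: max_def power2_eq_square)
    moreover have "(max 0 \<longlongrightarrow> max 0 (0::real)) (at 0)" by (intro tendsto_intros)
    ultimately show ?thesis using 3 by (simp add: DERIV_def)
  qed
qed

lemma integral_double_sum:
  fixes f :: "'i \<Rightarrow> 'j \<Rightarrow> 'x \<Rightarrow> real"
  assumes "\<And>i j. i \<in> I \<Longrightarrow> j \<in> J \<Longrightarrow> integrable M (f i j)"
  shows "(\<integral>x. (\<Sum>i\<in>I. \<Sum>j\<in>J. f i j x) \<partial>M) = (\<Sum>i\<in>I. \<Sum>j\<in>J. integral\<^sup>L M (f i j))"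
proof -
  have "(\<integral>x. (\<Sum>i\<in>I. \<Sum>j\<in>J. f i j x) \<partial>M) = (\<Sum>i\<in>I. \<integral>x. (\<Sum>j\<in>J. f i j x) \<partial>M)"
    by (rule Bochner_Integration.integral_sum) (intro Bochner_Integration.integrable_sum assms)
  also have "\<dots> = (\<Sum>i\<in>I. \<Sum>j\<in>J. integral\<^sup>L M (f i j))"
    by (intro sum.cong refl Bochner_Integration.integral_sum assms)
  finally show ?thesis .
qed

context clifford
begin

text \<open>
  Polynomial fields are not square integrable, so they are compared in a weighted \<open>L\<^sup>2\<close> space. Any
  radial weight of class C1 with compact support keeps \<open>\<Gamma>\<close> symmetric; this one also fills up the
  whole space, after division by \<open>R\<^sup>4\<close>, as \<open>R\<close> tends to infinity.
\<close>

definition cutoff :: "real \<Rightarrow> 'a \<Rightarrow> real" where "cutoff R x = (max 0 (R\<^sup>2 - x \<bullet> x))\<^sup>2"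

lemma cutoff_has_derivative:
  "(cutoff R has_derivative (\<lambda>h. (x \<bullet> h) * (- 4 * max 0 (R\<^sup>2 - x \<bullet> x)))) (at x)"
proof -
  have 1: "((\<lambda>x. R\<^sup>2 - x \<bullet> x) has_derivative (\<lambda>h. - (2 * (x \<bullet> h)))) (at x)"
    by (auto intro!: derivative_eq_intros simp: inner_commute)
  have "((\<lambda>x. (max 0 (R\<^sup>2 - x \<bullet> x))\<^sup>2) has_derivative (\<lambda>h. 2 * max 0 (R\<^sup>2 - x \<bullet> x) * (- (2 * (x \<bullet> h))))) (at x)"
    by (rule has_derivative_compose[OF 1 has_real_derivative_max_sq[unfolded has_field_derivative_def]])
  then show ?thesis by (simp add: cutoff_def[abs_def] mult_ac)
qed

lemma pd_cutoff: "pd b (cutoff R) x = (x \<bullet> b) * (- 4 * max 0 (R\<^sup>2 - x \<bullet> x))"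
  by (rule pd_eq[OF cutoff_has_derivative])

lemma C1_cutoff: "C1 (cutoff R)"
proof (rule C1I)
  show "cutoff R differentiable (at x)" for x using cutoff_has_derivative by (auto simp: differentiable_def)
  show "pd b (cutoff R) x = (x \<bullet> b) * (- 4 * max 0 (R\<^sup>2 - x \<bullet> x))" for b x by (rule pd_cutoff)
qed (intro continuous_intros)

lemma csupp_cutoff: "csupp (cutoff R)"
proof (rule csuppI)
  fix x :: 'a assume "\<bar>R\<bar> < norm x"
  then have "R\<^sup>2 < (norm x)\<^sup>2" by (metis abs_ge_zero power2_abs power_strict_mono pos2)
  then show "cutoff R x = 0" by (simp add: cutoff_def power2_norm_eq_inner)
qed

abbreviation cutoff_inner :: "real \<Rightarrow> ('a \<Rightarrow> 'v) \<Rightarrow> ('a \<Rightarrow> 'v) \<Rightarrow> real" where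
  "cutoff_inner R f g \<equiv> \<integral>x. cutoff R x * (f x \<bullet> g x) \<partial>lborel"

lemma integrable_cutoff_inner:
  assumes "continuous_on UNIV f" "continuous_on UNIV g"
  shows "integrable lborel (\<lambda>x. cutoff R x * (f x \<bullet> g x))"
  by (intro integrable_csupp csupp_0[OF csupp_cutoff[of R]] continuous_on_mult continuous_on_inner assms C1_continuous[OF C1_cutoff]) simp

lemma Angular_symmetric_cutoff:
  assumes "C1 f" "C1 g" shows "cutoff_inner R (Angular f) g = cutoff_inner R f (Angular g)"
  by (rule Angular_symmetric[OF assms C1_cutoff _ pd_cutoff]) (rule csupp_0[OF csupp_cutoff[of R]], simp)

lemma eigenfield_orthogonal:
  assumes "eigenfield l f" "eigenfield k g" "l \<noteq> k" shows "cutoff_inner R f g = 0"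
proof -
  have "cutoff_inner R (Angular f) g = cutoff_inner R f (Angular g)" using assms by (intro Angular_symmetric_cutoff) (auto simp: eigenfield_def)
  moreover have "cutoff_inner R (Angular f) g = real_of_int l * cutoff_inner R f g"
    using assms(1) by (simp add: eigenfield_def mult.left_commute)
  moreover have "cutoff_inner R f (Angular g) = real_of_int k * cutoff_inner R f g"
    using assms(2) by (simp add: eigenfield_def mult.left_commute)
  ultimately show ?thesis using assms(3) by simp
qed

lemma cutoff_inner_orthogonal_sum:
  assumes L: "finite L" "\<And>l. l \<in> L \<Longrightarrow> eigenfield l (p l)"
  shows "cutoff_inner R (\<lambda>x. \<Sum>l\<in>L. \<alpha> l *\<^sub>R p l x) (\<lambda>x. \<Sum>l\<in>L. \<alpha> l *\<^sub>R p l x) = (\<Sum>l\<in>L. (\<alpha> l)\<^sup>2 * cutoff_inner R (p l) (p l))"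
proof -
  have cp: "continuous_on UNIV (p l)" if "l \<in> L" for l
    using L(2)[OF that] C1_continuous by (auto simp: eigenfield_def)
  have "cutoff_inner R (\<lambda>x. \<Sum>l\<in>L. \<alpha> l *\<^sub>R p l x) (\<lambda>x. \<Sum>l\<in>L. \<alpha> l *\<^sub>R p l x)
     = (\<integral>x. (\<Sum>l\<in>L. \<Sum>k\<in>L. \<alpha> l * \<alpha> k * (cutoff R x * (p l x \<bullet> p k x))) \<partial>lborel)"
  proof (rule Bochner_Integration.integral_cong[OF refl])
    fix x
    have "(\<Sum>l\<in>L. \<alpha> l *\<^sub>R p l x) \<bullet> (\<Sum>l\<in>L. \<alpha> l *\<^sub>R p l x) = (\<Sum>l\<in>L. \<Sum>k\<in>L. \<alpha> l * (\<alpha> k * (p l x \<bullet> p k x)))"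
      unfolding inner_sum_left by (simp add: inner_sum_right sum_distrib_left mult.left_commute)
    then show "cutoff R x * ((\<Sum>l\<in>L. \<alpha> l *\<^sub>R p l x) \<bullet> (\<Sum>l\<in>L. \<alpha> l *\<^sub>R p l x))
      = (\<Sum>l\<in>L. \<Sum>k\<in>L. \<alpha> l * \<alpha> k * (cutoff R x * (p l x \<bullet> p k x)))"
      by (simp add: sum_distrib_left mult_ac)
  qed
  also have "\<dots> = (\<Sum>l\<in>L. \<Sum>k\<in>L. \<alpha> l * \<alpha> k * cutoff_inner R (p l) (p k))"
    by (subst integral_double_sum) (auto intro!: integrable_mult_right integrable_cutoff_inner cp)
  also have "\<dots> = (\<Sum>l\<in>L. \<Sum>k\<in>L. if k = l then (\<alpha> l)\<^sup>2 * cutoff_inner R (p l) (p l) else 0)"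
    by (intro sum.cong refl) (auto simp: power2_eq_square eigenfield_orthogonal[OF L(2) L(2)])
  also have "\<dots> = (\<Sum>l\<in>L. (\<alpha> l)\<^sup>2 * cutoff_inner R (p l) (p l))"
    using L(1) by (simp add: sum.delta)
  finally show ?thesis .
qed

lemma cutoff_inner_nonneg: "cutoff_inner R f f \<ge> 0"
  by (rule Bochner_Integration.integral_nonneg) (simp add: cutoff_def)

text \<open>
  On a sum of eigenfields, \<open>\<Gamma> - a\<close> is inverted by dividing each summand by \<open>l - a\<close>; orthogonality
  turns \<open>d \<le> |l - a|\<close> into the bound for the norm.
\<close>

lemma eigenfield_sum_resolvent:
  assumes p: "eigenfield_sum (monogenic_degrees DIM('a)) p" and d: "d > 0" "\<And>l. l \<in> monogenic_degrees DIM('a) \<Longrightarrow> d \<le> \<bar>real_of_int l - a\<bar>"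
  obtains q where "C1 q" "\<And>x. Angular q x - a *\<^sub>R q x = p x" "d\<^sup>2 * cutoff_inner R q q \<le> cutoff_inner R p p"
proof -
  obtain L P where L: "finite L" "L \<subseteq> monogenic_degrees DIM('a)" "\<And>l. l \<in> L \<Longrightarrow> eigenfield l (P l)" "\<And>x. p x = (\<Sum>l\<in>L. P l x)"
    using p unfolding eigenfield_sum_def by blast
  define \<alpha> where "\<alpha> l = 1 / (real_of_int l - a)" for l
  define q where "q x = (\<Sum>l\<in>L. \<alpha> l *\<^sub>R P l x)" for x
  have C1P: "C1 (P l)" if "l \<in> L" for l using L(3)[OF that] by (simp add: eigenfield_def)
  have q: "C1 q" unfolding q_def by (intro C1_sum C1_scaleR_const C1P)
  have "Angular q x - a *\<^sub>R q x = p x" for x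
  proof -
    have "Angular q x = (\<Sum>l\<in>L. \<alpha> l *\<^sub>R Angular (P l) x)"
      unfolding q_def by (rule Angular_sum_scaleR[OF C1D[OF C1P]])
    then have "Angular q x - a *\<^sub>R q x = (\<Sum>l\<in>L. \<alpha> l *\<^sub>R Angular (P l) x - a *\<^sub>R (\<alpha> l *\<^sub>R P l x))"
      by (simp add: q_def scaleR_sum_right sum_subtractf)
    also have "\<dots> = (\<Sum>l\<in>L. P l x)"
    proof (intro sum.cong refl)
      fix l assume l: "l \<in> L"
      have nz: "real_of_int l - a \<noteq> 0" using d(1) d(2)[of l] l L(2) by auto
      have "\<alpha> l *\<^sub>R Angular (P l) x - a *\<^sub>R (\<alpha> l *\<^sub>R P l x) = (\<alpha> l * (real_of_int l - a)) *\<^sub>R P l x"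
        using L(3)[OF l] by (simp add: eigenfield_def algebra_simps)
      then show "\<alpha> l *\<^sub>R Angular (P l) x - a *\<^sub>R (\<alpha> l *\<^sub>R P l x) = P l x" using nz by (simp add: \<alpha>_def)
    qed
    finally show ?thesis by (simp add: L(4))
  qed
  moreover have "d\<^sup>2 * cutoff_inner R q q \<le> cutoff_inner R p p"
  proof -
    have "cutoff_inner R p p = (\<Sum>l\<in>L. cutoff_inner R (P l) (P l))"
      using cutoff_inner_orthogonal_sum[OF L(1,3), where \<alpha>="\<lambda>_. 1" and R=R] by (simp add: L(4))
    moreover have "cutoff_inner R q q = (\<Sum>l\<in>L. (\<alpha> l)\<^sup>2 * cutoff_inner R (P l) (P l))"
      unfolding q_def by (rule cutoff_inner_orthogonal_sum[OF L(1,3)])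
    moreover have "(\<Sum>l\<in>L. d\<^sup>2 * ((\<alpha> l)\<^sup>2 * cutoff_inner R (P l) (P l))) \<le> (\<Sum>l\<in>L. cutoff_inner R (P l) (P l))"
    proof (rule sum_mono)
      fix l assume l: "l \<in> L"
      have "d\<^sup>2 \<le> (real_of_int l - a)\<^sup>2"
        using d(1) d(2)[of l] l L(2) by (metis abs_le_square_iff abs_of_pos subsetD)
      moreover have "(real_of_int l - a)\<^sup>2 > 0" using d(1) d(2)[of l] l L(2) by auto
      ultimately have "d\<^sup>2 * (\<alpha> l)\<^sup>2 \<le> 1" by (simp add: \<alpha>_def power_divide)
      from mult_right_mono[OF this cutoff_inner_nonneg[of R "P l"]]
      show "d\<^sup>2 * ((\<alpha> l)\<^sup>2 * cutoff_inner R (P l) (P l)) \<le> cutoff_inner R (P l) (P l)" by (simp add: mult.assoc)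
    qed
    ultimately show ?thesis by (simp add: sum_distrib_left)
  qed
  ultimately show ?thesis using that q by blast
qed

text \<open>
  All values lie in a fixed finite-dimensional subspace, and there they are expanded as in an
  orthonormal basis.
\<close>

definition finite_rank :: "('a \<Rightarrow> 'v) \<Rightarrow> bool" where
  "finite_rank v \<longleftrightarrow> (\<exists>B. finite B \<and> (\<forall>x. v x = (\<Sum>e\<in>B. (v x \<bullet> e) *\<^sub>R e)))"

text \<open>
  Duality. Let \<open>p\<close> be a polynomial field close to \<open>v\<close>, and solve \<open>\<Gamma> q - a q = p\<close>. Symmetry gives
  \<open>\<langle>v, p\<rangle> = \<langle>\<Gamma> v - a v, q\<rangle>\<close>, which is at most half of \<open>\<parallel>\<Gamma> v - a v\<parallel>\<^sup>2 / d\<^sup>2 + \<parallel>p\<parallel>\<^sup>2\<close>. In the expansion of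
  \<open>\<parallel>v - p\<parallel>\<^sup>2\<close> the terms \<open>\<parallel>p\<parallel>\<^sup>2\<close> cancel, and the claim follows up to the error \<open>\<parallel>v - p\<parallel>\<^sup>2\<close>.
\<close>

lemma spectral_gap_weighted:
  assumes v: "C1 v" "finite_rank v" and d: "d > 0" "\<And>l. l \<in> monogenic_degrees DIM('a) \<Longrightarrow> d \<le> \<bar>real_of_int l - a\<bar>"
  shows "d\<^sup>2 * cutoff_inner R v v \<le> cutoff_inner R (\<lambda>x. Angular v x - a *\<^sub>R v x) (\<lambda>x. Angular v x - a *\<^sub>R v x)"
proof (rule field_le_epsilon)
  fix \<delta> :: real assume \<delta>: "\<delta> > 0"
  define W where "W = (\<integral>x. cutoff R x \<partial>lborel)"
  have W: "W \<ge> 0" unfolding W_def by (rule Bochner_Integration.integral_nonneg) (simp add: cutoff_def)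
  have iW: "integrable lborel (cutoff R)" by (intro integrable_csupp csupp_cutoff C1_continuous C1_cutoff)
  define \<epsilon> where "\<epsilon> = sqrt (\<delta> / (d\<^sup>2 * (W + 1)))"
  have \<epsilon>: "\<epsilon> > 0" unfolding \<epsilon>_def using \<delta> W d by simp
  have \<epsilon>2: "d\<^sup>2 * (\<epsilon>\<^sup>2 * W) \<le> \<delta>"
  proof -
    have "\<epsilon>\<^sup>2 = \<delta> / (d\<^sup>2 * (W + 1))" unfolding \<epsilon>_def using \<delta> W d by simp
    then have "d\<^sup>2 * \<epsilon>\<^sup>2 = \<delta> / (W + 1)" using d(1) by simp
    then have "d\<^sup>2 * (\<epsilon>\<^sup>2 * W) = \<delta> * (W / (W + 1))" by (simp add: mult.assoc[symmetric])
    also have "\<dots> \<le> \<delta> * 1" using \<delta> W by (intro mult_left_mono) auto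
    finally show ?thesis by simp
  qed
  have cv: "continuous_on UNIV v" by (rule C1_continuous[OF v(1)])
  obtain B where B: "finite B" "\<And>x. v x = (\<Sum>e\<in>B. (v x \<bullet> e) *\<^sub>R e)" using v(2) unfolding finite_rank_def by blast
  obtain p where p: "eigenfield_sum (monogenic_degrees DIM('a)) p" "\<And>x. norm x \<le> \<bar>R\<bar> \<Longrightarrow> norm (v x - p x) \<le> \<epsilon>"
    using eigenfield_sum_dense[OF cv B \<epsilon>] by blast
  obtain q where q: "C1 q" "\<And>x. Angular q x - a *\<^sub>R q x = p x" "d\<^sup>2 * cutoff_inner R q q \<le> cutoff_inner R p p"
    using eigenfield_sum_resolvent[OF p(1) d] by blast
  define Bv where "Bv x = Angular v x - a *\<^sub>R v x" for x
  have cG: "continuous_on UNIV (Angular v)" "continuous_on UNIV (Angular q)" using continuous_Angular v q by auto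
  have cq: "continuous_on UNIV q" by (rule C1_continuous[OF q(1)])
  have cB: "continuous_on UNIV Bv" unfolding Bv_def by (intro continuous_on_diff cG continuous_on_scaleR continuous_on_const cv)
  have pq: "p = (\<lambda>x. Angular q x - a *\<^sub>R q x)" using q(2) by auto
  have cp: "continuous_on UNIV p" unfolding pq by (intro continuous_on_diff cG continuous_on_scaleR continuous_on_const cq)
  note ii = integrable_cutoff_inner[of _ _ R]
  have vp: "cutoff_inner R v p = cutoff_inner R Bv q"
  proof -
    have "cutoff_inner R v p = cutoff_inner R v (Angular q) - a * cutoff_inner R v q"
      unfolding pq by (simp add: inner_diff_right right_diff_distrib mult.left_commute ii cv cG cq)
    moreover have "cutoff_inner R Bv q = cutoff_inner R (Angular v) q - a * cutoff_inner R v q"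
      unfolding Bv_def by (simp add: inner_diff_left right_diff_distrib mult.left_commute ii cv cG cq)
    ultimately show ?thesis using Angular_symmetric_cutoff[OF v(1) q(1), of R] by simp
  qed
  have young: "2 * d\<^sup>2 * cutoff_inner R Bv q \<le> cutoff_inner R Bv Bv + d\<^sup>2 * (d\<^sup>2 * cutoff_inner R q q)"
  proof -
    have "0 \<le> cutoff_inner R (\<lambda>x. Bv x - d\<^sup>2 *\<^sub>R q x) (\<lambda>x. Bv x - d\<^sup>2 *\<^sub>R q x)" by (rule cutoff_inner_nonneg)
    also have "(\<lambda>x. cutoff R x * ((Bv x - d\<^sup>2 *\<^sub>R q x) \<bullet> (Bv x - d\<^sup>2 *\<^sub>R q x)))
      = (\<lambda>x. cutoff R x * (Bv x \<bullet> Bv x) - 2 * d\<^sup>2 * (cutoff R x * (Bv x \<bullet> q x)) + d\<^sup>2 * (d\<^sup>2 * (cutoff R x * (q x \<bullet> q x))))"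
      by (rule ext) (simp add: inner_diff_left inner_diff_right inner_commute algebra_simps)
    also have "integral\<^sup>L lborel \<dots> = cutoff_inner R Bv Bv - 2 * d\<^sup>2 * cutoff_inner R Bv q + d\<^sup>2 * (d\<^sup>2 * cutoff_inner R q q)"
      by (simp add: ii cB cq)
    finally show ?thesis by simp
  qed
  have expand: "cutoff_inner R (\<lambda>x. v x - p x) (\<lambda>x. v x - p x) = cutoff_inner R v v - 2 * cutoff_inner R v p + cutoff_inner R p p"
  proof -
    have "(\<lambda>x. cutoff R x * ((v x - p x) \<bullet> (v x - p x)))
      = (\<lambda>x. cutoff R x * (v x \<bullet> v x) - 2 * (cutoff R x * (v x \<bullet> p x)) + cutoff R x * (p x \<bullet> p x))"
      by (rule ext) (simp add: inner_diff_left inner_diff_right inner_commute algebra_simps)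
    then show ?thesis by (simp add: ii cv cp)
  qed
  have "cutoff_inner R (\<lambda>x. v x - p x) (\<lambda>x. v x - p x) \<le> (\<integral>x. \<epsilon>\<^sup>2 * cutoff R x \<partial>lborel)"
  proof (rule integral_mono)
    show "integrable lborel (\<lambda>x. cutoff R x * ((v x - p x) \<bullet> (v x - p x)))"
      by (intro ii continuous_on_diff cv cp)
    show "integrable lborel (\<lambda>x. \<epsilon>\<^sup>2 * cutoff R x)" using iW by simp
    fix x
    show "cutoff R x * ((v x - p x) \<bullet> (v x - p x)) \<le> \<epsilon>\<^sup>2 * cutoff R x"
    proof (cases "norm x \<le> \<bar>R\<bar>")
      case True
      have "(v x - p x) \<bullet> (v x - p x) \<le> \<epsilon>\<^sup>2"
        unfolding power2_norm_eq_inner[symmetric] by (rule power_mono[OF p(2)[OF True]]) simp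
      then show ?thesis unfolding mult.commute[of "\<epsilon>\<^sup>2"] by (rule mult_left_mono) (simp add: cutoff_def)
    next
      case False
      then have "R\<^sup>2 < (norm x)\<^sup>2" by (metis abs_ge_zero not_le power2_abs power_strict_mono pos2)
      then show ?thesis by (simp add: cutoff_def power2_norm_eq_inner)
    qed
  qed
  also have "\<dots> = \<epsilon>\<^sup>2 * W" by (simp add: W_def)
  finally have E: "d\<^sup>2 * cutoff_inner R (\<lambda>x. v x - p x) (\<lambda>x. v x - p x) \<le> \<delta>"
    using \<epsilon>2 mult_left_mono[of "cutoff_inner R (\<lambda>x. v x - p x) (\<lambda>x. v x - p x)" "\<epsilon>\<^sup>2 * W" "d\<^sup>2"] by simp
  have "d\<^sup>2 * cutoff_inner R v v = d\<^sup>2 * cutoff_inner R (\<lambda>x. v x - p x) (\<lambda>x. v x - p x) + 2 * d\<^sup>2 * cutoff_inner R v p - d\<^sup>2 * cutoff_inner R p p"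
    unfolding expand by (simp add: algebra_simps)
  also have "\<dots> \<le> \<delta> + (cutoff_inner R Bv Bv + d\<^sup>2 * (d\<^sup>2 * cutoff_inner R q q)) - d\<^sup>2 * (d\<^sup>2 * cutoff_inner R q q)"
    using E young vp mult_left_mono[OF q(3), of "d\<^sup>2"] by simp
  finally show "d\<^sup>2 * cutoff_inner R v v \<le> cutoff_inner R (\<lambda>x. Angular v x - a *\<^sub>R v x) (\<lambda>x. Angular v x - a *\<^sub>R v x) + \<delta>"
    by (simp add: Bv_def)
qed

lemma csupp_Angular: "csupp v \<Longrightarrow> csupp (\<lambda>x. Angular v x - a *\<^sub>R v x)"
proof -
  assume v: "csupp v"
  have "csupp (\<lambda>x. Euler v x + (- c x (Dirac v x)) + (- a *\<^sub>R v x))"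
    by (intro csupp_add csupp_Euler v csupp_0[OF csupp_Dirac[OF v]] csupp_0[OF v]) (auto simp: cl.zero_right)
  then show ?thesis by (simp add: Angular_def)
qed

text \<open>
  The weighted inequality, divided by \<open>R\<^sup>4\<close>. On the support of \<open>v\<close>, which lies in a ball of radius \<open>\<rho>\<close>,
  the normalised weight is at least \<open>(1 - (\<rho> / R)\<^sup>2)\<^sup>2\<close>, which tends to one.
\<close>

lemma spectral_gap:
  assumes v: "C1 v" "csupp v" "finite_rank v" and d: "d > 0" "\<And>l. l \<in> monogenic_degrees DIM('a) \<Longrightarrow> d \<le> \<bar>real_of_int l - a\<bar>"
  shows "d\<^sup>2 * (\<integral>x. v x \<bullet> v x \<partial>lborel) \<le> (\<integral>x. (Angular v x - a *\<^sub>R v x) \<bullet> (Angular v x - a *\<^sub>R v x) \<partial>lborel)"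
proof -
  define Bv where "Bv x = Angular v x - a *\<^sub>R v x" for x
  define I J where "I = (\<integral>x. v x \<bullet> v x \<partial>lborel)" and "J = (\<integral>x. Bv x \<bullet> Bv x \<partial>lborel)"
  have cv: "continuous_on UNIV v" by (rule C1_continuous[OF v(1)])
  have cB: "continuous_on UNIV Bv" unfolding Bv_def
    by (intro continuous_on_diff continuous_Angular v continuous_on_scaleR continuous_on_const cv)
  have sB: "csupp Bv" unfolding Bv_def by (rule csupp_Angular[OF v(2)])
  have iB: "integrable lborel (\<lambda>x. Bv x \<bullet> Bv x)"
    by (intro integrable_csupp continuous_on_inner cB csupp_0[OF sB]) simp
  have iv: "integrable lborel (\<lambda>x. v x \<bullet> v x)"
    by (intro integrable_csupp continuous_on_inner cv csupp_0[OF v(2)]) simp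
  obtain \<rho>' where \<rho>': "\<And>x. \<rho>' < norm x \<Longrightarrow> v x = 0" using csuppE[OF v(2)] by blast
  define \<rho> where "\<rho> = \<bar>\<rho>'\<bar>"
  have \<rho>: "\<And>x. \<rho> < norm x \<Longrightarrow> v x = 0" "\<rho> \<ge> 0" using \<rho>' by (auto simp: \<rho>_def)
  have "d\<^sup>2 * ((1 - (\<rho> / R)\<^sup>2)\<^sup>2 * I) \<le> J" if R: "R > \<rho>" for R
  proof -
    have R0: "R > 0" using R \<rho>(2) by linarith
    have "(R\<^sup>2 - \<rho>\<^sup>2)\<^sup>2 * I = (\<integral>x. (R\<^sup>2 - \<rho>\<^sup>2)\<^sup>2 * (v x \<bullet> v x) \<partial>lborel)" unfolding I_def by simp
    also have "\<dots> \<le> cutoff_inner R v v"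
    proof (rule integral_mono)
      fix x
      show "(R\<^sup>2 - \<rho>\<^sup>2)\<^sup>2 * (v x \<bullet> v x) \<le> cutoff R x * (v x \<bullet> v x)"
      proof (cases "\<rho> < norm x")
        case False
        then have "(norm x)\<^sup>2 \<le> \<rho>\<^sup>2" by (intro power_mono) auto
        moreover have "\<rho>\<^sup>2 \<le> R\<^sup>2" using R \<rho>(2) by (intro power_mono) auto
        ultimately have "(R\<^sup>2 - \<rho>\<^sup>2)\<^sup>2 \<le> cutoff R x"
          unfolding cutoff_def power2_norm_eq_inner[symmetric] by (intro power_mono) auto
        then show ?thesis by (rule mult_right_mono) simp
      qed (simp add: \<rho>(1))
    qed (use iv integrable_cutoff_inner[OF cv cv] in auto)
    finally have 1: "(R\<^sup>2 - \<rho>\<^sup>2)\<^sup>2 * I \<le> cutoff_inner R v v" .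
    have "cutoff_inner R Bv Bv \<le> (\<integral>x. (R\<^sup>2)\<^sup>2 * (Bv x \<bullet> Bv x) \<partial>lborel)"
    proof (rule integral_mono)
      fix x
      have "cutoff R x \<le> (R\<^sup>2)\<^sup>2" unfolding cutoff_def by (intro power_mono) auto
      then show "cutoff R x * (Bv x \<bullet> Bv x) \<le> (R\<^sup>2)\<^sup>2 * (Bv x \<bullet> Bv x)" by (rule mult_right_mono) simp
    qed (use iB integrable_cutoff_inner[OF cB cB] in auto)
    also have "\<dots> = (R\<^sup>2)\<^sup>2 * J" unfolding J_def by simp
    finally have 2: "cutoff_inner R Bv Bv \<le> (R\<^sup>2)\<^sup>2 * J" .
    have "d\<^sup>2 * ((R\<^sup>2 - \<rho>\<^sup>2)\<^sup>2 * I) \<le> d\<^sup>2 * cutoff_inner R v v" using 1 by (rule mult_left_mono) simp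
    also have "\<dots> \<le> cutoff_inner R Bv Bv" unfolding Bv_def by (rule spectral_gap_weighted[OF v(1,3) d])
    also note 2
    also have "(R\<^sup>2 - \<rho>\<^sup>2)\<^sup>2 = (R\<^sup>2)\<^sup>2 * (1 - (\<rho> / R)\<^sup>2)\<^sup>2"
    proof -
      have "R\<^sup>2 * (1 - (\<rho> / R)\<^sup>2) = R\<^sup>2 - \<rho>\<^sup>2" using R0 by (simp add: right_diff_distrib power_divide)
      then show ?thesis by (simp only: power_mult_distrib[symmetric])
    qed
    finally have "(R\<^sup>2)\<^sup>2 * (d\<^sup>2 * ((1 - (\<rho> / R)\<^sup>2)\<^sup>2 * I)) \<le> (R\<^sup>2)\<^sup>2 * J" by (simp add: mult_ac)
    moreover have "(R\<^sup>2)\<^sup>2 > 0" using R0 by simp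
    ultimately show ?thesis by (rule mult_left_le_imp_le)
  qed
  then have ev: "eventually (\<lambda>R. d\<^sup>2 * ((1 - (\<rho> / R)\<^sup>2)\<^sup>2 * I) \<le> J) at_top"
    using eventually_gt_at_top[of \<rho>] by (rule eventually_mono[rotated])
  have "((\<lambda>R::real. \<rho> / R) \<longlongrightarrow> 0) at_top"
    by (rule tendsto_divide_0[OF tendsto_const]) (simp add: filterlim_at_top_imp_at_infinity filterlim_ident)
  then have "((\<lambda>R. d\<^sup>2 * ((1 - (\<rho> / R)\<^sup>2)\<^sup>2 * I)) \<longlongrightarrow> d\<^sup>2 * ((1 - 0\<^sup>2)\<^sup>2 * I)) at_top"
    by (intro tendsto_intros)
  from tendsto_upperbound[OF this ev] show ?thesis by (simp add: I_def J_def Bv_def)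
qed


lemma integral_Euler:
  fixes f g :: "'a \<Rightarrow> 'v"
  assumes f: "C1 f" "csupp f" and g: "C1 g"
  shows "(\<integral>x. Euler f x \<bullet> g x \<partial>lborel) = - (\<integral>x. f x \<bullet> Euler g x \<partial>lborel) - real DIM('a) * (\<integral>x. f x \<bullet> g x \<partial>lborel)"
proof -
  have cf: "continuous_on UNIV f" "continuous_on UNIV g" using f g C1_continuous by auto
  have D: "f differentiable (at x)" "g differentiable (at x)" for x using C1D f g by auto
  define F where "F b x = (x \<bullet> b) * (f x \<bullet> g x)" for b x
  have F: "C1 (F b)" "csupp (F b)" for b unfolding F_def
    by (intro C1_mult C1_coord C1_inner f g) (rule csupp_0[OF f(2)], simp)
  have pdF: "pd b (F b) x = f x \<bullet> g x + ((x \<bullet> b) * (pd b f x \<bullet> g x) + (x \<bullet> b) * (f x \<bullet> pd b g x))" if "b \<in> Basis" for b x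
    unfolding F_def using that by (subst pd_mult) (auto simp: pd_inner D distrib_left intro!: differentiable_inner' D)
  have key: "(\<Sum>b\<in>Basis. pd b (F b) x) = Euler f x \<bullet> g x + f x \<bullet> Euler g x + real DIM('a) * (f x \<bullet> g x)" for x
    by (simp add: pdF sum.distrib Euler_def inner_sum_left inner_sum_right)
  have "(\<integral>x. (\<Sum>b\<in>Basis. pd b (F b) x) \<partial>lborel) = 0"
    by (subst Bochner_Integration.integral_sum)
      (auto intro!: integrable_csupp C1_pd F csupp_pd sum.neutral integral_pd)
  moreover have "integrable lborel (\<lambda>x. Euler f x \<bullet> g x)" "integrable lborel (\<lambda>x. f x \<bullet> Euler g x)" "integrable lborel (\<lambda>x. f x \<bullet> g x)"
    by (intro integrable_csupp continuous_on_inner continuous_Euler cf f g csupp_0[OF csupp_Euler[OF f(2)]] csupp_0[OF f(2)]; simp)+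
  ultimately show ?thesis by (simp add: key)
qed

lemma Dirac_Euler:
  assumes v: "C2 v"
  shows "Dirac (Euler v) x = Dirac v x + Euler (Dirac v) x"
proof -
  have D: "pd d v differentiable (at x)" if "d \<in> Basis" for d using C1D[OF C2_pd[OF v that]] .
  have 1: "pd b (Euler v) x = pd b v x + (\<Sum>d\<in>Basis. (x \<bullet> d) *\<^sub>R pd b (pd d v) x)" if b: "b \<in> Basis" for b
  proof -
    have "pd b (Euler v) x = (\<Sum>d\<in>Basis. (b \<bullet> d) *\<^sub>R pd d v x + (x \<bullet> d) *\<^sub>R pd b (pd d v) x)"
      unfolding Euler_def using D by (subst pd_sum) (auto intro!: differentiable_scaleR sum.cong simp: pd_scaleR)
    also have "\<dots> = pd b v x + (\<Sum>d\<in>Basis. (x \<bullet> d) *\<^sub>R pd b (pd d v) x)"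
      by (simp add: sum.distrib pd_sum_Basis[OF C2D[OF v], symmetric])
    finally show ?thesis .
  qed
  have 2: "pd d (Dirac v) x = (\<Sum>b\<in>Basis. c b (pd b (pd d v) x))" if d: "d \<in> Basis" for d
    unfolding Dirac_def using D
    by (subst pd_sum) (auto intro!: differentiable_linear'[OF bounded_linear_c] sum.cong simp: pd_c_const pd_commute[OF v _ d])
  have "Dirac (Euler v) x = Dirac v x + (\<Sum>b\<in>Basis. \<Sum>d\<in>Basis. (x \<bullet> d) *\<^sub>R c b (pd b (pd d v) x))"
    by (simp add: Dirac_def 1 cl.add_right sum.distrib cl.sum_right cl.scaleR_right)
  also have "(\<Sum>b\<in>Basis. \<Sum>d\<in>Basis. (x \<bullet> d) *\<^sub>R c b (pd b (pd d v) x)) = Euler (Dirac v) x"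
    unfolding Euler_def by (subst sum.swap) (simp add: 2 scaleR_sum_right)
  finally show ?thesis .
qed

text \<open>
  The angular operator commutes with dilations; this is where the symmetry of the second
  derivatives enters.
\<close>

lemma Angular_Euler:
  assumes v: "C2 v"
  shows "Angular (Euler v) x = Euler (Angular v) x"
proof -
  have D: "Euler v differentiable (at x)" "Dirac v differentiable (at x)" "(\<lambda>x. c x (Dirac v x)) differentiable (at x)"
    using C1D[OF C1_Euler[OF v]] C1D[OF C1_Dirac[OF v]] C1D[OF C1_position_mult[OF C1_Dirac[OF v]]] by auto
  have "Euler (Angular v) x = Euler (Euler v) x - (c x (Euler (Dirac v) x) + c x (Dirac v x))"
    unfolding Angular_def using Euler_diff[OF D(1,3)] Euler_position_mult[OF D(2)] by simp
  then show ?thesis by (simp add: Angular_def Dirac_Euler[OF v] cl.add_right)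
qed

lemma Angular_symmetric_csupp:
  assumes "C1 f" "C1 g" "csupp f"
  shows "(\<integral>x. Angular f x \<bullet> g x \<partial>lborel) = (\<integral>x. f x \<bullet> Angular g x \<partial>lborel)"
  using Angular_symmetric[OF assms(1,2) C1_const[of 1], of "\<lambda>_. 0"] assms(3) by simp

text \<open>
  With \<open>P = (E + n/2) v\<close> and \<open>Q = (\<Gamma> - a) v\<close> for \<open>a = - (s + n/2)\<close>, the integrand on the right is
  \<open>|P - Q|\<^sup>2\<close>. Since \<open>E + n/2\<close> is skew and commutes with the symmetric \<open>\<Gamma>\<close>, the integral of \<open>P \<bullet> Q\<close>
  vanishes; then \<open>\<integral> |P - Q|\<^sup>2 \<ge> \<integral> |Q|\<^sup>2\<close>, and the spectral gap applies.
\<close>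

lemma hardy_inequality:
  assumes v: "C2 v" "csupp v" "finite_rank v"
    and d: "d > 0" "\<And>l. l \<in> monogenic_degrees DIM('a) \<Longrightarrow> d \<le> \<bar>real_of_int l + s + real DIM('a) / 2\<bar>"
  shows "d\<^sup>2 * (\<integral>x. (norm (v x))\<^sup>2 \<partial>lborel) \<le> (\<integral>x. (norm (c x (Dirac v x) - s *\<^sub>R v x))\<^sup>2 \<partial>lborel)"
proof -
  define n where "n = real DIM('a)"
  define a where "a = - (s + n / 2)"
  define P Q where "P x = Euler v x + (n / 2) *\<^sub>R v x" and "Q x = Angular v x - a *\<^sub>R v x" for x
  have v1: "C1 v" by (rule C2_C1[OF v(1)])
  have c: "continuous_on UNIV v" "continuous_on UNIV (Euler v)" "continuous_on UNIV (Angular v)"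
    using C1_continuous continuous_Euler continuous_Angular v1 by auto
  have cP: "continuous_on UNIV P" and cQ: "continuous_on UNIV Q"
    unfolding P_def Q_def by (intro continuous_on_add continuous_on_diff continuous_on_scaleR continuous_on_const c)+
  have sE: "csupp (Euler v)" by (rule csupp_Euler[OF v(2)])
  have sQ: "csupp Q" unfolding Q_def by (rule csupp_Angular[OF v(2)])
  have sP: "csupp P" unfolding P_def by (rule csupp_add[OF sE]) (rule csupp_0[OF v(2)], simp)
  have int: "integrable lborel (\<lambda>x. f x \<bullet> g x)" if "continuous_on UNIV f" "continuous_on UNIV g" "csupp f" for f g :: "'a \<Rightarrow> 'v"
    by (rule integrable_csupp[OF continuous_on_inner[OF that(1,2)]]) (rule csupp_0[OF that(3)], simp)
  define EG vG Ev vv where "EG = (\<integral>x. Euler v x \<bullet> Angular v x \<partial>lborel)" and "vG = (\<integral>x. v x \<bullet> Angular v x \<partial>lborel)"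
    and "Ev = (\<integral>x. Euler v x \<bullet> v x \<partial>lborel)" and "vv = (\<integral>x. v x \<bullet> v x \<partial>lborel)"
  have "Ev = - n * vv - Ev"
    using integral_Euler[OF v1 v(2) v1] by (simp add: Ev_def vv_def n_def inner_commute)
  then have Ev: "Ev = - n / 2 * vv" by simp
  have "EG = - n / 2 * vG"
  proof -
    \<comment> \<open>Two expressions for the same integral: move \<open>E\<close> to the other side by parts, or move \<open>\<Gamma>\<close>
      by symmetry and commute it with \<open>E\<close>.\<close>
    have "EG = - (\<integral>x. v x \<bullet> Euler (Angular v) x \<partial>lborel) - n * vG"
      using integral_Euler[OF v1 v(2) C1_Angular[OF v(1)]] by (simp add: EG_def vG_def n_def)
    moreover have "EG = (\<integral>x. v x \<bullet> Euler (Angular v) x \<partial>lborel)"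
      using Angular_symmetric_csupp[OF C1_Euler[OF v(1)] v1 sE]
      by (simp add: EG_def Angular_Euler[OF v(1)] inner_commute)
    ultimately show ?thesis by simp
  qed
  moreover note Ev
  moreover have "(\<integral>x. P x \<bullet> Q x \<partial>lborel) = EG - a * Ev + n / 2 * vG - n / 2 * (a * vv)"
  proof -
    have "(\<lambda>x. P x \<bullet> Q x) = (\<lambda>x. Euler v x \<bullet> Angular v x - a * (Euler v x \<bullet> v x) + n / 2 * (v x \<bullet> Angular v x) - n / 2 * (a * (v x \<bullet> v x)))"
      unfolding P_def Q_def by (simp add: inner_diff_right inner_add_left algebra_simps)
    then show ?thesis by (simp add: EG_def Ev_def vG_def vv_def int c v sE)
  qed
  ultimately have PQ: "(\<integral>x. P x \<bullet> Q x \<partial>lborel) = 0" by simp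
  have eq: "c x (Dirac v x) - s *\<^sub>R v x = P x - Q x" for x
    unfolding P_def Q_def a_def Angular_def by (simp add: algebra_simps)
  have "d\<^sup>2 * (\<integral>x. v x \<bullet> v x \<partial>lborel) \<le> (\<integral>x. Q x \<bullet> Q x \<partial>lborel)"
    unfolding Q_def
  proof (rule spectral_gap[OF v1 v(2,3) d(1)])
    fix l assume l: "l \<in> monogenic_degrees DIM('a)"
    have "real_of_int l - a = real_of_int l + s + real DIM('a) / 2" by (simp add: a_def n_def)
    then show "d \<le> \<bar>real_of_int l - a\<bar>" using d(2)[OF l] by simp
  qed
  also have "\<dots> \<le> (\<integral>x. P x \<bullet> P x \<partial>lborel) - 2 * (\<integral>x. P x \<bullet> Q x \<partial>lborel) + (\<integral>x. Q x \<bullet> Q x \<partial>lborel)"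
    unfolding PQ by simp
  also have "\<dots> = (\<integral>x. P x \<bullet> P x - 2 * (P x \<bullet> Q x) + Q x \<bullet> Q x \<partial>lborel)"
    by (simp add: int cP cQ sP sQ)
  also have "\<dots> = (\<integral>x. (norm (P x - Q x))\<^sup>2 \<partial>lborel)"
    by (simp add: power2_norm_eq_inner inner_diff_left inner_diff_right inner_commute algebra_simps)
  finally show ?thesis by (simp add: eq power2_norm_eq_inner)
qed

text \<open>
  In the expansion of \<open>|D v|\<^sup>2\<close> into terms \<open>T b d\<close>, integrating by parts twice exchanges the two
  derivatives, so \<open>T b d\<close> has the same integral as \<open>U b d\<close>. By the Clifford relations \<open>T b d + U b d\<close>
  vanishes for \<open>b \<noteq> d\<close> and is twice the square of the partial derivative for \<open>b = d\<close>.
\<close>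

lemma integral_Dirac:
  assumes v: "C2 v" "csupp v"
  shows "(\<integral>x. (norm (Dirac v x))\<^sup>2 \<partial>lborel) = (\<integral>x. (\<Sum>b\<in>Basis. (norm (pd b v x))\<^sup>2) \<partial>lborel)"
proof -
  define T U where "T b d x = c b (pd b v x) \<bullet> c d (pd d v x)" and "U b d x = c b (pd d v x) \<bullet> c d (pd b v x)" for b d x
  have v1: "C1 v" by (rule C2_C1[OF v(1)])
  have cc: "continuous_on UNIV (\<lambda>x. c b (pd d v x))" if "d \<in> Basis" for b d
    by (rule bounded_linear.continuous_on[OF bounded_linear_c C1_pd[OF v1 that]])
  have sc: "csupp (\<lambda>x. c b (pd d v x))" for b d
    by (rule csupp_0[OF csupp_pd[OF v(2), of d]]) (simp add: cl.zero_right)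
  have iT: "integrable lborel (T b d)" if "b \<in> Basis" "d \<in> Basis" for b d
    unfolding T_def by (rule integrable_csupp[OF continuous_on_inner[OF cc cc]]) (use that in \<open>auto intro!: csupp_0[OF sc[of b b]]\<close>)
  have iU: "integrable lborel (U b d)" if "b \<in> Basis" "d \<in> Basis" for b d
    unfolding U_def by (rule integrable_csupp[OF continuous_on_inner[OF cc cc]]) (use that in \<open>auto intro!: csupp_0[OF sc[of b d]]\<close>)
  have TU: "integral\<^sup>L lborel (T b d) = integral\<^sup>L lborel (U b d)" if b: "b \<in> Basis" and d: "d \<in> Basis" for b d
  proof -
    have D: "v differentiable (at x)" "pd b v differentiable (at x)" "pd d v differentiable (at x)" for x
      using C2D[OF v(1)] C1D[OF C2_pd[OF v(1) b]] C1D[OF C2_pd[OF v(1) d]] by auto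
    have C: "C1 (\<lambda>x. c b (v x))" "C1 (\<lambda>x. c d (pd d v x))" "C1 (\<lambda>x. c d (pd b v x))" "csupp (\<lambda>x. c b (v x))"
      by (auto intro!: C1_c_const v1 C2_pd v b d csupp_0[OF v(2)] simp: cl.zero_right)
    have "integral\<^sup>L lborel (T b d) = - (\<integral>x. c b (v x) \<bullet> c d (pd b (pd d v) x) \<partial>lborel)"
      using integral_pd_inner_parts[OF C(1,2,4) b] by (simp add: T_def[abs_def] pd_c_const D)
    moreover have "integral\<^sup>L lborel (U b d) = - (\<integral>x. c b (v x) \<bullet> c d (pd d (pd b v) x) \<partial>lborel)"
      using integral_pd_inner_parts[OF C(1,3,4) d] by (simp add: U_def[abs_def] pd_c_const D)
    ultimately show ?thesis by (simp add: pd_commute[OF v(1) b d])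
  qed
  have TpU: "T b d x + U b d x = (if d = b then 2 * (norm (pd b v x))\<^sup>2 else 0)" if "b \<in> Basis" "d \<in> Basis" for b d x
  proof -
    have "T b d x = c d (c b (pd b v x)) \<bullet> pd d v x" by (simp add: T_def c_sym)
    moreover have "U b d x = c b (c d (pd b v x)) \<bullet> pd d v x"
      unfolding U_def by (simp add: c_sym inner_commute)
    ultimately have "T b d x + U b d x = ((2 * (d \<bullet> b)) *\<^sub>R pd b v x) \<bullet> pd d v x"
      using c_anticommute[of d b "pd b v x"] by (simp add: inner_add_left[symmetric])
    then show ?thesis using that by (auto simp: inner_Basis power2_norm_eq_inner)
  qed
  have "2 * (\<integral>x. (norm (Dirac v x))\<^sup>2 \<partial>lborel) = 2 * (\<integral>x. (\<Sum>b\<in>Basis. \<Sum>d\<in>Basis. T b d x) \<partial>lborel)"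
    unfolding power2_norm_eq_inner Dirac_def T_def inner_sum_left by (simp only: inner_sum_right)
  also have "(\<integral>x. (\<Sum>b\<in>Basis. \<Sum>d\<in>Basis. T b d x) \<partial>lborel) = (\<Sum>b\<in>Basis. \<Sum>d\<in>Basis. integral\<^sup>L lborel (T b d))"
    by (rule integral_double_sum[OF iT])
  also have "2 * \<dots> = (\<Sum>b\<in>Basis. \<Sum>d\<in>Basis. integral\<^sup>L lborel (T b d) + integral\<^sup>L lborel (U b d))"
    by (simp add: TU sum_distrib_left)
  also have "\<dots> = (\<Sum>b\<in>Basis. \<Sum>d\<in>Basis. \<integral>x. T b d x + U b d x \<partial>lborel)"
    by (intro sum.cong refl) (simp add: iT iU)
  also have "\<dots> = (\<Sum>b\<in>Basis. \<Sum>d\<in>Basis. if d = b then 2 * (\<integral>x. (norm (pd b v x))\<^sup>2 \<partial>lborel) else 0)"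
    by (intro sum.cong refl) (auto simp: TpU)
  also have "\<dots> = (\<Sum>b\<in>Basis. 2 * (\<integral>x. (norm (pd b v x))\<^sup>2 \<partial>lborel))" by (simp add: sum.delta)
  also have "\<dots> = 2 * (\<integral>x. (\<Sum>b\<in>Basis. (norm (pd b v x))\<^sup>2) \<partial>lborel)"
  proof -
    have "integrable lborel (\<lambda>x. (norm (pd b v x))\<^sup>2)" if b: "b \<in> Basis" for b
      by (rule integrable_csupp) (auto intro!: continuous_intros C1_pd v1 b csupp_0[OF csupp_pd[OF v(2), of b]])
    then show ?thesis by (subst Bochner_Integration.integral_sum) (auto simp: sum_distrib_left)
  qed
  finally show ?thesis by simp
qed

end

section \<open>Powers of the norm as weights\<close>

definition zero_near_0 :: "('a::euclidean_space \<Rightarrow> 'v::real_normed_vector) \<Rightarrow> bool" where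
  "zero_near_0 u \<longleftrightarrow> (\<exists>r>0. \<forall>x\<in>ball 0 r. u x = 0)"

lemma zero_near_0_mono: "zero_near_0 u \<Longrightarrow> (\<And>x. u x = 0 \<Longrightarrow> g x = 0) \<Longrightarrow> zero_near_0 g"
  unfolding zero_near_0_def by metis

lemma zero_near_0_at: "zero_near_0 u \<Longrightarrow> u 0 = 0"
  unfolding zero_near_0_def by auto

lemma zero_near_0_pd:
  assumes "zero_near_0 u" shows "zero_near_0 (pd b u)"
proof -
  obtain r where r: "r > 0" "\<forall>x\<in>ball 0 r. u x = 0" using assms unfolding zero_near_0_def by blast
  have "pd b u x = 0" if "x \<in> ball 0 r" for x
    using pd_cong_open(1)[of "ball 0 r" x "\<lambda>_. 0" u b] r that by simp
  then show ?thesis unfolding zero_near_0_def using r(1) by blast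
qed

lemma continuous_zero_near_0:
  assumes "zero_near_0 u" "\<And>x. x \<noteq> 0 \<Longrightarrow> isCont u x"
  shows "continuous_on UNIV u"
proof -
  obtain r where r: "r > 0" "\<forall>x\<in>ball 0 r. u x = 0" using assms(1) unfolding zero_near_0_def by blast
  have "isCont u x" for x
  proof (cases "x = 0")
    case True
    then have "x \<in> ball 0 r" using r(1) by simp
    then have "\<forall>\<^sub>F y in nhds x. u y = 0"
      unfolding eventually_nhds using r(2) open_ball by blast
    from isCont_cong[OF this] show ?thesis by simp
  qed (rule assms(2))
  then show ?thesis by (simp add: continuous_on_eq_continuous_at)
qed

lemma differentiable_zero_near_0:
  assumes "zero_near_0 u" shows "u differentiable (at 0)" "pd b u 0 = 0"
proof -
  obtain r where r: "r > 0" "\<forall>x\<in>ball 0 r. u x = 0" using assms(1) unfolding zero_near_0_def by blast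
  show "u differentiable (at 0)" "pd b u 0 = 0"
    using pd_cong_open(1)[of "ball 0 r" 0 "\<lambda>_. 0" u b] pd_cong_open(2)[of "ball 0 r" 0 "\<lambda>_. 0" u] r by simp_all
qed

lemma continuous_norm_powr_scaleR:
  assumes "continuous_on UNIV u" "zero_near_0 u"
  shows "continuous_on UNIV (\<lambda>x. norm x powr s *\<^sub>R u x)"
proof (rule continuous_zero_near_0)
  show "zero_near_0 (\<lambda>x. norm x powr s *\<^sub>R u x)" by (rule zero_near_0_mono[OF assms(2)]) simp
  fix x :: 'a assume x: "x \<noteq> 0"
  have "isCont u x" using assms(1) by (simp add: continuous_on_eq_continuous_at)
  then show "isCont (\<lambda>x. norm x powr s *\<^sub>R u x) x"
    using x by (intro continuous_intros) auto
qed

lemma norm_powr_scaleR: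
  fixes u :: "'a::euclidean_space \<Rightarrow> 'v::real_normed_vector"
  assumes u: "C1 u" "zero_near_0 u"
  shows pd_norm_powr_scaleR:
      "pd b (\<lambda>x. norm x powr s *\<^sub>R u x) x = norm x powr (s - 2) *\<^sub>R ((s * (x \<bullet> b)) *\<^sub>R u x) + norm x powr s *\<^sub>R pd b u x" (is "?pd b x")
    and C1_norm_powr_scaleR: "C1 (\<lambda>x. norm x powr s *\<^sub>R u x)" (is "C1 ?v")
proof -
  have z: "zero_near_0 ?v" by (rule zero_near_0_mono[OF u(2)]) simp
  have *: "?v differentiable (at x) \<and> ?pd b x" for b x
  proof (cases "x = 0")
    case True
    then show ?thesis using differentiable_zero_near_0[OF z] by simp
  next
    case False
    have "(?v has_derivative (\<lambda>h. norm x powr s *\<^sub>R pd h u x + (s * norm x powr (s - 2) * (x \<bullet> h)) *\<^sub>R u x)) (at x)"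
      by (rule has_derivative_scaleR[OF has_derivative_norm_powr_nonzero[OF False] has_derivative_pd[OF C1D[OF u(1)]]])
    then show ?thesis using pd_eq by (auto simp: differentiable_def mult_ac add.commute)
  qed
  then show "?pd b x" by blast
  show "C1 ?v"
  proof (rule C1I)
    show "?v differentiable (at x)" for x using * by blast
    show "?pd b x" for b x using * by blast
    fix b :: 'a assume b: "b \<in> Basis"
    have "continuous_on UNIV (\<lambda>x. (s * (x \<bullet> b)) *\<^sub>R u x)"
      by (intro continuous_intros C1_continuous u)
    moreover have "zero_near_0 (\<lambda>x. (s * (x \<bullet> b)) *\<^sub>R u x)" by (rule zero_near_0_mono[OF u(2)]) simp
    ultimately show "continuous_on UNIV (\<lambda>x. norm x powr (s - 2) *\<^sub>R ((s * (x \<bullet> b)) *\<^sub>R u x) + norm x powr s *\<^sub>R pd b u x)"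
      by (intro continuous_on_add continuous_norm_powr_scaleR C1_pd[OF u(1) b] zero_near_0_pd[OF u(2)])
  qed
qed

text \<open>
  The derivative of \<open>|x|\<^sup>s u\<close> is a sum of two fields of the same form with class C1 factors.
\<close>

lemma C2_norm_powr_scaleR:
  fixes u :: "'a::euclidean_space \<Rightarrow> 'v::real_normed_vector"
  assumes u: "C2 u" "zero_near_0 u"
  shows "C2 (\<lambda>x. norm x powr s *\<^sub>R u x)"
proof -
  have u1: "C1 u" by (rule C2_C1[OF u(1)])
  have "C1 (pd b (\<lambda>x. norm x powr s *\<^sub>R u x))" if b: "b \<in> Basis" for b
  proof -
    have "C1 (\<lambda>x. s *\<^sub>R ((x \<bullet> b) *\<^sub>R u x))" by (intro C1_scaleR C1_const C1_coord u1)
    then have "C1 (\<lambda>x. (s * (x \<bullet> b)) *\<^sub>R u x)" by simp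
    moreover have "zero_near_0 (\<lambda>x. (s * (x \<bullet> b)) *\<^sub>R u x)" by (rule zero_near_0_mono[OF u(2)]) simp
    ultimately have "C1 (\<lambda>x. norm x powr (s - 2) *\<^sub>R ((s * (x \<bullet> b)) *\<^sub>R u x) + norm x powr s *\<^sub>R pd b u x)"
      by (intro C1_add C1_norm_powr_scaleR C2_pd[OF u(1) b] zero_near_0_pd[OF u(2)])
    moreover have "pd b (\<lambda>x. norm x powr s *\<^sub>R u x) =
        (\<lambda>x. norm x powr (s - 2) *\<^sub>R ((s * (x \<bullet> b)) *\<^sub>R u x) + norm x powr s *\<^sub>R pd b u x)"
      by (rule ext) (rule pd_norm_powr_scaleR[OF u1 u(2)])
    ultimately show ?thesis by simp
  qed
  then show ?thesis unfolding C2_def using C1D[OF C1_norm_powr_scaleR[OF u1 u(2)]] by blast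
qed

context clifford
begin

lemma Dirac_norm_powr_scaleR:
  assumes u: "C1 u" "zero_near_0 u"
  shows "Dirac (\<lambda>x. norm x powr s *\<^sub>R u x) x = norm x powr s *\<^sub>R Dirac u x + (s * norm x powr (s - 2)) *\<^sub>R c x (u x)"
proof -
  have "Dirac (\<lambda>x. norm x powr s *\<^sub>R u x) x
     = (\<Sum>b\<in>Basis. (s * norm x powr (s - 2)) *\<^sub>R ((x \<bullet> b) *\<^sub>R c b (u x)) + norm x powr s *\<^sub>R c b (pd b u x))"
    unfolding Dirac_def by (intro sum.cong refl) (simp add: pd_norm_powr_scaleR[OF u] cl.add_right cl.scaleR_right mult_ac)
  also have "\<dots> = (s * norm x powr (s - 2)) *\<^sub>R (\<Sum>b\<in>Basis. (x \<bullet> b) *\<^sub>R c b (u x)) + norm x powr s *\<^sub>R Dirac u x"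
    by (simp add: sum.distrib scaleR_sum_right Dirac_def)
  finally show ?thesis by (simp add: c_expand[of x "u x", symmetric])
qed

lemma finite_rank_scaleR: "finite_rank u \<Longrightarrow> finite_rank (\<lambda>x. r x *\<^sub>R u x)"
proof -
  assume "finite_rank u"
  then obtain B where B: "finite B" "\<And>x. u x = (\<Sum>e\<in>B. (u x \<bullet> e) *\<^sub>R e)" unfolding finite_rank_def by blast
  have "r x *\<^sub>R u x = (\<Sum>e\<in>B. ((r x *\<^sub>R u x) \<bullet> e) *\<^sub>R e)" for x
    by (subst B(2)) (simp add: scaleR_sum_right)
  then show ?thesis unfolding finite_rank_def using B(1) by blast
qed

text \<open>
  For \<open>v = |x|\<^sup>s u\<close> with \<open>s = - b/2 - 1\<close> the radial derivative of the weight cancels the term \<open>s v\<close>, and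
  \<open>c x (D v) - s v = |x|\<^sup>s c x (D u)\<close> has the squared norm \<open>|x|\<^bsup>-b\<^esup> |D u|\<^sup>2\<close>. So the Hardy
  inequality bounds \<open>\<integral> |v|\<^sup>2\<close>, and with it \<open>D w\<close> for \<open>w = |x| v\<close>, the field to which the Sobolev
  inequality is applied.
\<close>

lemma weighted_dirac_sobolev:
  assumes n: "DIM('a) > 2"
    and d: "d > 0" "\<And>l. l \<in> monogenic_degrees DIM('a) \<Longrightarrow> d \<le> \<bar>real_of_int l + (real DIM('a) - 2 - b) / 2\<bar>"
    and u: "C2 u" "csupp u" "zero_near_0 u" "finite_rank u"
  defines "q \<equiv> 2 * real DIM('a) / (real DIM('a) - 2)"
  shows "(\<integral>x. norm x powr (- (b * real DIM('a) / (real DIM('a) - 2))) * norm (u x) powr q \<partial>lborel) powr (2 / q)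
    \<le> (2 * (real DIM('a) - 1) / (real DIM('a) - 2))\<^sup>2 * (2 + b\<^sup>2 / (2 * d\<^sup>2)) * (\<integral>x. norm x powr (- b) * (norm (Dirac u x))\<^sup>2 \<partial>lborel)"
proof -
  define s where "s = - b / 2 - 1"
  define v w where "v x = norm x powr s *\<^sub>R u x" and "w x = norm x powr (s + 1) *\<^sub>R u x" for x
  define N where "N x = norm x powr (- b) * (norm (Dirac u x))\<^sup>2" for x
  have u1: "C1 u" by (rule C2_C1[OF u(1)])
  have v: "C2 v" "csupp v" "finite_rank v" and w: "C2 w" "csupp w"
    unfolding v_def[abs_def] w_def[abs_def]
    by (intro C2_norm_powr_scaleR finite_rank_scaleR u csupp_0[OF u(2)]; simp)+
  have v1: "C1 v" by (rule C2_C1[OF v(1)])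
  have w1: "C1 w" by (rule C2_C1[OF w(1)])
  have u0: "u 0 = 0" by (rule zero_near_0_at[OF u(3)])
  have N_eq: "(norm (c x (Dirac v x) - s *\<^sub>R v x))\<^sup>2 = N x" for x
  proof (cases "x = 0")
    case True
    then show ?thesis using u0 by (simp add: cl.zero_left v_def N_def)
  next
    case False
    have "x \<bullet> x = norm x powr 2"
      using False powr_realpow[of "norm x" 2] by (simp add: power2_norm_eq_inner)
    then have "norm x powr (s - 2) * (x \<bullet> x) = norm x powr s"
      by (simp only: powr_add[symmetric]) simp
    then have "c x (Dirac v x) - s *\<^sub>R v x = norm x powr s *\<^sub>R c x (Dirac u x)"
      unfolding v_def Dirac_norm_powr_scaleR[OF u1 u(3)] by (simp add: cl.add_right cl.scaleR_right c_square mult.assoc)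
    then have "(norm (c x (Dirac v x) - s *\<^sub>R v x))\<^sup>2 = (norm x powr s * norm x)\<^sup>2 * (norm (Dirac u x))\<^sup>2"
      by (simp add: norm_c power_mult_distrib)
    also have "(norm x powr s * norm x)\<^sup>2 = norm x powr (- b)"
    proof -
      have "norm x powr s * norm x = norm x powr (s + 1)" using False by (simp add: powr_add)
      then show ?thesis using False by (simp add: power2_eq_square powr_add[symmetric] s_def)
    qed
    finally show ?thesis by (simp add: N_def)
  qed
  have iN: "integrable lborel N"
  proof -
    have "continuous_on UNIV (\<lambda>x. (norm (c x (Dirac v x) - s *\<^sub>R v x))\<^sup>2)"
      by (intro continuous_on_power continuous_on_norm continuous_on_diff continuous_position_mult continuous_Dirac v1 continuous_on_scaleR continuous_on_const C1_continuous[OF v1])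
    moreover have "csupp N" by (rule csupp_0[OF csupp_Dirac[OF u(2)]]) (simp add: N_def)
    ultimately show ?thesis
      using integrable_csupp[of N] by (simp only: N_eq)
  qed
  have iv: "integrable lborel (\<lambda>x. (norm (v x))\<^sup>2)"
    by (intro integrable_csupp continuous_intros C1_continuous[OF v1] csupp_0[OF v(2)]) simp
  have H: "d\<^sup>2 * (\<integral>x. (norm (v x))\<^sup>2 \<partial>lborel) \<le> integral\<^sup>L lborel N"
    unfolding N_eq[symmetric, abs_def]
  proof (rule hardy_inequality[OF v d(1)])
    fix l assume l: "l \<in> monogenic_degrees DIM('a)"
    have eq: "real_of_int l + s + real DIM('a) / 2 = real_of_int l + (real DIM('a) - 2 - b) / 2"
      by (simp add: s_def field_simps)
    show "d \<le> \<bar>real_of_int l + s + real DIM('a) / 2\<bar>" unfolding eq by (rule d(2)[OF l])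
  qed
  have pointwise: "(norm (Dirac w x))\<^sup>2 \<le> 2 * N x + b\<^sup>2 / 2 * (norm (v x))\<^sup>2" for x
  proof (cases "x = 0")
    case True
    have "Dirac w x = 0" using True u0 unfolding w_def Dirac_norm_powr_scaleR[OF u1 u(3)] by (simp add: cl.zero_left)
    then show ?thesis by (simp add: N_def)
  next
    case False
    let ?A = "norm x powr (s + 1) *\<^sub>R Dirac u x" and ?B = "((s + 1) * norm x powr (s - 1)) *\<^sub>R c x (u x)"
    have D: "Dirac w x = ?A + ?B"
      unfolding w_def Dirac_norm_powr_scaleR[OF u1 u(3)] by simp
    have A: "(norm ?A)\<^sup>2 = N x"
      unfolding N_def s_def by (simp add: power_mult_distrib power2_eq_square[of "_ powr _"] powr_add[symmetric])
    have "norm x powr (s - 1) * norm x = norm x powr s" using False powr_add[of "norm x" "s - 1" 1] by simp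
    then have "norm ?B = \<bar>b / 2\<bar> * norm (v x)"
      unfolding v_def by (simp add: norm_c s_def abs_mult mult.assoc[symmetric])
    then have B: "(norm ?B)\<^sup>2 = b\<^sup>2 / 4 * (norm (v x))\<^sup>2" by (simp only: power_mult_distrib power2_abs power_divide) simp
    have "norm (Dirac w x) \<le> norm ?A + norm ?B" unfolding D by (rule norm_triangle_ineq)
    then have "(norm (Dirac w x))\<^sup>2 \<le> (norm ?A + norm ?B)\<^sup>2" by (intro power_mono) auto
    also have "\<dots> \<le> 2 * (norm ?A)\<^sup>2 + 2 * (norm ?B)\<^sup>2"
      using zero_le_power2[of "norm ?A - norm ?B"] by (simp add: power2_eq_square algebra_simps)
    finally show ?thesis unfolding A B by simp
  qed
  have "(\<integral>x. (norm (Dirac w x))\<^sup>2 \<partial>lborel) \<le> (\<integral>x. 2 * N x + b\<^sup>2 / 2 * (norm (v x))\<^sup>2 \<partial>lborel)"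
  proof (rule integral_mono)
    show "integrable lborel (\<lambda>x. (norm (Dirac w x))\<^sup>2)"
      by (intro integrable_csupp continuous_intros continuous_Dirac w1 csupp_0[OF csupp_Dirac[OF w(2)]]) simp
  qed (use iN iv pointwise in auto)
  also have "\<dots> = 2 * integral\<^sup>L lborel N + b\<^sup>2 / 2 * (\<integral>x. (norm (v x))\<^sup>2 \<partial>lborel)" using iN iv by simp
  also have "\<dots> \<le> 2 * integral\<^sup>L lborel N + b\<^sup>2 / 2 * (integral\<^sup>L lborel N / d\<^sup>2)"
    using H d(1) by (intro add_left_mono mult_left_mono) (auto simp: field_simps)
  also have "\<dots> = (2 + b\<^sup>2 / (2 * d\<^sup>2)) * integral\<^sup>L lborel N" by (simp add: algebra_simps)
  finally have G: "(\<integral>x. (norm (Dirac w x))\<^sup>2 \<partial>lborel) \<le> (2 + b\<^sup>2 / (2 * d\<^sup>2)) * integral\<^sup>L lborel N" .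
  have W: "norm x powr (- (b * real DIM('a) / (real DIM('a) - 2))) * norm (u x) powr q = norm (w x) powr q" for x
  proof -
    have "(norm x powr (s + 1)) powr q = norm x powr (- (b * real DIM('a) / (real DIM('a) - 2)))"
      unfolding powr_powr s_def q_def by simp
    then show ?thesis by (simp add: w_def powr_mult)
  qed
  have "(\<integral>x. norm (w x) powr q \<partial>lborel) powr (2 / q)
     \<le> (2 * (real DIM('a) - 1) / (real DIM('a) - 2))\<^sup>2 * (\<integral>x. (norm (Dirac w x))\<^sup>2 \<partial>lborel)"
    unfolding q_def integral_Dirac[OF w] by (rule sobolev_inequality[OF w1 w(2) n])
  also have "\<dots> \<le> (2 * (real DIM('a) - 1) / (real DIM('a) - 2))\<^sup>2 * ((2 + b\<^sup>2 / (2 * d\<^sup>2)) * integral\<^sup>L lborel N)"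
    by (rule mult_left_mono[OF G]) simp
  finally show ?thesis by (simp only: W N_def[symmetric] mult.assoc)
qed

end

section \<open>A common space for spinors of all sizes\<close>

text \<open>
  The size \<open>m\<close> of the matrices is a number and not a type. Finitely supported complex sequences
  contain \<open>\<complex>\<^sup>m\<close> for every \<open>m\<close>.
\<close>

typedef spinor = "{f :: nat \<Rightarrow> complex. \<exists>N. \<forall>k\<ge>N. f k = 0}"
  morphisms entry Spinor
  by (rule exI[of _ "\<lambda>_. 0"]) auto

lemma entry_Spinor: "(\<And>k. k \<ge> N \<Longrightarrow> f k = 0) \<Longrightarrow> entry (Spinor f) = f"
  by (rule Spinor_inverse) blast

lemma entry_bound:
  obtains N where "\<And>k. k \<ge> N \<Longrightarrow> entry v k = 0"
  using entry[of v] by blast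

lemma spinor_eqI: "(\<And>k. entry v k = entry w k) \<Longrightarrow> v = w"
  using entry_inject by blast

instantiation spinor :: real_vector
begin

definition "0 = Spinor (\<lambda>k. 0)"
definition "v + w = Spinor (\<lambda>k. entry v k + entry w k)"
definition "v - w = Spinor (\<lambda>k. entry v k - entry w k)"
definition "- v = Spinor (\<lambda>k. - entry v k)"
definition "r *\<^sub>R v = Spinor (\<lambda>k. r *\<^sub>R entry v k)"

lemma entry_zero: "entry 0 k = 0"
  unfolding zero_spinor_def by (subst entry_Spinor[of 0]) auto

lemma entry_add: "entry (v + w) k = entry v k + entry w k"
proof -
  obtain N where N: "\<And>k. k \<ge> N \<Longrightarrow> entry v k = 0" using entry_bound[of "v"] by blast
  obtain M where M: "\<And>k. k \<ge> M \<Longrightarrow> entry w k = 0" using entry_bound[of "w"] by blast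
  show ?thesis unfolding plus_spinor_def by (subst entry_Spinor[of "max N M"]) (auto simp: N M)
qed

lemma entry_minus: "entry (- v) k = - entry v k"
proof -
  obtain N where N: "\<And>k. k \<ge> N \<Longrightarrow> entry v k = 0" using entry_bound[of "v"] by blast
  show ?thesis unfolding uminus_spinor_def by (subst entry_Spinor[of N]) (auto simp: N)
qed

lemma entry_diff: "entry (v - w) k = entry v k - entry w k"
proof -
  obtain N where N: "\<And>k. k \<ge> N \<Longrightarrow> entry v k = 0" using entry_bound[of "v"] by blast
  obtain M where M: "\<And>k. k \<ge> M \<Longrightarrow> entry w k = 0" using entry_bound[of "w"] by blast
  show ?thesis unfolding minus_spinor_def by (subst entry_Spinor[of "max N M"]) (auto simp: N M)
qed

lemma entry_scaleR: "entry (r *\<^sub>R v) k = r *\<^sub>R entry v k"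
proof -
  obtain N where N: "\<And>k. k \<ge> N \<Longrightarrow> entry v k = 0" using entry_bound[of "v"] by blast
  show ?thesis unfolding scaleR_spinor_def by (subst entry_Spinor[of N]) (auto simp: N)
qed

instance
proof
  fix u v w :: spinor and r s :: real
  show "u + v + w = u + (v + w)" "u + v = v + u" "0 + u = u" "- u + u = 0" "u - v = u + - v"
    by (rule spinor_eqI, simp add: entry_zero entry_add entry_minus entry_diff)+
  show "r *\<^sub>R (u + v) = r *\<^sub>R u + r *\<^sub>R v" "(r + s) *\<^sub>R u = r *\<^sub>R u + s *\<^sub>R u" "r *\<^sub>R s *\<^sub>R u = (r * s) *\<^sub>R u" "1 *\<^sub>R u = u"
    by (rule spinor_eqI, simp add: entry_add entry_scaleR algebra_simps)+
qed

end

instantiation spinor :: real_inner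
begin

definition "v \<bullet> w = (\<Sum>k | entry v k \<noteq> 0. entry v k \<bullet> entry w k)"
definition "norm (v :: spinor) = sqrt (inner v v)"
definition "sgn (v :: spinor) = v /\<^sub>R norm v"
definition "dist (v :: spinor) w = norm (v - w)"
definition "(uniformity :: (spinor \<times> spinor) filter) = (INF e\<in>{0<..}. principal {(x, y). dist x y < e})"
definition "open (U :: spinor set) = (\<forall>x\<in>U. eventually (\<lambda>(x', y). x' = x \<longrightarrow> y \<in> U) uniformity)"

lemma inner_spinor:
  assumes "\<And>k. k \<ge> N \<Longrightarrow> entry v k = 0"
  shows "v \<bullet> w = (\<Sum>k<N. entry v k \<bullet> entry w k)"
  unfolding inner_spinor_def
  by (rule sum.mono_neutral_left) (use assms in \<open>auto simp: not_less[symmetric]\<close>)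

instance
proof
  fix u v w :: spinor and r s :: real
  show "dist u v = norm (u - v)" by (rule dist_spinor_def)
  show "sgn u = u /\<^sub>R norm u" by (rule sgn_spinor_def)
  show "(uniformity :: (spinor \<times> spinor) filter) = (INF e\<in>{0<..}. principal {(x, y). dist x y < e})"
    by (rule uniformity_spinor_def)
  show "open U = (\<forall>x\<in>U. eventually (\<lambda>(x', y). x' = x \<longrightarrow> y \<in> U) uniformity)" for U :: "spinor set"
    by (rule open_spinor_def)
  obtain N where N: "\<And>k. k \<ge> N \<Longrightarrow> entry u k = 0" using entry_bound[of "u"] by blast
  obtain M where M: "\<And>k. k \<ge> M \<Longrightarrow> entry v k = 0" using entry_bound[of "v"] by blast
  have B: "entry u k = 0" "entry v k = 0" if "k \<ge> max N M" for k using N M that by auto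
  have u: "u \<bullet> x = (\<Sum>k<max N M. entry u k \<bullet> entry x k)" for x by (rule inner_spinor) (rule B(1))
  have v: "v \<bullet> x = (\<Sum>k<max N M. entry v k \<bullet> entry x k)" for x by (rule inner_spinor) (rule B(2))
  show "u \<bullet> v = v \<bullet> u" unfolding u v by (simp add: inner_commute)
  have "(u + v) \<bullet> w = (\<Sum>k<max N M. entry (u + v) k \<bullet> entry w k)"
    by (rule inner_spinor) (simp add: entry_add B)
  then show "(u + v) \<bullet> w = u \<bullet> w + v \<bullet> w"
    unfolding u v by (simp add: entry_add inner_add_left sum.distrib)
  have "(r *\<^sub>R u) \<bullet> v = (\<Sum>k<max N M. entry (r *\<^sub>R u) k \<bullet> entry v k)"
    by (rule inner_spinor) (simp add: entry_scaleR B)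
  then show "(r *\<^sub>R u) \<bullet> v = r * (u \<bullet> v)"
    unfolding u by (simp add: entry_scaleR sum_distrib_left)
  show "0 \<le> u \<bullet> u" unfolding u by (intro sum_nonneg) simp
  show "(u \<bullet> u = 0) = (u = 0)"
  proof
    assume "u \<bullet> u = 0"
    then have "(\<Sum>k<max N M. entry u k \<bullet> entry u k) = 0" unfolding u .
    then have "\<forall>k\<in>{..<max N M}. entry u k \<bullet> entry u k = 0" by (subst (asm) sum_nonneg_eq_0_iff) auto
    then have "entry u k = 0" for k using B(1)[of k] by (cases "max N M \<le> k") (auto simp only: not_le lessThan_iff inner_eq_zero_iff)
    then show "u = 0" by (intro spinor_eqI) (simp add: entry_zero)
  qed (simp add: inner_spinor_def entry_zero)
  show "norm u = sqrt (u \<bullet> u)" by (rule norm_spinor_def)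
qed

end

lemma entry_sum: "entry (\<Sum>i\<in>I. f i) k = (\<Sum>i\<in>I. entry (f i) k)"
  by (induction I rule: infinite_finite_induct) (auto simp: entry_zero entry_add)

text \<open>
  The sequence is cut into blocks of length \<open>m\<close>, and the matrix acts on each block. Acting on the
  first block only would violate the Clifford relations on the remaining entries.
\<close>

definition block_act :: "nat \<Rightarrow> complex mat \<Rightarrow> spinor \<Rightarrow> spinor" where
  "block_act m A v = Spinor (\<lambda>k. \<Sum>l<m. A $$ (k mod m, l) * entry v (k div m * m + l))"

lemma entry_block_act:
  assumes m: "m > 0"
  shows "entry (block_act m A v) k = (\<Sum>l<m. A $$ (k mod m, l) * entry v (k div m * m + l))"
proof -
  obtain N where N: "\<And>k. k \<ge> N \<Longrightarrow> entry v k = 0" using entry_bound[of "v"] by blast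
  have "(\<Sum>l<m. A $$ (k mod m, l) * entry v (k div m * m + l)) = 0" if k: "k \<ge> N + m" for k
  proof (intro sum.neutral ballI)
    fix l
    have "k div m * m + k mod m = k" by simp
    moreover have "k mod m < m" using m by simp
    ultimately have "k div m * m + l \<ge> N" using k by linarith
    then show "A $$ (k mod m, l) * entry v (k div m * m + l) = 0" using N by simp
  qed
  then show ?thesis unfolding block_act_def by (subst entry_Spinor[of "N + m"]) auto
qed

lemma block_act_linear:
  assumes m: "m > 0"
  shows "block_act m A (v + w) = block_act m A v + block_act m A w"
    "block_act m A (r *\<^sub>R v) = r *\<^sub>R block_act m A v"
  by (rule spinor_eqI, simp add: entry_block_act[OF m] entry_add entry_scaleR distrib_left sum.distrib scaleR_sum_right)+

text \<open>
  On each block this is the hermitian symmetry of \<open>A\<close>, read for the real part of the complex inner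
  product.
\<close>

lemma block_act_symmetric:
  assumes m: "m > 0" and A: "A \<in> carrier_mat m m" "mat_adjoint A = A"
  shows "block_act m A v \<bullet> w = v \<bullet> block_act m A w"
proof -
  obtain N where N: "\<And>k. k \<ge> N \<Longrightarrow> entry v k = 0" using entry_bound[of "v"] by blast
  obtain N' where N': "\<And>k. k \<ge> N' \<Longrightarrow> entry (block_act m A v) k = 0" using entry_bound[of "block_act m A v"] by blast
  define Q where "Q = max N N'"
  have Q: "Q \<le> Q * m" using m by simp
  have herm: "A $$ (r, l) = cnj (A $$ (l, r))" if "r < m" "l < m" for r l
  proof -
    have "mat_adjoint A $$ (r, l) = cnj (A $$ (l, r))"
      using A(1) that by (simp add: mat_adjoint_def mat_of_rows_def)
    then show ?thesis using A(2) by simp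
  qed
  have grp: "(\<Sum>k<Q * m. F k) = (\<Sum>q<Q. \<Sum>r<m. F (q * m + r))" for F :: "nat \<Rightarrow> real"
  proof -
    have "(\<Sum>k<Q * m. F k) = (\<Sum>q<Q. sum F {q * m..<q * m + m})" by (rule sum.nat_group[symmetric])
    also have "\<dots> = (\<Sum>q<Q. \<Sum>r<m. F (q * m + r))"
    proof (rule sum.cong[OF refl])
      fix q assume "q \<in> {..<Q}"
      show "sum F {q * m..<q * m + m} = (\<Sum>r<m. F (q * m + r))"
        by (rule sum.reindex_bij_witness[of _ "\<lambda>r. q * m + r" "\<lambda>k. k - q * m"]) auto
    qed
    finally show ?thesis .
  qed
  have "block_act m A v \<bullet> w = (\<Sum>k<Q * m. entry (block_act m A v) k \<bullet> entry w k)"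
    by (rule inner_spinor) (use N' Q in \<open>auto simp: Q_def\<close>)
  also have "\<dots> = (\<Sum>q<Q. \<Sum>r<m. \<Sum>l<m. (A $$ (r, l) * entry v (q * m + l)) \<bullet> entry w (q * m + r))"
    unfolding grp using m by (intro sum.cong refl) (simp add: entry_block_act inner_sum_left)
  also have "\<dots> = (\<Sum>q<Q. \<Sum>l<m. \<Sum>r<m. (A $$ (r, l) * entry v (q * m + l)) \<bullet> entry w (q * m + r))"
    by (intro sum.cong refl sum.swap)
  also have "\<dots> = (\<Sum>q<Q. \<Sum>l<m. \<Sum>r<m. entry v (q * m + l) \<bullet> (A $$ (l, r) * entry w (q * m + r)))"
  proof (intro sum.cong refl)
    fix q l r assume "l \<in> {..<m}" "r \<in> {..<m}"
    then have "A $$ (r, l) = cnj (A $$ (l, r))" by (intro herm) auto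
    then show "(A $$ (r, l) * entry v (q * m + l)) \<bullet> entry w (q * m + r) = entry v (q * m + l) \<bullet> (A $$ (l, r) * entry w (q * m + r))"
      by (simp add: inner_complex_def algebra_simps)
  qed
  also have "\<dots> = (\<Sum>k<Q * m. entry v k \<bullet> entry (block_act m A w) k)"
    unfolding grp using m by (intro sum.cong refl) (simp add: entry_block_act inner_sum_right)
  also have "\<dots> = v \<bullet> block_act m A w"
    by (rule inner_spinor[symmetric]) (use N Q in \<open>auto simp: Q_def\<close>)
  finally show ?thesis .
qed

lemma block_act_mult:
  assumes m: "m > 0" and A: "A \<in> carrier_mat m m" "B \<in> carrier_mat m m"
  shows "entry (block_act m A (block_act m B v)) k = (\<Sum>p<m. (A * B) $$ (k mod m, p) * entry v (k div m * m + p))"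
proof -
  have r: "k mod m < m" using m by simp
  have "entry (block_act m A (block_act m B v)) k
    = (\<Sum>l<m. \<Sum>p<m. A $$ (k mod m, l) * (B $$ (l, p) * entry v (k div m * m + p)))"
    using m by (simp add: entry_block_act sum_distrib_left)
  also have "\<dots> = (\<Sum>p<m. \<Sum>l<m. A $$ (k mod m, l) * (B $$ (l, p) * entry v (k div m * m + p)))"
    by (rule sum.swap)
  also have "\<dots> = (\<Sum>p<m. (A * B) $$ (k mod m, p) * entry v (k div m * m + p))"
  proof (intro sum.cong refl)
    fix p assume "p \<in> {..<m}"
    then have "(A * B) $$ (k mod m, p) = (\<Sum>l<m. A $$ (k mod m, l) * B $$ (l, p))"
      using A r by (simp add: scalar_prod_def lessThan_atLeast0)
    then show "(\<Sum>l<m. A $$ (k mod m, l) * (B $$ (l, p) * entry v (k div m * m + p))) = (A * B) $$ (k mod m, p) * entry v (k div m * m + p)"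
      by (simp add: sum_distrib_right mult.assoc)
  qed
  finally show ?thesis .
qed

definition clifford_act :: "nat \<Rightarrow> ('n \<Rightarrow> complex mat) \<Rightarrow> real ^ 'n::finite \<Rightarrow> spinor \<Rightarrow> spinor" where
  "clifford_act m \<sigma> x v = (\<Sum>i\<in>UNIV. vec_nth x i *\<^sub>R block_act m (\<sigma> i) v)"

lemma block_act_anticommute:
  assumes m: "m > 0" and \<sigma>: "clifford_matrices m \<sigma>"
  shows "block_act m (\<sigma> i) (block_act m (\<sigma> j) v) + block_act m (\<sigma> j) (block_act m (\<sigma> i) v) = (if i = j then 2 else 0) *\<^sub>R v"
proof (rule spinor_eqI)
  fix k
  have C: "\<sigma> i \<in> carrier_mat m m" "\<sigma> j \<in> carrier_mat m m"
    and R: "\<sigma> i * \<sigma> j + \<sigma> j * \<sigma> i = (if i = j then 2 else 0) \<cdot>\<^sub>m 1\<^sub>m m"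
    using \<sigma> unfolding clifford_matrices_def by auto
  have r: "k mod m < m" using m by simp
  have "entry (block_act m (\<sigma> i) (block_act m (\<sigma> j) v) + block_act m (\<sigma> j) (block_act m (\<sigma> i) v)) k
    = (\<Sum>p<m. ((\<sigma> i * \<sigma> j) $$ (k mod m, p) + (\<sigma> j * \<sigma> i) $$ (k mod m, p)) * entry v (k div m * m + p))"
    by (simp add: entry_add block_act_mult[OF m C] block_act_mult[OF m C(2,1)] distrib_right sum.distrib)
  also have "\<dots> = (\<Sum>p<m. if p = k mod m then (if i = j then 2 else 0) * entry v (k div m * m + p) else 0)"
  proof (intro sum.cong refl)
    fix p assume p: "p \<in> {..<m}"
    have "(\<sigma> i * \<sigma> j) $$ (k mod m, p) + (\<sigma> j * \<sigma> i) $$ (k mod m, p) = (\<sigma> i * \<sigma> j + \<sigma> j * \<sigma> i) $$ (k mod m, p)"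
      using C r p by simp
    also have "\<dots> = (if i = j then 2 else 0) * (if k mod m = p then 1 else 0)"
      unfolding R using r p by simp
    finally show "((\<sigma> i * \<sigma> j) $$ (k mod m, p) + (\<sigma> j * \<sigma> i) $$ (k mod m, p)) * entry v (k div m * m + p)
      = (if p = k mod m then (if i = j then 2 else 0) * entry v (k div m * m + p) else 0)" by simp
  qed
  also have "\<dots> = (if i = j then 2 else 0) * entry v k"
    using r by (simp add: sum.delta)
  finally show "entry (block_act m (\<sigma> i) (block_act m (\<sigma> j) v) + block_act m (\<sigma> j) (block_act m (\<sigma> i) v)) k
     = entry ((if i = j then 2 else 0) *\<^sub>R v) k"
    by (simp add: entry_scaleR scaleR_conv_of_real)
qed

lemma clifford_clifford_act:
  assumes m: "m > 0" and \<sigma>: "clifford_matrices m \<sigma>"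
  shows "clifford (clifford_act m \<sigma>)"
proof
  note lin = block_act_linear[OF m]
  have sum: "block_act m A (\<Sum>i\<in>I. r i *\<^sub>R f i) = (\<Sum>i\<in>I. r i *\<^sub>R block_act m A (f i))" for A I r f
  proof (rule spinor_eqI)
    fix k
    show "entry (block_act m A (\<Sum>i\<in>I. r i *\<^sub>R f i)) k = entry (\<Sum>i\<in>I. r i *\<^sub>R block_act m A (f i)) k"
      by (simp add: entry_block_act[OF m] entry_sum entry_scaleR sum_distrib_left scaleR_sum_right, rule sum.swap)
  qed
  fix x y :: "real ^ 'a" and v w :: spinor and r :: real
  show "clifford_act m \<sigma> (x + y) v = clifford_act m \<sigma> x v + clifford_act m \<sigma> y v"
    "clifford_act m \<sigma> (r *\<^sub>R x) v = r *\<^sub>R clifford_act m \<sigma> x v"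
    "clifford_act m \<sigma> x (v + w) = clifford_act m \<sigma> x v + clifford_act m \<sigma> x w"
    "clifford_act m \<sigma> x (r *\<^sub>R v) = r *\<^sub>R clifford_act m \<sigma> x v"
    by (simp_all add: clifford_act_def lin scaleR_add_left scaleR_add_right sum.distrib scaleR_sum_right mult.commute)
  have herm: "\<sigma> i \<in> carrier_mat m m" "mat_adjoint (\<sigma> i) = \<sigma> i" for i
    using \<sigma> unfolding clifford_matrices_def by auto
  show "clifford_act m \<sigma> x v \<bullet> w = v \<bullet> clifford_act m \<sigma> x w"
    by (simp add: clifford_act_def inner_sum_left inner_sum_right block_act_symmetric[OF m herm])
  have "clifford_act m \<sigma> x (clifford_act m \<sigma> y v) + clifford_act m \<sigma> y (clifford_act m \<sigma> x v)
    = (\<Sum>i\<in>UNIV. \<Sum>j\<in>UNIV. (vec_nth x i * vec_nth y j) *\<^sub>R block_act m (\<sigma> i) (block_act m (\<sigma> j) v))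
    + (\<Sum>j\<in>UNIV. \<Sum>i\<in>UNIV. (vec_nth y j * vec_nth x i) *\<^sub>R block_act m (\<sigma> j) (block_act m (\<sigma> i) v))"
    by (simp add: clifford_act_def sum scaleR_sum_right)
  also have "(\<Sum>j\<in>UNIV. \<Sum>i\<in>UNIV. (vec_nth y j * vec_nth x i) *\<^sub>R block_act m (\<sigma> j) (block_act m (\<sigma> i) v))
    = (\<Sum>i\<in>UNIV. \<Sum>j\<in>UNIV. (vec_nth x i * vec_nth y j) *\<^sub>R block_act m (\<sigma> j) (block_act m (\<sigma> i) v))"
    by (subst sum.swap) (simp add: mult.commute)
  also have "(\<Sum>i\<in>UNIV. \<Sum>j\<in>UNIV. (vec_nth x i * vec_nth y j) *\<^sub>R block_act m (\<sigma> i) (block_act m (\<sigma> j) v))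
    + (\<Sum>i\<in>UNIV. \<Sum>j\<in>UNIV. (vec_nth x i * vec_nth y j) *\<^sub>R block_act m (\<sigma> j) (block_act m (\<sigma> i) v))
    = (\<Sum>i\<in>UNIV. \<Sum>j\<in>UNIV. if j = i then (2 * (vec_nth x i * vec_nth y i)) *\<^sub>R v else 0)"
    unfolding sum.distrib[symmetric] scaleR_add_right[symmetric] block_act_anticommute[OF m \<sigma>]
    by (intro sum.cong refl) auto
  also have "\<dots> = (2 * (x \<bullet> y)) *\<^sub>R v"
    by (simp add: sum.delta inner_vec_def scaleR_sum_left sum_distrib_left)
  finally show "clifford_act m \<sigma> x (clifford_act m \<sigma> y v) + clifford_act m \<sigma> y (clifford_act m \<sigma> x v) = (2 * (x \<bullet> y)) *\<^sub>R v" .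
qed


section \<open>From matrices to spinor fields\<close>

definition spinor_of_vec :: "nat \<Rightarrow> complex vec \<Rightarrow> spinor" where
  "spinor_of_vec m v = Spinor (\<lambda>k. if k < m then vec_index v k else 0)"

lemma entry_spinor_of_vec: "entry (spinor_of_vec m v) k = (if k < m then vec_index v k else 0)"
  unfolding spinor_of_vec_def by (subst entry_Spinor[of m]) auto

lemma norm_spinor_of_vec:
  assumes "v \<in> carrier_vec m" shows "norm (spinor_of_vec m v) = vec_norm2 v"
proof -
  have "spinor_of_vec m v \<bullet> spinor_of_vec m v = (\<Sum>k<m. (cmod (vec_index v k))\<^sup>2)"
    by (subst inner_spinor[of m]) (auto simp: entry_spinor_of_vec power2_norm_eq_inner)
  then show ?thesis using assms by (simp add: norm_spinor_def vec_norm2_def L2_set_def)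
qed

definition single :: "nat \<Rightarrow> complex \<Rightarrow> spinor" where
  "single k z = Spinor (\<lambda>j. if j = k then z else 0)"

lemma entry_single: "entry (single k z) j = (if j = k then z else 0)"
  unfolding single_def by (subst entry_Spinor[of "Suc k"]) auto

lemma inner_single: "v \<bullet> single k z = entry v k \<bullet> z"
proof -
  have "single k z \<bullet> v = (\<Sum>j<Suc k. entry (single k z) j \<bullet> entry v j)"
    by (rule inner_spinor) (simp add: entry_single)
  also have "\<dots> = (\<Sum>j<Suc k. if j = k then z \<bullet> entry v k else 0)"
    by (intro sum.cong refl) (simp add: entry_single)
  finally show ?thesis by (simp add: inner_commute sum.delta)
qed

lemma bounded_linear_single: "bounded_linear (single k)"
proof (rule bounded_linear_intro[of _ 1])
  show "norm (single k z) \<le> norm z * 1" for z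
    by (simp add: norm_eq_sqrt_inner inner_single entry_single)
qed (rule spinor_eqI, simp add: entry_single entry_add entry_scaleR)+

lemma spinor_of_vec_sum: "spinor_of_vec m v = (\<Sum>k<m. single k (vec_index v k))"
  by (rule spinor_eqI) (simp add: entry_spinor_of_vec entry_sum entry_single sum.delta)

lemma partial_deriv_pd: "partial_deriv i f = pd (axis i 1) f"
  by (rule ext) (simp add: partial_deriv_def pd_def)

lemma Basis_axis: "Basis = range (\<lambda>i. axis i (1::real))"
  by (auto simp: Basis_vec_def)

lemma sum_Basis_axis: "(\<Sum>b\<in>Basis. F b) = (\<Sum>i\<in>UNIV. F (axis i (1::real)))"
  unfolding Basis_axis by (rule sum.reindex_cong[of "\<lambda>i. axis i 1"]) (auto simp: inj_on_def axis_eq_axis)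

text \<open>
  Smoothness off the origin extends over the origin for functions vanishing nearby.
\<close>

lemma C1_of_Ck_on:
  assumes "Ck_on (Suc 0) (- {0}) f" "zero_near_0 f" shows "C1 f"
  unfolding C1_def
proof (intro conjI allI ballI)
  show "f differentiable (at x)" for x
    using assms(1) differentiable_zero_near_0(1)[OF assms(2)] by (cases "x = 0") auto
  fix b :: "real ^ 'a" assume "b \<in> Basis"
  then obtain i where b: "b = axis i 1" unfolding Basis_axis by auto
  have "continuous_on (- {0}) (pd b f)" using assms(1) by (simp add: partial_deriv_pd b)
  then show "continuous_on UNIV (pd b f)"
    by (intro continuous_zero_near_0 zero_near_0_pd[OF assms(2)])
      (simp add: continuous_on_eq_continuous_at open_Compl)
qed

lemma C2_of_Ck_on:
  assumes "Ck_on (Suc (Suc 0)) (- {0}) f" "zero_near_0 f" shows "C2 f"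
  unfolding C2_def
proof (intro conjI allI ballI)
  show "f differentiable (at x)" for x
    using assms(1) differentiable_zero_near_0(1)[OF assms(2)] by (cases "x = 0") auto
  fix b :: "real ^ 'a" assume "b \<in> Basis"
  then obtain i where b: "b = axis i 1" unfolding Basis_axis by auto
  have "Ck_on (Suc 0) (- {0}) (pd b f)" using assms(1) unfolding b partial_deriv_pd[symmetric] by simp
  then show "C1 (pd b f)" by (rule C1_of_Ck_on) (rule zero_near_0_pd[OF assms(2)])
qed

lemma test_functionsD:
  assumes u: "u \<in> test_functions (- {0 :: real ^ 'n::finite}) m"
  defines "U \<equiv> \<lambda>x. spinor_of_vec m (u x)"
  shows "C2 U" "csupp U" "zero_near_0 U"
    and "\<And>k. k < m \<Longrightarrow> C2 (\<lambda>x. vec_index (u x) k)" "\<And>x. u x \<in> carrier_vec m"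
proof -
  let ?S = "closure {x. u x \<noteq> 0\<^sub>v m}"
  have S: "compact ?S" "0 \<notin> ?S" and uc: "\<And>x. u x \<in> carrier_vec m"
    and Ck: "\<And>j k. j < m \<Longrightarrow> Ck_on k (- {0}) (\<lambda>x. vec_index (u x) j)"
    using u unfolding test_functions_def by auto
  show "u x \<in> carrier_vec m" for x by (rule uc)
  have out: "u x = 0\<^sub>v m" if "x \<notin> ?S" for x
    using that closure_subset[of "{x. u x \<noteq> 0\<^sub>v m}"] by blast
  have "open (- ?S)" "0 \<in> - ?S" using S(2) by auto
  then obtain r where r: "r > 0" "ball 0 r \<subseteq> - ?S" using open_contains_ball by blast
  obtain R where R: "\<And>x. x \<in> ?S \<Longrightarrow> norm x \<le> R"
    using compact_imp_bounded[OF S(1)] unfolding bounded_iff by blast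
  have U0: "U x = 0" if "u x = 0\<^sub>v m" for x
    unfolding U_def that by (rule spinor_eqI) (simp add: entry_spinor_of_vec entry_zero)
  have "U x = 0" if "R < norm x" for x
    using R[of x] that by (intro U0 out) auto
  then show "csupp U" by (rule csuppI)
  have near: "u x = 0\<^sub>v m" if "x \<in> ball 0 r" for x using out r(2) that by blast
  show "zero_near_0 U" unfolding zero_near_0_def using r(1) near U0 by blast
  show C2k: "C2 (\<lambda>x. vec_index (u x) k)" if k: "k < m" for k
  proof (rule C2_of_Ck_on[OF Ck[OF k]])
    have "vec_index (u x) k = 0" if "x \<in> ball 0 r" for x using near[OF that] k by simp
    then show "zero_near_0 (\<lambda>x. vec_index (u x) k)" unfolding zero_near_0_def using r(1) by blast
  qed
  show "C2 U" unfolding U_def spinor_of_vec_sum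
    by (intro C2_sum C2_linear[OF bounded_linear_single] C2k) simp
qed

text \<open>
  The values lie in the span of the first \<open>m\<close> unit vectors and their multiples by \<open>\<i>\<close>.
\<close>

lemma finite_rank_spinor_of_vec:
  assumes "clifford (c :: 'a::euclidean_space \<Rightarrow> spinor \<Rightarrow> spinor)"
  shows "clifford.finite_rank (\<lambda>x::'a. spinor_of_vec m (u x))"
proof -
  interpret clifford c by (rule assms)
  define B where "B = (\<lambda>(k, z). single k z) ` ({..<m} \<times> (Basis :: complex set))"
  have inj: "inj_on (\<lambda>(k, z). single k z) ({..<m} \<times> (Basis :: complex set))"
  proof (rule inj_onI, clarify)
    fix k k' :: nat and z z' :: complex
    assume z: "z \<in> Basis" and eq: "single k z = single k' z'"
    have "entry (single k z) k = entry (single k' z') k" using eq by simp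
    then have "z = (if k = k' then z' else 0)" by (simp add: entry_single)
    then show "k = k' \<and> z = z'" using z nonzero_Basis by (auto split: if_splits)
  qed
  have "spinor_of_vec m (u x) = (\<Sum>e\<in>B. (spinor_of_vec m (u x) \<bullet> e) *\<^sub>R e)" for x
  proof -
    have "(\<Sum>e\<in>B. (spinor_of_vec m (u x) \<bullet> e) *\<^sub>R e)
      = (\<Sum>(k, z)\<in>{..<m} \<times> Basis. (spinor_of_vec m (u x) \<bullet> single k z) *\<^sub>R single k z)"
      unfolding B_def sum.reindex[OF inj] by (simp add: case_prod_beta' comp_def)
    also have "\<dots> = (\<Sum>k<m. \<Sum>z\<in>Basis. (spinor_of_vec m (u x) \<bullet> single k z) *\<^sub>R single k z)"
      by (rule sum.cartesian_product[symmetric])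
    also have "\<dots> = (\<Sum>k<m. single k (\<Sum>z\<in>Basis. (vec_index (u x) k \<bullet> z) *\<^sub>R z))"
      by (intro sum.cong refl)
        (simp add: inner_single entry_spinor_of_vec linear_sum[OF bounded_linear.linear[OF bounded_linear_single]]
           linear_scale[OF bounded_linear.linear[OF bounded_linear_single]])
    also have "\<dots> = spinor_of_vec m (u x)"
      by (simp add: euclidean_representation spinor_of_vec_sum)
    finally show ?thesis by simp
  qed
  moreover have "finite B" by (simp add: B_def)
  ultimately show ?thesis unfolding finite_rank_def by blast
qed

lemma Dirac_spinor_of_vec:
  assumes m: "m > 0" and \<sigma>: "clifford_matrices m \<sigma>"
    and u: "\<And>k. k < m \<Longrightarrow> (\<lambda>x. vec_index (u x) k) differentiable (at x)"
  shows "clifford.Dirac (clifford_act m \<sigma>) (\<lambda>x. spinor_of_vec m (u x)) x = spinor_of_vec m (dirac_op m \<sigma> u x)"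
proof -
  interpret clifford "clifford_act m \<sigma>" by (rule clifford_clifford_act[OF m \<sigma>])
  have C: "\<sigma> i \<in> carrier_mat m m" for i using \<sigma> unfolding clifford_matrices_def by auto
  have pdU: "pd b (\<lambda>x. spinor_of_vec m (u x)) x = spinor_of_vec m (vec m (\<lambda>k. pd b (\<lambda>y. vec_index (u y) k) x))" for b
  proof -
    have "pd b (\<lambda>x. spinor_of_vec m (u x)) x = (\<Sum>k<m. single k (pd b (\<lambda>x. vec_index (u x) k) x))"
      unfolding spinor_of_vec_sum
      by (subst pd_sum) (auto intro!: differentiable_linear'[OF bounded_linear_single] u sum.cong simp: pd_linear[OF bounded_linear_single] u)
    then show ?thesis by (simp add: spinor_of_vec_sum)
  qed
  have act: "clifford_act m \<sigma> (axis i 1) v = block_act m (\<sigma> i) v" for i v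
  proof -
    have "clifford_act m \<sigma> (axis i 1) v = (\<Sum>j\<in>UNIV. if j = i then block_act m (\<sigma> i) v else 0)"
      unfolding clifford_act_def by (intro sum.cong refl) (auto simp: axis_def)
    then show ?thesis by (simp add: sum.delta)
  qed
  have "Dirac (\<lambda>x. spinor_of_vec m (u x)) x
     = (\<Sum>i\<in>UNIV. block_act m (\<sigma> i) (spinor_of_vec m (vec m (\<lambda>k. partial_deriv i (\<lambda>y. vec_index (u y) k) x))))"
    unfolding Dirac_def sum_Basis_axis act pdU partial_deriv_pd ..
  also have "\<dots> = spinor_of_vec m (dirac_op m \<sigma> u x)"
  proof (rule spinor_eqI)
    fix j
    show "entry (\<Sum>i\<in>UNIV. block_act m (\<sigma> i) (spinor_of_vec m (vec m (\<lambda>k. partial_deriv i (\<lambda>y. vec_index (u y) k) x)))) j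
       = entry (spinor_of_vec m (dirac_op m \<sigma> u x)) j"
    \<comment> \<open>Outside the first block both sides vanish.\<close>
    proof (cases "j < m")
      case True
      have *: "(\<Sum>l<m. \<sigma> i $$ (j, l) * w l) = vec_index (\<sigma> i *\<^sub>v vec m w) j" for w i
        using C[of i] True by (simp add: scalar_prod_def lessThan_atLeast0)
      show ?thesis using True
        by (simp add: entry_sum entry_block_act[OF m] entry_spinor_of_vec dirac_op_def *)
    next
      case False
      then have "j div m \<ge> 1" using m by (simp add: div_greater_zero_iff Suc_le_eq)
      then have "j div m * m \<ge> 1 * m" by (rule mult_le_mono1)
      then have "\<not> j div m * m + l < m" for l by linarith
      then show ?thesis using False by (simp add: entry_sum entry_block_act[OF m] entry_spinor_of_vec)
    qed
  qed
  finally show ?thesis .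
qed

text \<open>
  Sets of integers are closed, so a real number outside has a positive distance.
\<close>

lemma integer_gap_positive:
  fixes a :: real
  assumes "\<And>l. l \<in> A \<Longrightarrow> a \<noteq> real_of_int l"
  obtains d where "d > 0" "\<And>l. l \<in> A \<Longrightarrow> d \<le> \<bar>real_of_int l - a\<bar>"
proof (cases "A = {}")
  case True
  then show ?thesis using that[of 1] by simp
next
  case False
  have "closed (real_of_int ` A)" by (rule closed_of_int_image)
  then have "infdist a (real_of_int ` A) > 0"
    using False assms by (intro infdist_pos_not_in_closed) auto
  moreover have "infdist a (real_of_int ` A) \<le> \<bar>real_of_int l - a\<bar>" if "l \<in> A" for l
    using infdist_le[of "real_of_int l" "real_of_int ` A" a] that by (simp add: dist_real_def abs_minus_commute)
  ultimately show ?thesis using that by blast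
qed

theorem theorem1p2:
  fixes b :: real
  assumes "CARD('n::finite) > 2"
    and "(real CARD('n) - 2 - b) / 2 \<notin> \<int> - real_of_int ` {1..int CARD('n) - 2}"
  shows "\<exists>C>0. \<forall>m>0. \<forall>\<sigma> :: 'n \<Rightarrow> complex mat. clifford_matrices m \<sigma> \<longrightarrow>
           (\<forall>u \<in> test_functions (- {0 :: real ^ 'n}) m.
              (\<integral>x. norm x powr (- b) * (vec_norm2 (dirac_op m \<sigma> u x))\<^sup>2 \<partial>lborel)
              \<ge> C * (\<integral>x. norm x powr (- (b * real CARD('n) / (real CARD('n) - 2)))
                             * vec_norm2 (u x) powr sobolev_exponent CARD('n) \<partial>lborel)
                    powr (2 / sobolev_exponent CARD('n)))"
proof -
  define n where "n = real CARD('n)"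
  define \<kappa> where "\<kappa> = (n - 2 - b) / 2"
  have n: "n > 2" using assms(1) by (simp add: n_def)
  have DIM: "DIM(real ^ 'n) = CARD('n)" by simp
  \<comment> \<open>The hypothesis on \<open>b\<close>: an integer \<open>\<kappa>\<close> lies in \<open>{1..n - 2}\<close>, so \<open>- \<kappa>\<close> is not a monogenic degree.\<close>
  have "- \<kappa> \<noteq> real_of_int l" if l: "l \<in> monogenic_degrees CARD('n)" for l
  proof
    assume "- \<kappa> = real_of_int l"
    then have \<kappa>: "\<kappa> = real_of_int (- l)" by simp
    then have "\<kappa> \<in> real_of_int ` {1..int CARD('n) - 2}" using assms(2) unfolding \<kappa>_def n_def by (metis DiffI Ints_of_int)
    then have "- l \<in> {1..int CARD('n) - 2}" unfolding \<kappa> by (metis image_iff of_int_eq_iff)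
    then show False using l by (auto simp: monogenic_degrees_def)
  qed
  then obtain d where d: "d > 0" "\<And>l. l \<in> monogenic_degrees CARD('n) \<Longrightarrow> d \<le> \<bar>real_of_int l - (- \<kappa>)\<bar>"
    using integer_gap_positive[of "monogenic_degrees CARD('n)" "- \<kappa>"] by metis
  define K where "K = (2 * (n - 1) / (n - 2))\<^sup>2 * (2 + b\<^sup>2 / (2 * d\<^sup>2))"
  have K: "K > 0" unfolding K_def using n by (intro mult_pos_pos add_pos_nonneg) auto
  show ?thesis
  proof (intro exI[of _ "1 / K"] conjI allI impI ballI)
    show "1 / K > 0" using K by simp
    fix m :: nat and \<sigma> :: "'n \<Rightarrow> complex mat" and u :: "real ^ 'n \<Rightarrow> complex vec"
    assume m: "m > 0" and \<sigma>: "clifford_matrices m \<sigma>" and u: "u \<in> test_functions (- {0}) m"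
    interpret clifford "clifford_act m \<sigma>" by (rule clifford_clifford_act[OF m \<sigma>])
    let ?U = "\<lambda>x. spinor_of_vec m (u x)"
    note U = test_functionsD[OF u]
    have D: "Dirac ?U x = spinor_of_vec m (dirac_op m \<sigma> u x)" for x
      by (rule Dirac_spinor_of_vec[OF m \<sigma> C2D[OF U(4)]])
    have nD: "norm (Dirac ?U x) = vec_norm2 (dirac_op m \<sigma> u x)" for x
      unfolding D by (rule norm_spinor_of_vec) (simp add: dirac_op_def)
    have nU: "norm (?U x) = vec_norm2 (u x)" for x by (rule norm_spinor_of_vec[OF U(5)])
    have "(\<integral>x. norm x powr (- (b * real CARD('n) / (real CARD('n) - 2))) * norm (?U x) powr (2 * real CARD('n) / (real CARD('n) - 2)) \<partial>lborel)
         powr (2 / (2 * real CARD('n) / (real CARD('n) - 2)))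
       \<le> K * (\<integral>x. norm x powr (- b) * (norm (Dirac ?U x))\<^sup>2 \<partial>lborel)"
      using weighted_dirac_sobolev[of d b ?U] assms(1) d U(1-3) finite_rank_spinor_of_vec[OF clifford_axioms, of m u]
      unfolding K_def n_def \<kappa>_def DIM by simp
    then show "(\<integral>x. norm x powr (- b) * (vec_norm2 (dirac_op m \<sigma> u x))\<^sup>2 \<partial>lborel)
              \<ge> 1 / K * (\<integral>x. norm x powr (- (b * real CARD('n) / (real CARD('n) - 2)))
                             * vec_norm2 (u x) powr sobolev_exponent CARD('n) \<partial>lborel)
                    powr (2 / sobolev_exponent CARD('n))"
      unfolding nD nU sobolev_exponent_def using K by (simp add: field_simps)
  qed
qed

end
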